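(* Let $(F,\omega)$ be a coquasi-bimonad over a 0-cell $\mathcal A$ of a 2-category $\mathcal K$ and $B:\mathcal A\to\mathcal A$ a right $F$-module monad with action $\triangleleft:BF\to B$ and $\psi_{B,F}=(F\times\triangleleft)\circ(\tau_{B,F}\times F)\circ(B\times\Delta)$. Let $\mathcal C={}_{\tau_B}\mathcal T^{(\mathcal A,F,\omega)}$ and, for $X\in\mathcal C$ with coaction $\rho_X:X\to XF$, put $\psi_{B,X}=(X\times\triangleleft)\circ(\tau_{B,X}\times F)\circ(B\times\rho_X)$. Let $\sigma:FF\to B$ be a given 2-cell such that for all $X\in\mathcal C$ $$(X\times\sigma)\circ(\tau_{F,X}\times F)\circ(F\times\tau_{F,X})=\tau_{B,X}\circ(\sigma\times X).$$ The following are equivalent: 1. The 2-cells $\bar\rho_{X,Y}=(X\times Y\times\sigma)\circ(X\times\tau_{F,Y}\times F)\circ(\rho_X\times\rho_Y):XY\to XYB$, $X,Y\in\mathcal C$, satisfy conditions (i)–(v) of the context (i.e. they form an invertible normalized 2-cocycle, in the inverse form, in $\mathrm{EM}^M(\mathcal K)$). 2. $(B,F,\psi_{B,F},\mu_M,\eta_M,\varepsilon_F,\beta)$ is a Sweedler's Hopf datum, where $\mu_M=(\mu\times\sigma)\circ(F\times\tau_{F,F}\times F)\circ(\Delta\times\Delta)$, $\eta_M=\eta_F\times\eta_B$, $\beta=(\omega^{-1}\times F\times F\times F)\circ\Delta_{FFF}$, and the Sweedler's 2-cocycle $\sigma$ is invertible in the convolution algebra $\mathcal K(\mathcal A)(F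F,B)$.
   Context: Conventions: 1-cells are composed by juxtaposition, $\times$ is horizontal and $\circ$ (or juxtaposition) vertical composition of 2-cells; a 1-cell in a formula stands for its identity 2-cell; $F^n=F\cdots F$. For a comonad $D$ and a monad $M$ on $\mathcal A$, 2-cells $D\to M$ have the convolution product $f*g=\mu_M(f\times g)\Delta_D$, unit $\eta_M\varepsilon_D$. Distributive laws: for $F$ with 2-cells $\mu,\eta,\Delta,\varepsilon$, $\tau:FF\to FF$ is left monadic if $\tau(\mu\times F)=(F\times\mu)(\tau\times F)(F\times\tau)$, $\tau(\eta\times F)=F\times\eta$; right monadic if $\tau(F\times\mu)=(\mu\times F)(F\times\tau)(\tau\times F)$, $\tau(F\times\eta)=\eta\times F$; left comonadic if $(\Delta\times F)\tau=(F\times\tau)(\tau\times F)(F\times\Delta)$, $(\varepsilon\times F)\tau=F\times\varepsilon$; right comonadic if $(F\times\Delta)\tau=(\tau\times F)(F\times\tau)(\Delta\times F)$, $(F\times\varepsilon)\tau=\varepsilon\times F$. Coquasi-bimonad: $(\mathcal A,F,\mu,\eta,\Delta,\varepsilon,\tau=\tau_{F,F},\omega)$ where $(F,\Delta,\varepsilon)$ is a comonad, $\tau$ is left and right monadic and left and right comonadic, $\mu(\eta\times F)=F=\mu(F\times\eta)$, $\Delta\mu=(\mu\times\mu)(F\times\tau\times F)(\Delta\times\Delta)$, $\Delta\eta=\eta\times\eta$, $\varepsilon\mu=\varepsilon\times\varepsilon$, $\varepsilon\eta=\mathrm{Id}$. With $\Delta_{FF}=(F\times\tau\times F)(\Delta\times\Delta)$,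 $\Delta_{FFF}=(F^2\times\tau\times F^2)(F\times\tau\times\tau\times F)(\Delta\times\Delta\times\Delta)$ (and similarly $\Delta_{FFFF}$), $\omega:FFF\to\mathrm{Id}_{\mathcal A}$ is convolution invertible, normalized ($\omega(F\times\eta\times F)=\varepsilon\times\varepsilon$), $(\omega\times\mu(\mu\times F))\Delta_{FFF}=(\mu(F\times\mu)\times\omega)\Delta_{FFF}$, and $(\varepsilon\times\omega)*\omega(F\times\mu\times F)*(\omega\times\varepsilon)=\omega(F\times F\times\mu)*\omega(\mu\times F\times F)$ in convolution on $F^4$. It is moreover a 0-cell of $\mathrm{CQB}(\mathcal K)$: $F\times\omega=(\omega\times F)(F^2\times\tau)(F\times\tau\times F)(\tau\times F^2)$. $\mathrm{CQB}(\mathcal K)(F)$: objects $(X,\tau_{F,X}:FX\to XF)$, $X:\mathcal A\to\mathcal A$, with $\tau_{F,X}(\mu\times X)=(X\times\mu)(\tau_{F,X}\times F)(F\times\tau_{F,X})$, $\tau_{F,X}(\eta\times X)=X\times\eta$, $(X\times\Delta)\tau_{F,X}=(\tau_{F,X}\times F)(F\times\tau_{F,X})(\Delta\times X)$, $(X\times\varepsilon)\tau_{F,X}=\varepsilon\times X$, $\omega\times X=(X\times\omega)(\tau_{F,X}\times F^2)(F\times\tau_{F,X}\times F)(F^2\times\tau_{F,X})$, $(X\times\tau)(\tau_{F,X}\times F)(F\times\tau_{F,X})=(\tau_{F,X}\times F)(F\times\tau_{F,X})(\tau\times X)$. $\mathcal T^{(\mathcal A,F,\omega)}$ (right Tambara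 comodules): $(X,\tau_{F,X},\rho_X)$ with $(X,\tau_{F,X})\in\mathrm{CQB}(\mathcal K)(F)$, $\rho_X:X\to XF$ a right $F$-coaction with $(\rho_X\times F)\tau_{F,X}=(X\times\tau)(\tau_{F,X}\times F)(F\times\rho_X)$. $\mathcal T(\mathcal A,B)$: pairs $(X,\psi:BX\to XB)$ with $\psi(\mu_B\times X)=(X\times\mu_B)(\psi\times B)(B\times\psi)$, $\psi(\eta_B\times X)=X\times\eta_B$. Right $F$-module monad: $\triangleleft=(\varepsilon\times B)\psi_{B,F}$ satisfies $\mu_B(\triangleleft\times B)(B\times\psi_{B,F})=\triangleleft(\mu_B\times F)$, $\triangleleft(\eta_B\times F)=\eta_B\varepsilon_F$. The category ${}_{\tau_B}\mathcal T^{(\mathcal A,F,\omega)}$: objects $(X,\tau_{B,X},\tau_{F,X})$ (with $\rho_X$), where $(X,\tau_{F,X},\rho_X)\in\mathcal T^{(\mathcal A,F,\omega)}$, $(X,\tau_{B,X})\in\mathcal T(\mathcal A,B)$, $(\rho_X\times B)\tau_{B,X}=(X\times\tau_{B,F})(\tau_{B,X}\times F)(B\times\rho_X)$, $(X\times\tau_{B,F})(\tau_{B,X}\times F)(B\times\tau_{F,X})=(\tau_{F,X}\times B)(F\times\tau_{B,X})(\tau_{B,F}\times X)$, $\tau_{B,X}(\triangleleft\times X)=(X\times\triangleleft)(\tau_{B,X}\times F)(B\times\tau_{F,X})$; these conditions are assumed to include the case $X=F$ (with $\tau_{F,F}=\tau$, $\rho_F=\Delta$ and the given $\tau_{B,F}$).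 Also $B\times\omega=(\omega\times B)(F^2\times\tau_{B,F})(F\times\tau_{B,F}\times F)(\tau_{B,F}\times F^2)$. Morphisms are right $F$-colinear 2-cells $\zeta$ with $(\zeta\times B)\tau_{B,X}=\tau_{B,Y}(B\times\zeta)$, $(\zeta\times F)\tau_{F,X}=\tau_{F,Y}(F\times\zeta)$. It is monoidal: $XY$ has $\tau_{-,XY}=(X\times\tau_{-,Y})(\tau_{-,X}\times Y)$, coaction $(XY\times\mu)(X\times\tau_{F,Y}\times F)(\rho_X\times\rho_Y)$, identity unit constraints, and associativity $\alpha_{X,Y,Z}=(XYZ\times\omega)(XY\times\tau_{F,Z}\times F^2)(X\times\tau_{F,Y}\times\tau_{F,Z}\times F)(\rho_X\times\rho_Y\times\rho_Z)$. Conditions on $\bar\rho$, with $\psi_{B,XY}=(X\times\psi_{B,Y})(\psi_{B,X}\times Y)$: (i) $(\zeta\times\xi\times B)\bar\rho_{X,Y}=\bar\rho_{X',Y'}(\zeta\times\xi)$ for morphisms $\zeta,\xi$ of $\mathcal C$; (ii) there is $\bar\rho^{-1}_{X,Y}:XY\to XYB$ with $(XY\times\mu_B)(\bar\rho^{-1}_{X,Y}\times B)\bar\rho_{X,Y}=XY\times\eta_B=(XY\times\mu_B)(\bar\rho_{X,Y}\times B)\bar\rho^{-1}_{X,Y}$; (iii) $(XY\times\mu_B)(\bar\rho_{X,Y}\times B)\psi_{B,XY}=(XY\times\mu_B)(\psi_{B,XY}\times B)(B\times\bar\rho_{X,Y})$; (iv) $(\alpha\times\mu_B)(\bar\rho_{XY,Z}\times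 B)(XY\times\psi_{B,Z})(\bar\rho_{X,Y}\times Z)=(XYZ\times\mu_B)(\bar\rho_{X,YZ}\times B)(X\times\bar\rho_{Y,Z})$; (v) $\bar\rho_{X,\mathrm{Id}}=X\times\eta_B=\bar\rho_{\mathrm{Id},X}$. These are the conditions under which $(X,M)\mapsto XM$ is an action of $\mathcal C$ on the category of left $B$-modules with associativity $X(YM)\to(XY)M$ given by $(XY\times\nu_M)(\bar\rho_{X,Y}\times M)$. Sweedler's Hopf datum $(B,F,\psi,\mu_M,\eta_M,\varepsilon_F,\beta)$: $B$ a monad and $F$ a 1-cell on $\mathcal A$, $\psi:BF\to FB$, $\mu_M:FF\to FB$, $\eta_M:\mathrm{Id}\to FB$, $\varepsilon_F:F\to\mathrm{Id}$, and $\beta:FFF\to FFF$ a 3-cocycle on $FFF$ in $\mathcal K$ (a 3-cocycle is a natural operator $\rho_{X,Y,Z}:XYZ\to XYZ$ with $(X\times\rho_{Y,Z,W})\rho_{X,YZ,W}(\rho_{X,Y,Z}\times W)=\rho_{X,Y,ZW}\rho_{XY,Z,W}$); putting $\triangleleft=(\varepsilon_F\times B)\psi$ and $\sigma=(\varepsilon_F\times B)\mu_M$ (called Sweedler's 2-cocycle), the following hold: $\mu_B(\triangleleft\times B)(B\times\psi)=\triangleleft(\mu_B\times F)$; $\triangleleft(\eta_B\times F)=\eta_B\varepsilon_F$; $\mu_B(\sigma\times B)(F\times\psi)(\psi\times F)=\mu_B(\triangleleft\times B)(B\times\mu_M)$; $\mu_B(\varepsilon_F\times B\times B)(\eta_M\times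 B)=\mu_B(\triangleleft\times B)(B\times\eta_M)$; $\mu_B(\sigma\times B)(F\times\mu_M)\beta=\mu_B(\sigma\times B)(F\times\psi)(\mu_M\times F)$; $\mu_B(\sigma\times B)(F\times\psi)(\eta_M\times F)=\eta_B\varepsilon_F=\mu_B(\sigma\times B)(F\times\eta_M)$.
   Formalization: In (iii) the right-hand ψ_{B,XY} is that of the object XY of 𝒞 (with coaction ρ_{XY}), not the composite (X×ψ_{B,Y})(ψ_{B,X}×Y), and the action of F on B is assumed unital, ◁(B×η_F)=B; without either change the equivalence is false. *)

theory Defs
  imports Main
begin

section \<open>Strict 2-categories\<close>

text \<open>
  Composition of 1-cells (juxtaposition) and horizontal composition of 2-cells are written in
  applicative order: \<open>g \<star> f\<close> is "\<open>g\<close> after \<open>f\<close>", and \<open>\<beta> \<bullet> \<alpha>\<close> is vertical composition,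
  "\<open>\<beta>\<close> after \<open>\<alpha>\<close>".  The operations are total functions; only their values on composable cells
  are constrained.
\<close>

record ('o, 'c, 'd) two_cat =
  zero_cells :: "'o set"
  one_cells :: "'c set"
  two_cells :: "'d set"
  src :: "'c \<Rightarrow> 'o"
  tgt :: "'c \<Rightarrow> 'o"
  dom2 :: "'d \<Rightarrow> 'c"
  cod2 :: "'d \<Rightarrow> 'c"
  id1 :: "'o \<Rightarrow> 'c"
  comp1 :: "'c \<Rightarrow> 'c \<Rightarrow> 'c"  (infixr "\<star>\<index>" 75)
  id2 :: "'c \<Rightarrow> 'd"
  hcomp :: "'d \<Rightarrow> 'd \<Rightarrow> 'd"  (infixr "\<otimes>\<index>" 70)
  vcomp :: "'d \<Rightarrow> 'd \<Rightarrow> 'd"  (infixr "\<bullet>\<index>" 65)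

definition hom2 :: "('o, 'c, 'd) two_cat \<Rightarrow> 'c \<Rightarrow> 'c \<Rightarrow> 'd set"  ("Hom\<index>") where
  "hom2 K f g = {\<alpha> \<in> two_cells K. dom2 K \<alpha> = f \<and> cod2 K \<alpha> = g}"

definition endo :: "('o, 'c, 'd) two_cat \<Rightarrow> 'o \<Rightarrow> 'c set" where
  "endo K A = {f \<in> one_cells K. src K f = A \<and> tgt K f = A}"

locale two_category =
  fixes K :: "('o, 'c, 'd) two_cat" (structure)
  assumes src_tgt: "f \<in> one_cells K \<Longrightarrow> src K f \<in> zero_cells K \<and> tgt K f \<in> zero_cells K"
    and id1: "a \<in> zero_cells K \<Longrightarrow> id1 K a \<in> one_cells K \<and> src K (id1 K a) = a \<and> tgt K (id1 K a) = a"
    and comp1: "\<lbrakk>f \<in> one_cells K; g \<in> one_cells K; src K g = tgt K f\<rbrakk>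
      \<Longrightarrow> g \<star> f \<in> one_cells K \<and> src K (g \<star> f) = src K f \<and> tgt K (g \<star> f) = tgt K g"
    and comp1_assoc: "\<lbrakk>f \<in> one_cells K; g \<in> one_cells K; h \<in> one_cells K;
        src K g = tgt K f; src K h = tgt K g\<rbrakk> \<Longrightarrow> (h \<star> g) \<star> f = h \<star> g \<star> f"
    and comp1_unit: "f \<in> one_cells K
      \<Longrightarrow> id1 K (tgt K f) \<star> f = f \<and> f \<star> id1 K (src K f) = f"
    and dom_cod: "\<alpha> \<in> two_cells K \<Longrightarrow> dom2 K \<alpha> \<in> one_cells K \<and> cod2 K \<alpha> \<in> one_cells K
        \<and> src K (dom2 K \<alpha>) = src K (cod2 K \<alpha>) \<and> tgt K (dom2 K \<alpha>) = tgt K (cod2 K \<alpha>)"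
    and id2: "f \<in> one_cells K \<Longrightarrow> id2 K f \<in> Hom f f"
    and vcomp: "\<lbrakk>\<alpha> \<in> Hom f g; \<beta> \<in> Hom g h\<rbrakk> \<Longrightarrow> \<beta> \<bullet> \<alpha> \<in> Hom f h"
    and vcomp_assoc: "\<lbrakk>\<alpha> \<in> Hom f g; \<beta> \<in> Hom g h; \<gamma> \<in> Hom h k\<rbrakk>
      \<Longrightarrow> (\<gamma> \<bullet> \<beta>) \<bullet> \<alpha> = \<gamma> \<bullet> \<beta> \<bullet> \<alpha>"
    and vcomp_unit: "\<alpha> \<in> Hom f g \<Longrightarrow> id2 K g \<bullet> \<alpha> = \<alpha> \<and> \<alpha> \<bullet> id2 K f = \<alpha>"
    and hcomp: "\<lbrakk>\<alpha> \<in> Hom f f'; \<beta> \<in> Hom g g'; src K g = tgt K f\<rbrakk>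
      \<Longrightarrow> \<beta> \<otimes> \<alpha> \<in> Hom (g \<star> f) (g' \<star> f')"
    and hcomp_assoc: "\<lbrakk>\<alpha> \<in> Hom f f'; \<beta> \<in> Hom g g'; \<gamma> \<in> Hom h h'; src K g = tgt K f; src K h = tgt K g\<rbrakk>
      \<Longrightarrow> (\<gamma> \<otimes> \<beta>) \<otimes> \<alpha> = \<gamma> \<otimes> \<beta> \<otimes> \<alpha>"
    and hcomp_unit: "\<alpha> \<in> Hom f f' \<Longrightarrow> id2 K (id1 K (tgt K f)) \<otimes> \<alpha> = \<alpha>
        \<and> \<alpha> \<otimes> id2 K (id1 K (src K f)) = \<alpha>"
    and id2_comp1: "\<lbrakk>f \<in> one_cells K; g \<in> one_cells K; src K g = tgt K f\<rbrakk>
      \<Longrightarrow> id2 K (g \<star> f) = id2 K g \<otimes> id2 K f"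
    and interchange: "\<lbrakk>\<alpha> \<in> Hom f f'; \<alpha>' \<in> Hom f' f''; \<beta> \<in> Hom g g'; \<beta>' \<in> Hom g' g''; src K g = tgt K f\<rbrakk>
      \<Longrightarrow> (\<beta>' \<bullet> \<beta>) \<otimes> (\<alpha>' \<bullet> \<alpha>) = (\<beta>' \<otimes> \<alpha>') \<bullet> (\<beta> \<otimes> \<alpha>)"


section \<open>Endo-1-cells with structure 2-cells\<close>

record 'c cell1 =
  cell :: 'c

record ('c, 'd) algebra_data = "'c cell1" +
  mul :: 'd  ("\<mu>\<index>")
  unt :: 'd  ("\<eta>\<index>")

record ('c, 'd) coquasi_data = "('c, 'd) algebra_data" +
  comul :: 'd  ("\<Delta>\<index>")
  counit :: 'd  ("\<epsilon>\<index>")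
  dist :: 'd  ("\<tau>\<index>")
  omega :: 'd  ("\<omega>\<index>")

text \<open>For \<open>B\<close>: the action \<open>BF \<rightarrow> B\<close> and \<open>tauBF B = \<tau>\<^bsub>B,F\<^esub> : BF \<rightarrow> FB\<close>.\<close>

record ('c, 'd) module_data = "('c, 'd) algebra_data" +
  act :: 'd  ("\<lhd>\<index>")
  tauBF :: 'd

text \<open>\<open>tauF X = \<tau>\<^bsub>F,X\<^esub> : FX \<rightarrow> XF\<close>, \<open>tauB X = \<tau>\<^bsub>B,X\<^esub> : BX \<rightarrow> XB\<close>, and the right coaction \<open>X \<rightarrow> XF\<close>.\<close>

record ('c, 'd) tobj = "'c cell1" +
  tauF :: 'd
  tauB :: 'd
  coact :: 'd  ("\<rho>\<index>")

text \<open>The left-handed analogue: \<open>tauL X = \<tau>\<^bsub>X,F\<^esub> : XF \<rightarrow> FX\<close> and a left coaction \<open>X \<rightarrow> FX\<close>.\<close>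

record ('c, 'd) ltobj = "'c cell1" +
  tauL :: 'd
  lcoact :: 'd

abbreviation ident :: "('o, 'c, 'd) two_cat \<Rightarrow> ('c, 'z) cell1_scheme \<Rightarrow> 'd"  ("\<langle>_\<rangle>\<index>") where
  "ident K X \<equiv> id2 K (cell X)"


section \<open>Monads, comonads, distributive laws, convolution\<close>

context
  fixes K :: "('o, 'c, 'd) two_cat" (structure) and A :: 'o
begin

definition monad :: "('c, 'd, 'z) algebra_data_scheme \<Rightarrow> bool" where
  "monad M \<longleftrightarrow> cell M \<in> endo K A
    \<and> \<mu>\<^bsub>M\<^esub> \<in> Hom (cell M \<star> cell M) (cell M) \<and> \<eta>\<^bsub>M\<^esub> \<in> Hom (id1 K A) (cell M)
    \<and> \<mu>\<^bsub>M\<^esub> \<bullet> (\<mu>\<^bsub>M\<^esub> \<otimes> \<langle>M\<rangle>) = \<mu>\<^bsub>M\<^esub> \<bullet> (\<langle>M\<rangle> \<otimes> \<mu>\<^bsub>M\<^esub>)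
    \<and> \<mu>\<^bsub>M\<^esub> \<bullet> (\<eta>\<^bsub>M\<^esub> \<otimes> \<langle>M\<rangle>) = \<langle>M\<rangle> \<and> \<mu>\<^bsub>M\<^esub> \<bullet> (\<langle>M\<rangle> \<otimes> \<eta>\<^bsub>M\<^esub>) = \<langle>M\<rangle>"

definition comonad :: "('c, 'd) coquasi_data \<Rightarrow> bool" where
  "comonad D \<longleftrightarrow> cell D \<in> endo K A
    \<and> \<Delta>\<^bsub>D\<^esub> \<in> Hom (cell D) (cell D \<star> cell D) \<and> \<epsilon>\<^bsub>D\<^esub> \<in> Hom (cell D) (id1 K A)
    \<and> (\<Delta>\<^bsub>D\<^esub> \<otimes> \<langle>D\<rangle>) \<bullet> \<Delta>\<^bsub>D\<^esub> = (\<langle>D\<rangle> \<otimes> \<Delta>\<^bsub>D\<^esub>) \<bullet> \<Delta>\<^bsub>D\<^esub>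
    \<and> (\<epsilon>\<^bsub>D\<^esub> \<otimes> \<langle>D\<rangle>) \<bullet> \<Delta>\<^bsub>D\<^esub> = \<langle>D\<rangle> \<and> (\<langle>D\<rangle> \<otimes> \<epsilon>\<^bsub>D\<^esub>) \<bullet> \<Delta>\<^bsub>D\<^esub> = \<langle>D\<rangle>"

text \<open>
  Compatibility of \<open>t : MX \<rightarrow> XM\<close> (left monadic), \<open>t : XM \<rightarrow> MX\<close> (right monadic),
  \<open>t : XD \<rightarrow> DX\<close> (left comonadic), \<open>t : DX \<rightarrow> XD\<close> (right comonadic) with the structure of
  \<open>M\<close>, \<open>D\<close>.  The laws for \<open>t : FF \<rightarrow> FF\<close> are the case \<open>X = F\<close>.
\<close>

definition left_monadic :: "('c, 'd, 'z) algebra_data_scheme \<Rightarrow> ('c, 'y) cell1_scheme \<Rightarrow> 'd \<Rightarrow> bool" where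
  "left_monadic M X t \<longleftrightarrow> t \<in> Hom (cell M \<star> cell X) (cell X \<star> cell M)
    \<and> t \<bullet> (\<mu>\<^bsub>M\<^esub> \<otimes> \<langle>X\<rangle>) = (\<langle>X\<rangle> \<otimes> \<mu>\<^bsub>M\<^esub>) \<bullet> (t \<otimes> \<langle>M\<rangle>) \<bullet> (\<langle>M\<rangle> \<otimes> t)
    \<and> t \<bullet> (\<eta>\<^bsub>M\<^esub> \<otimes> \<langle>X\<rangle>) = \<langle>X\<rangle> \<otimes> \<eta>\<^bsub>M\<^esub>"

definition right_monadic :: "('c, 'd, 'z) algebra_data_scheme \<Rightarrow> ('c, 'y) cell1_scheme \<Rightarrow> 'd \<Rightarrow> bool" where
  "right_monadic M X t \<longleftrightarrow> t \<in> Hom (cell X \<star> cell M) (cell M \<star> cell X)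
    \<and> t \<bullet> (\<langle>X\<rangle> \<otimes> \<mu>\<^bsub>M\<^esub>) = (\<mu>\<^bsub>M\<^esub> \<otimes> \<langle>X\<rangle>) \<bullet> (\<langle>M\<rangle> \<otimes> t) \<bullet> (t \<otimes> \<langle>M\<rangle>)
    \<and> t \<bullet> (\<langle>X\<rangle> \<otimes> \<eta>\<^bsub>M\<^esub>) = \<eta>\<^bsub>M\<^esub> \<otimes> \<langle>X\<rangle>"

definition left_comonadic :: "('c, 'd) coquasi_data \<Rightarrow> ('c, 'y) cell1_scheme \<Rightarrow> 'd \<Rightarrow> bool" where
  "left_comonadic D X t \<longleftrightarrow> t \<in> Hom (cell X \<star> cell D) (cell D \<star> cell X)
    \<and> (\<Delta>\<^bsub>D\<^esub> \<otimes> \<langle>X\<rangle>) \<bullet> t = (\<langle>D\<rangle> \<otimes> t) \<bullet> (t \<otimes> \<langle>D\<rangle>) \<bullet> (\<langle>X\<rangle> \<otimes> \<Delta>\<^bsub>D\<^esub>)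
    \<and> (\<epsilon>\<^bsub>D\<^esub> \<otimes> \<langle>X\<rangle>) \<bullet> t = \<langle>X\<rangle> \<otimes> \<epsilon>\<^bsub>D\<^esub>"

definition right_comonadic :: "('c, 'd) coquasi_data \<Rightarrow> ('c, 'y) cell1_scheme \<Rightarrow> 'd \<Rightarrow> bool" where
  "right_comonadic D X t \<longleftrightarrow> t \<in> Hom (cell D \<star> cell X) (cell X \<star> cell D)
    \<and> (\<langle>X\<rangle> \<otimes> \<Delta>\<^bsub>D\<^esub>) \<bullet> t = (t \<otimes> \<langle>D\<rangle>) \<bullet> (\<langle>D\<rangle> \<otimes> t) \<bullet> (\<Delta>\<^bsub>D\<^esub> \<otimes> \<langle>X\<rangle>)
    \<and> (\<langle>X\<rangle> \<otimes> \<epsilon>\<^bsub>D\<^esub>) \<bullet> t = \<epsilon>\<^bsub>D\<^esub> \<otimes> \<langle>X\<rangle>"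

text \<open>Convolution with respect to a multiplication \<open>m\<close> and a comultiplication \<open>d\<close>.\<close>

definition conv :: "'d \<Rightarrow> 'd \<Rightarrow> 'd \<Rightarrow> 'd \<Rightarrow> 'd" where
  "conv m d f g = m \<bullet> (f \<otimes> g) \<bullet> d"

definition is_conv_inverse :: "'d \<Rightarrow> 'd \<Rightarrow> 'd \<Rightarrow> 'd \<Rightarrow> 'd \<Rightarrow> 'd \<Rightarrow> bool" where
  "is_conv_inverse m u d e f g \<longleftrightarrow> conv m d f g = u \<bullet> e \<and> conv m d g f = u \<bullet> e"


section \<open>Coquasi-bimonads\<close>

definition Delta2 :: "('c, 'd) coquasi_data \<Rightarrow> 'd" where
  "Delta2 F = (\<langle>F\<rangle> \<otimes> \<tau>\<^bsub>F\<^esub> \<otimes> \<langle>F\<rangle>) \<bullet> (\<Delta>\<^bsub>F\<^esub> \<otimes> \<Delta>\<^bsub>F\<^esub>)"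

definition Delta3 :: "('c, 'd) coquasi_data \<Rightarrow> 'd" where
  "Delta3 F = (\<langle>F\<rangle> \<otimes> \<langle>F\<rangle> \<otimes> \<tau>\<^bsub>F\<^esub> \<otimes> \<langle>F\<rangle> \<otimes> \<langle>F\<rangle>) \<bullet> (\<langle>F\<rangle> \<otimes> \<tau>\<^bsub>F\<^esub> \<otimes> \<tau>\<^bsub>F\<^esub> \<otimes> \<langle>F\<rangle>)
      \<bullet> (\<Delta>\<^bsub>F\<^esub> \<otimes> \<Delta>\<^bsub>F\<^esub> \<otimes> \<Delta>\<^bsub>F\<^esub>)"

definition Delta4 :: "('c, 'd) coquasi_data \<Rightarrow> 'd" where
  "Delta4 F = (\<langle>F\<rangle> \<otimes> \<langle>F\<rangle> \<otimes> \<langle>F\<rangle> \<otimes> \<tau>\<^bsub>F\<^esub> \<otimes> \<langle>F\<rangle> \<otimes> \<langle>F\<rangle> \<otimes> \<langle>F\<rangle>)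
      \<bullet> (\<langle>F\<rangle> \<otimes> \<langle>F\<rangle> \<otimes> \<tau>\<^bsub>F\<^esub> \<otimes> \<tau>\<^bsub>F\<^esub> \<otimes> \<langle>F\<rangle> \<otimes> \<langle>F\<rangle>)
      \<bullet> (\<langle>F\<rangle> \<otimes> \<tau>\<^bsub>F\<^esub> \<otimes> \<tau>\<^bsub>F\<^esub> \<otimes> \<tau>\<^bsub>F\<^esub> \<otimes> \<langle>F\<rangle>)
      \<bullet> (\<Delta>\<^bsub>F\<^esub> \<otimes> \<Delta>\<^bsub>F\<^esub> \<otimes> \<Delta>\<^bsub>F\<^esub> \<otimes> \<Delta>\<^bsub>F\<^esub>)"

text \<open>\<open>w\<close> is inverse to \<open>\<omega>\<close> in the convolution algebra of 2-cells from the comonad \<open>FFF\<close> to the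
  identity monad.\<close>

definition omega_inverse :: "('c, 'd) coquasi_data \<Rightarrow> 'd \<Rightarrow> bool" where
  "omega_inverse F w \<longleftrightarrow> w \<in> Hom (cell F \<star> cell F \<star> cell F) (id1 K A)
    \<and> is_conv_inverse (id2 K (id1 K A)) (id2 K (id1 K A)) (Delta3 F) (\<epsilon>\<^bsub>F\<^esub> \<otimes> \<epsilon>\<^bsub>F\<^esub> \<otimes> \<epsilon>\<^bsub>F\<^esub>) \<omega>\<^bsub>F\<^esub> w"

definition coquasi_bimonad :: "('c, 'd) coquasi_data \<Rightarrow> bool" where
  "coquasi_bimonad F \<longleftrightarrow> comonad F
    \<and> left_monadic F F \<tau>\<^bsub>F\<^esub> \<and> right_monadic F F \<tau>\<^bsub>F\<^esub>
    \<and> left_comonadic F F \<tau>\<^bsub>F\<^esub> \<and> right_comonadic F F \<tau>\<^bsub>F\<^esub>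
    \<and> \<mu>\<^bsub>F\<^esub> \<in> Hom (cell F \<star> cell F) (cell F) \<and> \<eta>\<^bsub>F\<^esub> \<in> Hom (id1 K A) (cell F)
    \<and> \<mu>\<^bsub>F\<^esub> \<bullet> (\<eta>\<^bsub>F\<^esub> \<otimes> \<langle>F\<rangle>) = \<langle>F\<rangle> \<and> \<mu>\<^bsub>F\<^esub> \<bullet> (\<langle>F\<rangle> \<otimes> \<eta>\<^bsub>F\<^esub>) = \<langle>F\<rangle>
    \<and> \<Delta>\<^bsub>F\<^esub> \<bullet> \<mu>\<^bsub>F\<^esub> = (\<mu>\<^bsub>F\<^esub> \<otimes> \<mu>\<^bsub>F\<^esub>) \<bullet> (\<langle>F\<rangle> \<otimes> \<tau>\<^bsub>F\<^esub> \<otimes> \<langle>F\<rangle>) \<bullet> (\<Delta>\<^bsub>F\<^esub> \<otimes> \<Delta>\<^bsub>F\<^esub>)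
    \<and> \<Delta>\<^bsub>F\<^esub> \<bullet> \<eta>\<^bsub>F\<^esub> = \<eta>\<^bsub>F\<^esub> \<otimes> \<eta>\<^bsub>F\<^esub>
    \<and> \<epsilon>\<^bsub>F\<^esub> \<bullet> \<mu>\<^bsub>F\<^esub> = \<epsilon>\<^bsub>F\<^esub> \<otimes> \<epsilon>\<^bsub>F\<^esub>
    \<and> \<epsilon>\<^bsub>F\<^esub> \<bullet> \<eta>\<^bsub>F\<^esub> = id2 K (id1 K A)
    \<and> \<omega>\<^bsub>F\<^esub> \<in> Hom (cell F \<star> cell F \<star> cell F) (id1 K A)
    \<and> (\<exists>w. omega_inverse F w)
    \<and> \<omega>\<^bsub>F\<^esub> \<bullet> (\<langle>F\<rangle> \<otimes> \<eta>\<^bsub>F\<^esub> \<otimes> \<langle>F\<rangle>) = \<epsilon>\<^bsub>F\<^esub> \<otimes> \<epsilon>\<^bsub>F\<^esub>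
    \<and> (\<omega>\<^bsub>F\<^esub> \<otimes> (\<mu>\<^bsub>F\<^esub> \<bullet> (\<mu>\<^bsub>F\<^esub> \<otimes> \<langle>F\<rangle>))) \<bullet> Delta3 F = ((\<mu>\<^bsub>F\<^esub> \<bullet> (\<langle>F\<rangle> \<otimes> \<mu>\<^bsub>F\<^esub>)) \<otimes> \<omega>\<^bsub>F\<^esub>) \<bullet> Delta3 F
    \<and> (let cv = conv (id2 K (id1 K A)) (Delta4 F) in
         cv (cv (\<epsilon>\<^bsub>F\<^esub> \<otimes> \<omega>\<^bsub>F\<^esub>) (\<omega>\<^bsub>F\<^esub> \<bullet> (\<langle>F\<rangle> \<otimes> \<mu>\<^bsub>F\<^esub> \<otimes> \<langle>F\<rangle>))) (\<omega>\<^bsub>F\<^esub> \<otimes> \<epsilon>\<^bsub>F\<^esub>)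
           = cv (\<omega>\<^bsub>F\<^esub> \<bullet> (\<langle>F\<rangle> \<otimes> \<langle>F\<rangle> \<otimes> \<mu>\<^bsub>F\<^esub>)) (\<omega>\<^bsub>F\<^esub> \<bullet> (\<mu>\<^bsub>F\<^esub> \<otimes> \<langle>F\<rangle> \<otimes> \<langle>F\<rangle>)))"

text \<open>Passing \<open>\<omega>\<close> through \<open>X\<close> along \<open>t : FX \<rightarrow> XF\<close>, respectively along \<open>t : XF \<rightarrow> FX\<close>.\<close>

definition omega_natural :: "('c, 'd) coquasi_data \<Rightarrow> ('c, 'y) cell1_scheme \<Rightarrow> 'd \<Rightarrow> bool" where
  "omega_natural F X t \<longleftrightarrow> \<omega>\<^bsub>F\<^esub> \<otimes> \<langle>X\<rangle> =
     (\<langle>X\<rangle> \<otimes> \<omega>\<^bsub>F\<^esub>) \<bullet> (t \<otimes> \<langle>F\<rangle> \<otimes> \<langle>F\<rangle>) \<bullet> (\<langle>F\<rangle> \<otimes> t \<otimes> \<langle>F\<rangle>) \<bullet> (\<langle>F\<rangle> \<otimes> \<langle>F\<rangle> \<otimes> t)"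

definition omega_natural_left :: "('c, 'd) coquasi_data \<Rightarrow> ('c, 'y) cell1_scheme \<Rightarrow> 'd \<Rightarrow> bool" where
  "omega_natural_left F X t \<longleftrightarrow> \<langle>X\<rangle> \<otimes> \<omega>\<^bsub>F\<^esub> =
     (\<omega>\<^bsub>F\<^esub> \<otimes> \<langle>X\<rangle>) \<bullet> (\<langle>F\<rangle> \<otimes> \<langle>F\<rangle> \<otimes> t) \<bullet> (\<langle>F\<rangle> \<otimes> t \<otimes> \<langle>F\<rangle>) \<bullet> (t \<otimes> \<langle>F\<rangle> \<otimes> \<langle>F\<rangle>)"

text \<open>A coquasi-bimonad that is a 0-cell of \<open>CQB(K)\<close>.\<close>

definition CQB_zero_cell :: "('c, 'd) coquasi_data \<Rightarrow> bool" where
  "CQB_zero_cell F \<longleftrightarrow> coquasi_bimonad F \<and> omega_natural_left F F \<tau>\<^bsub>F\<^esub>"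


section \<open>Right Tambara comodules and the category \<open>C\<close>\<close>

definition CQB_object :: "('c, 'd) coquasi_data \<Rightarrow> ('c, 'd) tobj \<Rightarrow> bool" where
  "CQB_object F X \<longleftrightarrow> cell X \<in> endo K A
    \<and> left_monadic F X (tauF X) \<and> right_comonadic F X (tauF X)
    \<and> omega_natural F X (tauF X)
    \<and> (\<langle>X\<rangle> \<otimes> \<tau>\<^bsub>F\<^esub>) \<bullet> (tauF X \<otimes> \<langle>F\<rangle>) \<bullet> (\<langle>F\<rangle> \<otimes> tauF X)
        = (tauF X \<otimes> \<langle>F\<rangle>) \<bullet> (\<langle>F\<rangle> \<otimes> tauF X) \<bullet> (\<tau>\<^bsub>F\<^esub> \<otimes> \<langle>X\<rangle>)"

definition Tambara_comodule :: "('c, 'd) coquasi_data \<Rightarrow> ('c, 'd) tobj \<Rightarrow> bool" where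
  "Tambara_comodule F X \<longleftrightarrow> CQB_object F X
    \<and> \<rho>\<^bsub>X\<^esub> \<in> Hom (cell X) (cell X \<star> cell F)
    \<and> (\<rho>\<^bsub>X\<^esub> \<otimes> \<langle>F\<rangle>) \<bullet> \<rho>\<^bsub>X\<^esub> = (\<langle>X\<rangle> \<otimes> \<Delta>\<^bsub>F\<^esub>) \<bullet> \<rho>\<^bsub>X\<^esub>
    \<and> (\<langle>X\<rangle> \<otimes> \<epsilon>\<^bsub>F\<^esub>) \<bullet> \<rho>\<^bsub>X\<^esub> = \<langle>X\<rangle>
    \<and> (\<rho>\<^bsub>X\<^esub> \<otimes> \<langle>F\<rangle>) \<bullet> tauF X = (\<langle>X\<rangle> \<otimes> \<tau>\<^bsub>F\<^esub>) \<bullet> (tauF X \<otimes> \<langle>F\<rangle>) \<bullet> (\<langle>F\<rangle> \<otimes> \<rho>\<^bsub>X\<^esub>)"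

definition TB_objects :: "('c, 'd) coquasi_data \<Rightarrow> ('c, 'd) module_data \<Rightarrow> ('c, 'd) tobj set" where
  "TB_objects F B = {X. Tambara_comodule F X \<and> left_monadic B X (tauB X)
    \<and> (\<rho>\<^bsub>X\<^esub> \<otimes> \<langle>B\<rangle>) \<bullet> tauB X = (\<langle>X\<rangle> \<otimes> tauBF B) \<bullet> (tauB X \<otimes> \<langle>F\<rangle>) \<bullet> (\<langle>B\<rangle> \<otimes> \<rho>\<^bsub>X\<^esub>)
    \<and> (\<langle>X\<rangle> \<otimes> tauBF B) \<bullet> (tauB X \<otimes> \<langle>F\<rangle>) \<bullet> (\<langle>B\<rangle> \<otimes> tauF X)
        = (tauF X \<otimes> \<langle>B\<rangle>) \<bullet> (\<langle>F\<rangle> \<otimes> tauB X) \<bullet> (tauBF B \<otimes> \<langle>X\<rangle>)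
    \<and> tauB X \<bullet> (\<lhd>\<^bsub>B\<^esub> \<otimes> \<langle>X\<rangle>) = (\<langle>X\<rangle> \<otimes> \<lhd>\<^bsub>B\<^esub>) \<bullet> (tauB X \<otimes> \<langle>F\<rangle>) \<bullet> (\<langle>B\<rangle> \<otimes> tauF X)}"

definition TB_morphisms ::
  "('c, 'd) coquasi_data \<Rightarrow> ('c, 'd) module_data \<Rightarrow> ('c, 'd) tobj \<Rightarrow> ('c, 'd) tobj \<Rightarrow> 'd set" where
  "TB_morphisms F B X Y = {\<zeta> \<in> Hom (cell X) (cell Y).
      (\<zeta> \<otimes> \<langle>F\<rangle>) \<bullet> \<rho>\<^bsub>X\<^esub> = \<rho>\<^bsub>Y\<^esub> \<bullet> \<zeta>
    \<and> (\<zeta> \<otimes> \<langle>B\<rangle>) \<bullet> tauB X = tauB Y \<bullet> (\<langle>B\<rangle> \<otimes> \<zeta>)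
    \<and> (\<zeta> \<otimes> \<langle>F\<rangle>) \<bullet> tauF X = tauF Y \<bullet> (\<langle>F\<rangle> \<otimes> \<zeta>)}"

definition TB_tensor :: "('c, 'd) coquasi_data \<Rightarrow> ('c, 'd) tobj \<Rightarrow> ('c, 'd) tobj \<Rightarrow> ('c, 'd) tobj" where
  "TB_tensor F X Y = \<lparr>cell = cell X \<star> cell Y,
     tauF = (\<langle>X\<rangle> \<otimes> tauF Y) \<bullet> (tauF X \<otimes> \<langle>Y\<rangle>),
     tauB = (\<langle>X\<rangle> \<otimes> tauB Y) \<bullet> (tauB X \<otimes> \<langle>Y\<rangle>),
     coact = (\<langle>X\<rangle> \<otimes> \<langle>Y\<rangle> \<otimes> \<mu>\<^bsub>F\<^esub>) \<bullet> (\<langle>X\<rangle> \<otimes> tauF Y \<otimes> \<langle>F\<rangle>) \<bullet> (\<rho>\<^bsub>X\<^esub> \<otimes> \<rho>\<^bsub>Y\<^esub>)\<rparr>"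

definition TB_unit :: "('c, 'd) coquasi_data \<Rightarrow> ('c, 'd) module_data \<Rightarrow> ('c, 'd) tobj" where
  "TB_unit F B = \<lparr>cell = id1 K A, tauF = \<langle>F\<rangle>, tauB = \<langle>B\<rangle>, coact = \<eta>\<^bsub>F\<^esub>\<rparr>"

definition TB_assoc ::
  "('c, 'd) coquasi_data \<Rightarrow> ('c, 'd) tobj \<Rightarrow> ('c, 'd) tobj \<Rightarrow> ('c, 'd) tobj \<Rightarrow> 'd" where
  "TB_assoc F X Y Z = (\<langle>X\<rangle> \<otimes> \<langle>Y\<rangle> \<otimes> \<langle>Z\<rangle> \<otimes> \<omega>\<^bsub>F\<^esub>) \<bullet> (\<langle>X\<rangle> \<otimes> \<langle>Y\<rangle> \<otimes> tauF Z \<otimes> \<langle>F\<rangle> \<otimes> \<langle>F\<rangle>)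
     \<bullet> (\<langle>X\<rangle> \<otimes> tauF Y \<otimes> tauF Z \<otimes> \<langle>F\<rangle>) \<bullet> (\<rho>\<^bsub>X\<^esub> \<otimes> \<rho>\<^bsub>Y\<^esub> \<otimes> \<rho>\<^bsub>Z\<^esub>)"

definition regular :: "('c, 'd) coquasi_data \<Rightarrow> ('c, 'd) module_data \<Rightarrow> ('c, 'd) tobj" where
  "regular F B = \<lparr>cell = cell F, tauF = \<tau>\<^bsub>F\<^esub>, tauB = tauBF B, coact = \<Delta>\<^bsub>F\<^esub>\<rparr>"

definition psi :: "('c, 'd) coquasi_data \<Rightarrow> ('c, 'd) module_data \<Rightarrow> ('c, 'd) tobj \<Rightarrow> 'd" where
  "psi F B X = (\<langle>X\<rangle> \<otimes> \<lhd>\<^bsub>B\<^esub>) \<bullet> (tauB X \<otimes> \<langle>F\<rangle>) \<bullet> (\<langle>B\<rangle> \<otimes> \<rho>\<^bsub>X\<^esub>)"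

text \<open>
  The action is unital; associativity of the action is not required (it holds only up to a
  2-cocycle).  Unitality says exactly that \<open>\<psi>\<^bsub>B,Id\<^esub>\<close> is the identity of \<open>B\<close>, so that \<open>Id\<close> acts
  as the identity on left \<open>B\<close>-modules.
\<close>

definition right_module_monad :: "('c, 'd) coquasi_data \<Rightarrow> ('c, 'd) module_data \<Rightarrow> bool" where
  "right_module_monad F B \<longleftrightarrow> monad B
    \<and> \<lhd>\<^bsub>B\<^esub> \<in> Hom (cell B \<star> cell F) (cell B)
    \<and> \<lhd>\<^bsub>B\<^esub> \<bullet> (\<langle>B\<rangle> \<otimes> \<eta>\<^bsub>F\<^esub>) = \<langle>B\<rangle>
    \<and> (let \<psi> = psi F B (regular F B) in
         \<lhd>\<^bsub>B\<^esub> = (\<epsilon>\<^bsub>F\<^esub> \<otimes> \<langle>B\<rangle>) \<bullet> \<psi>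
       \<and> \<mu>\<^bsub>B\<^esub> \<bullet> (\<lhd>\<^bsub>B\<^esub> \<otimes> \<langle>B\<rangle>) \<bullet> (\<langle>B\<rangle> \<otimes> \<psi>) = \<lhd>\<^bsub>B\<^esub> \<bullet> (\<mu>\<^bsub>B\<^esub> \<otimes> \<langle>F\<rangle>)
       \<and> \<lhd>\<^bsub>B\<^esub> \<bullet> (\<eta>\<^bsub>B\<^esub> \<otimes> \<langle>F\<rangle>) = \<eta>\<^bsub>B\<^esub> \<bullet> \<epsilon>\<^bsub>F\<^esub>)"

text \<open>The standing conditions on \<open>\<tau>\<^bsub>B,F\<^esub>\<close> that go with the category \<open>C\<close>.\<close>

definition TB_setting :: "('c, 'd) coquasi_data \<Rightarrow> ('c, 'd) module_data \<Rightarrow> bool" where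
  "TB_setting F B \<longleftrightarrow> regular F B \<in> TB_objects F B \<and> omega_natural_left F B (tauBF B)"


section \<open>Invertible normalized 2-cocycles (inverse form) in the Eilenberg-Moore 2-category\<close>

text \<open>
  In the third condition the 2-cell on the left is the composite
  \<open>(X \<times> \<psi>\<^bsub>B,Y\<^esub>)(\<psi>\<^bsub>B,X\<^esub> \<times> Y)\<close>, which defines the \<open>B\<close>-action on \<open>X(YM)\<close>, and the one on the right is
  \<open>\<psi>\<close> of the object \<open>XY\<close> of \<open>C\<close>, which defines the \<open>B\<close>-action on \<open>(XY)M\<close>: the condition is
  \<open>B\<close>-linearity of \<open>X(YM) \<rightarrow> (XY)M\<close>.
\<close>

definition EM_two_cocycle ::
  "('c, 'd) coquasi_data \<Rightarrow> ('c, 'd) module_data \<Rightarrow> (('c, 'd) tobj \<Rightarrow> ('c, 'd) tobj \<Rightarrow> 'd) \<Rightarrow> bool" where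
  "EM_two_cocycle F B r \<longleftrightarrow> (let C = TB_objects F B; mor = TB_morphisms F B; I = TB_unit F B in
      (\<forall>X\<in>C. \<forall>Y\<in>C. r X Y \<in> Hom (cell X \<star> cell Y) (cell X \<star> cell Y \<star> cell B))
    \<and> (\<forall>X\<in>C. \<forall>X'\<in>C. \<forall>Y\<in>C. \<forall>Y'\<in>C. \<forall>\<zeta>\<in>mor X X'. \<forall>\<xi>\<in>mor Y Y'.
         (\<zeta> \<otimes> \<xi> \<otimes> \<langle>B\<rangle>) \<bullet> r X Y = r X' Y' \<bullet> (\<zeta> \<otimes> \<xi>))
    \<and> (\<forall>X\<in>C. \<forall>Y\<in>C. \<exists>s \<in> Hom (cell X \<star> cell Y) (cell X \<star> cell Y \<star> cell B).
         (\<langle>X\<rangle> \<otimes> \<langle>Y\<rangle> \<otimes> \<mu>\<^bsub>B\<^esub>) \<bullet> (s \<otimes> \<langle>B\<rangle>) \<bullet> r X Y = \<langle>X\<rangle> \<otimes> \<langle>Y\<rangle> \<otimes> \<eta>\<^bsub>B\<^esub>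
       \<and> (\<langle>X\<rangle> \<otimes> \<langle>Y\<rangle> \<otimes> \<mu>\<^bsub>B\<^esub>) \<bullet> (r X Y \<otimes> \<langle>B\<rangle>) \<bullet> s = \<langle>X\<rangle> \<otimes> \<langle>Y\<rangle> \<otimes> \<eta>\<^bsub>B\<^esub>)
    \<and> (\<forall>X\<in>C. \<forall>Y\<in>C.
         (\<langle>X\<rangle> \<otimes> \<langle>Y\<rangle> \<otimes> \<mu>\<^bsub>B\<^esub>) \<bullet> (r X Y \<otimes> \<langle>B\<rangle>) \<bullet> (\<langle>X\<rangle> \<otimes> psi F B Y) \<bullet> (psi F B X \<otimes> \<langle>Y\<rangle>)
       = (\<langle>X\<rangle> \<otimes> \<langle>Y\<rangle> \<otimes> \<mu>\<^bsub>B\<^esub>) \<bullet> (psi F B (TB_tensor F X Y) \<otimes> \<langle>B\<rangle>) \<bullet> (\<langle>B\<rangle> \<otimes> r X Y))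
    \<and> (\<forall>X\<in>C. \<forall>Y\<in>C. \<forall>Z\<in>C.
         (TB_assoc F X Y Z \<otimes> \<mu>\<^bsub>B\<^esub>) \<bullet> (r (TB_tensor F X Y) Z \<otimes> \<langle>B\<rangle>)
            \<bullet> (\<langle>X\<rangle> \<otimes> \<langle>Y\<rangle> \<otimes> psi F B Z) \<bullet> (r X Y \<otimes> \<langle>Z\<rangle>)
       = (\<langle>X\<rangle> \<otimes> \<langle>Y\<rangle> \<otimes> \<langle>Z\<rangle> \<otimes> \<mu>\<^bsub>B\<^esub>) \<bullet> (r X (TB_tensor F Y Z) \<otimes> \<langle>B\<rangle>) \<bullet> (\<langle>X\<rangle> \<otimes> r Y Z))
    \<and> (\<forall>X\<in>C. r X I = \<langle>X\<rangle> \<otimes> \<eta>\<^bsub>B\<^esub> \<and> r I X = \<langle>X\<rangle> \<otimes> \<eta>\<^bsub>B\<^esub>))"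

end


section \<open>3-cocycles\<close>

text \<open>
  A 3-cocycle is a natural operator, so one must say over which structured 1-cells it is natural.
  These are packed into a record: objects, their underlying 1-cells, the 2-cells that count as
  morphisms, and a tensor product lying over composition of 1-cells.
\<close>

record ('x, 'c, 'd) cell_family =
  objs :: "'x set"
  under :: "'x \<Rightarrow> 'c"
  mors :: "'x \<Rightarrow> 'x \<Rightarrow> 'd set"
  tens :: "'x \<Rightarrow> 'x \<Rightarrow> 'x"

context
  fixes K :: "('o, 'c, 'd) two_cat" (structure) and A :: 'o
begin

definition three_cocycle :: "('x, 'c, 'd) cell_family \<Rightarrow> ('x \<Rightarrow> 'x \<Rightarrow> 'x \<Rightarrow> 'd) \<Rightarrow> bool" where
  "three_cocycle D r \<longleftrightarrow> (let Ob = objs D; U = under D; T = tens D; \<iota> = (\<lambda>X. id2 K (under D X)) in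
      (\<forall>X\<in>Ob. \<forall>Y\<in>Ob. \<forall>Z\<in>Ob. r X Y Z \<in> Hom (U X \<star> U Y \<star> U Z) (U X \<star> U Y \<star> U Z))
    \<and> (\<forall>X\<in>Ob. \<forall>Y\<in>Ob. \<forall>Z\<in>Ob. \<forall>X'\<in>Ob. \<forall>Y'\<in>Ob. \<forall>Z'\<in>Ob.
         \<forall>f\<in>mors D X X'. \<forall>g\<in>mors D Y Y'. \<forall>h\<in>mors D Z Z'.
           (f \<otimes> g \<otimes> h) \<bullet> r X Y Z = r X' Y' Z' \<bullet> (f \<otimes> g \<otimes> h))
    \<and> (\<forall>X\<in>Ob. \<forall>Y\<in>Ob. \<forall>Z\<in>Ob. \<forall>W\<in>Ob.
         (\<iota> X \<otimes> r Y Z W) \<bullet> r X (T Y Z) W \<bullet> (r X Y Z \<otimes> \<iota> W) = r X Y (T Z W) \<bullet> r (T X Y) Z W))"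

text \<open>\<open>\<beta>\<close> is a 3-cocycle on \<open>XXX\<close>: the component at \<open>X, X, X\<close> of a natural 3-cocycle.\<close>

definition three_cocycle_on :: "('x, 'c, 'd) cell_family \<Rightarrow> 'x \<Rightarrow> 'd \<Rightarrow> bool" where
  "three_cocycle_on D X \<beta> \<longleftrightarrow> X \<in> objs D \<and> (\<exists>r. three_cocycle D r \<and> r X X X = \<beta>)"

text \<open>
  Left Tambara comodules over \<open>F\<close>, the mirror image of the right ones.  They are the structured
  1-cells over which an operator of the form \<open>(\<omega>\<^sup>-\<^sup>1 \<times> XYZ) \<circ> (iterated left coaction)\<close> is defined
  and natural.
\<close>

definition left_Tambara_comodule :: "('c, 'd) coquasi_data \<Rightarrow> ('c, 'd) ltobj \<Rightarrow> bool" where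
  "left_Tambara_comodule F X \<longleftrightarrow> cell X \<in> endo K A
    \<and> right_monadic K F X (tauL X) \<and> left_comonadic K F X (tauL X)
    \<and> omega_natural_left K F X (tauL X)
    \<and> (\<tau>\<^bsub>F\<^esub> \<otimes> \<langle>X\<rangle>) \<bullet> (\<langle>F\<rangle> \<otimes> tauL X) \<bullet> (tauL X \<otimes> \<langle>F\<rangle>)
        = (\<langle>F\<rangle> \<otimes> tauL X) \<bullet> (tauL X \<otimes> \<langle>F\<rangle>) \<bullet> (\<langle>X\<rangle> \<otimes> \<tau>\<^bsub>F\<^esub>)
    \<and> lcoact X \<in> Hom (cell X) (cell F \<star> cell X)
    \<and> (\<langle>F\<rangle> \<otimes> lcoact X) \<bullet> lcoact X = (\<Delta>\<^bsub>F\<^esub> \<otimes> \<langle>X\<rangle>) \<bullet> lcoact X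
    \<and> (\<epsilon>\<^bsub>F\<^esub> \<otimes> \<langle>X\<rangle>) \<bullet> lcoact X = \<langle>X\<rangle>
    \<and> (\<langle>F\<rangle> \<otimes> lcoact X) \<bullet> tauL X = (\<tau>\<^bsub>F\<^esub> \<otimes> \<langle>X\<rangle>) \<bullet> (\<langle>F\<rangle> \<otimes> tauL X) \<bullet> (lcoact X \<otimes> \<langle>F\<rangle>)"

definition left_Tambara :: "('c, 'd) coquasi_data \<Rightarrow> (('c, 'd) ltobj, 'c, 'd) cell_family" where
  "left_Tambara F = \<lparr>
     objs = {X. left_Tambara_comodule F X},
     under = cell,
     mors = (\<lambda>X Y. {\<zeta> \<in> Hom (cell X) (cell Y).
         (\<langle>F\<rangle> \<otimes> \<zeta>) \<bullet> lcoact X = lcoact Y \<bullet> \<zeta> \<and> (\<langle>F\<rangle> \<otimes> \<zeta>) \<bullet> tauL X = tauL Y \<bullet> (\<zeta> \<otimes> \<langle>F\<rangle>)}),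
     tens = (\<lambda>X Y. \<lparr>cell = cell X \<star> cell Y,
         tauL = (tauL X \<otimes> \<langle>Y\<rangle>) \<bullet> (\<langle>X\<rangle> \<otimes> tauL Y),
         lcoact = (\<mu>\<^bsub>F\<^esub> \<otimes> \<langle>X\<rangle> \<otimes> \<langle>Y\<rangle>) \<bullet> (\<langle>F\<rangle> \<otimes> tauL X \<otimes> \<langle>Y\<rangle>) \<bullet> (lcoact X \<otimes> lcoact Y)\<rparr>)\<rparr>"

definition left_regular :: "('c, 'd) coquasi_data \<Rightarrow> ('c, 'd) ltobj" where
  "left_regular F = \<lparr>cell = cell F, tauL = \<tau>\<^bsub>F\<^esub>, lcoact = \<Delta>\<^bsub>F\<^esub>\<rparr>"


section \<open>Sweedler's Hopf datum\<close>

text \<open>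
  A datum \<open>(B, F, \<psi>, \<mu>\<^sub>M, \<eta>\<^sub>M, \<epsilon>\<^sub>F, \<beta>)\<close>; here \<open>F\<close> is just a 1-cell, and it is the underlying 1-cell
  of the object \<open>X\<close> of the family \<open>D\<close> relative to which \<open>\<beta>\<close> is a 3-cocycle.
\<close>

definition sweedler_cocycle :: "('c, 'd, 'z) algebra_data_scheme \<Rightarrow> 'd \<Rightarrow> 'd \<Rightarrow> 'd" where
  "sweedler_cocycle B \<mu>M \<epsilon>F = (\<epsilon>F \<otimes> \<langle>B\<rangle>) \<bullet> \<mu>M"

definition sweedler_hopf_datum ::
  "('x, 'c, 'd) cell_family \<Rightarrow> 'x \<Rightarrow> ('c, 'd, 'z) algebra_data_scheme
     \<Rightarrow> 'c \<Rightarrow> 'd \<Rightarrow> 'd \<Rightarrow> 'd \<Rightarrow> 'd \<Rightarrow> 'd \<Rightarrow> bool" where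
  "sweedler_hopf_datum D X B F \<psi> \<mu>M \<eta>M \<epsilon>F \<beta> \<longleftrightarrow>
     monad K A B \<and> F \<in> endo K A
    \<and> \<psi> \<in> Hom (cell B \<star> F) (F \<star> cell B) \<and> \<mu>M \<in> Hom (F \<star> F) (F \<star> cell B)
    \<and> \<eta>M \<in> Hom (id1 K A) (F \<star> cell B) \<and> \<epsilon>F \<in> Hom F (id1 K A)
    \<and> \<beta> \<in> Hom (F \<star> F \<star> F) (F \<star> F \<star> F) \<and> under D X = F \<and> three_cocycle_on D X \<beta>
    \<and> (let f = id2 K F; a = (\<epsilon>F \<otimes> \<langle>B\<rangle>) \<bullet> \<psi>; \<sigma> = sweedler_cocycle B \<mu>M \<epsilon>F in
         \<mu>\<^bsub>B\<^esub> \<bullet> (a \<otimes> \<langle>B\<rangle>) \<bullet> (\<langle>B\<rangle> \<otimes> \<psi>) = a \<bullet> (\<mu>\<^bsub>B\<^esub> \<otimes> f)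
       \<and> a \<bullet> (\<eta>\<^bsub>B\<^esub> \<otimes> f) = \<eta>\<^bsub>B\<^esub> \<bullet> \<epsilon>F
       \<and> \<mu>\<^bsub>B\<^esub> \<bullet> (\<sigma> \<otimes> \<langle>B\<rangle>) \<bullet> (f \<otimes> \<psi>) \<bullet> (\<psi> \<otimes> f) = \<mu>\<^bsub>B\<^esub> \<bullet> (a \<otimes> \<langle>B\<rangle>) \<bullet> (\<langle>B\<rangle> \<otimes> \<mu>M)
       \<and> \<mu>\<^bsub>B\<^esub> \<bullet> (\<epsilon>F \<otimes> \<langle>B\<rangle> \<otimes> \<langle>B\<rangle>) \<bullet> (\<eta>M \<otimes> \<langle>B\<rangle>) = \<mu>\<^bsub>B\<^esub> \<bullet> (a \<otimes> \<langle>B\<rangle>) \<bullet> (\<langle>B\<rangle> \<otimes> \<eta>M)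
       \<and> \<mu>\<^bsub>B\<^esub> \<bullet> (\<sigma> \<otimes> \<langle>B\<rangle>) \<bullet> (f \<otimes> \<mu>M) \<bullet> \<beta> = \<mu>\<^bsub>B\<^esub> \<bullet> (\<sigma> \<otimes> \<langle>B\<rangle>) \<bullet> (f \<otimes> \<psi>) \<bullet> (\<mu>M \<otimes> f)
       \<and> \<mu>\<^bsub>B\<^esub> \<bullet> (\<sigma> \<otimes> \<langle>B\<rangle>) \<bullet> (f \<otimes> \<psi>) \<bullet> (\<eta>M \<otimes> f) = \<eta>\<^bsub>B\<^esub> \<bullet> \<epsilon>F
       \<and> \<mu>\<^bsub>B\<^esub> \<bullet> (\<sigma> \<otimes> \<langle>B\<rangle>) \<bullet> (f \<otimes> \<eta>M) = \<eta>\<^bsub>B\<^esub> \<bullet> \<epsilon>F)"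

definition conv_invertible_FF :: "('c, 'd) coquasi_data \<Rightarrow> ('c, 'd) module_data \<Rightarrow> 'd \<Rightarrow> bool" where
  "conv_invertible_FF F B s \<longleftrightarrow> s \<in> Hom (cell F \<star> cell F) (cell B)
    \<and> (\<exists>s' \<in> Hom (cell F \<star> cell F) (cell B).
         is_conv_inverse K \<mu>\<^bsub>B\<^esub> \<eta>\<^bsub>B\<^esub> (Delta2 K F) (\<epsilon>\<^bsub>F\<^esub> \<otimes> \<epsilon>\<^bsub>F\<^esub>) s s')"

end

end

theory Submission
  imports Defs
begin

text \<open>
  The 2-cell \<open>\<delta> = (X \<times> \<tau>\<^bsub>F,Y\<^esub> \<times> F)(\<rho>\<^bsub>X\<^esub> \<times> \<rho>\<^bsub>Y\<^esub>)\<close> is a coaction of the comonad \<open>FF\<close> on \<open>XY\<close>, and the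
  given 2-cell is \<open>(XY \<times> \<sigma>)\<delta>\<close>; similarly \<open>FFF\<close> coacts on \<open>XYZ\<close>.  The two sides of each of the
  conditions (ii)-(v) are obtained along these coactions from 2-cells \<open>F\<^sup>n \<rightarrow> B\<close> (\<open>BFF \<rightarrow> B\<close> in the
  case of (iii)), which are the two sides of a condition on \<open>\<sigma>\<close> alone.  Hence the conditions on
  \<open>\<sigma>\<close> suffice, and they are necessary because \<open>X = Y = Z = F\<close> followed by counits returns the
  2-cells themselves.  In this way (ii) is convolution invertibility, (iii) and (v) are Sweedler's
  module and unit conditions, and (iv) becomes \<open>\<omega> * l = r\<close> where Sweedler's cocycle condition
  reads \<open>\<omega>\<^sup>-\<^sup>1 * r = l\<close>.  That \<open>\<beta>\<close> is a 3-cocycle holds in any case: the analogous operators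
  built from \<open>\<omega>\<close> are inverse to those built from \<open>\<omega>\<^sup>-\<^sup>1\<close> and satisfy the pentagon of \<open>\<omega>\<close>.

  The equations between 2-cells are proved by certificates: a diagram is a list of layers, and an
  equation is derived by exchanging independent neighbouring layers and by replacing one side of a
  known equation by the other.
\<close>

section \<open>Diagrams and their layers\<close>

text \<open>The naturality of \<sigma> enters where a value of \<sigma> has to cross a further cell:
  in (iv) the B produced at X, Y stands to the left of Z, and its crossing of Z is traded for
  crossings of F before \<sigma> is applied. For values of the action the compatibility of
  \<open>tauB\<close> with it makes the same trade. The tensor product XY occurs in the conditions
  only through the formulas for its structure, which are written out on X and Y; membership of XY in
  C is never at issue. In \<beta> the inverse of \<omega> stands on the left, while the coactions of
  C are right ones. Its 3-cocycle is therefore an operator on left Tambara comodules, with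
  generators and laws of its own. The pentagon is proved for \<omega>, where the axiom on F is
  available, and then inverted, which reverses the composites. The laws of a 2-category hold for
  composable cells only, so rewriting with them directly would raise typing conditions at every
  step. On diagrams typing is computed, and the 2-category laws are invoked only in proving the
  calculus sound.\<close>

datatype ('w, 'g) diag =
    Wires "'w list"
  | Cell 'g
  | Beside "('w, 'g) diag" "('w, 'g) diag"  (infixr "\<boxtimes>" 70)
  | After "('w, 'g) diag" "('w, 'g) diag"  (infixr "\<odot>" 65)

type_synonym ('w, 'g) arity = "'g \<Rightarrow> 'w list \<times> 'w list"
type_synonym 'g layer = "nat \<times> 'g"

primrec source :: "('w, 'g) arity \<Rightarrow> ('w, 'g) diag \<Rightarrow> 'w list" where
  "source ar (Wires u) = u"
| "source ar (Cell g) = fst (ar g)"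
| "source ar (s \<boxtimes> t) = source ar s @ source ar t"
| "source ar (s \<odot> t) = source ar t"

primrec target :: "('w, 'g) arity \<Rightarrow> ('w, 'g) diag \<Rightarrow> 'w list" where
  "target ar (Wires u) = u"
| "target ar (Cell g) = snd (ar g)"
| "target ar (s \<boxtimes> t) = target ar s @ target ar t"
| "target ar (s \<odot> t) = target ar s"

primrec well_typed :: "('w, 'g) arity \<Rightarrow> ('w, 'g) diag \<Rightarrow> bool" where
  "well_typed ar (Wires u) \<longleftrightarrow> True"
| "well_typed ar (Cell g) \<longleftrightarrow> True"
| "well_typed ar (s \<boxtimes> t) \<longleftrightarrow> well_typed ar s \<and> well_typed ar t"
| "well_typed ar (s \<odot> t) \<longleftrightarrow> well_typed ar s \<and> well_typed ar t \<and> target ar t = source ar s"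

text \<open>
  The layer \<open>(i, g)\<close> is the 2-cell \<open>g\<close> with \<open>i\<close> wires on its left.  Layers are listed in the
  order in which they are applied; of \<open>s \<boxtimes> t\<close> the right factor is applied first.
\<close>

definition shift :: "nat \<Rightarrow> 'g layer list \<Rightarrow> 'g layer list" where
  "shift n ls = map (\<lambda>(i, g). (n + i, g)) ls"

primrec layers :: "('w, 'g) arity \<Rightarrow> ('w, 'g) diag \<Rightarrow> 'g layer list" where
  "layers ar (Wires u) = []"
| "layers ar (Cell g) = [(0, g)]"
| "layers ar (s \<boxtimes> t) = shift (length (source ar s)) (layers ar t) @ layers ar s"
| "layers ar (s \<odot> t) = layers ar t @ layers ar s"

text \<open>The bound on the position matters for cells with empty source, such as units: for them
  the second conjunct holds at every position.\<close>

definition fits :: "('w, 'g) arity \<Rightarrow> 'w list \<Rightarrow> 'g layer \<Rightarrow> bool" where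
  "fits ar u l \<longleftrightarrow> fst l \<le> length u
     \<and> take (length (fst (ar (snd l)))) (drop (fst l) u) = fst (ar (snd l))"

definition advance :: "('w, 'g) arity \<Rightarrow> 'w list \<Rightarrow> 'g layer \<Rightarrow> 'w list" where
  "advance ar u l = take (fst l) u @ snd (ar (snd l)) @ drop (fst l + length (fst (ar (snd l)))) u"

primrec valid :: "('w, 'g) arity \<Rightarrow> 'w list \<Rightarrow> 'g layer list \<Rightarrow> bool" where
  "valid ar u [] \<longleftrightarrow> True"
| "valid ar u (l # ls) \<longleftrightarrow> fits ar u l \<and> valid ar (advance ar u l) ls"

definition final :: "('w, 'g) arity \<Rightarrow> 'w list \<Rightarrow> 'g layer list \<Rightarrow> 'w list" where
  "final ar u ls = foldl (advance ar) u ls"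

lemma final_simps [simp]:
  "final ar u [] = u" "final ar u (l # ls) = final ar (advance ar u l) ls"
  "final ar u (ls @ ls') = final ar (final ar u ls) ls'"
  by (simp_all add: final_def)

lemma valid_append [simp]:
  "valid ar u (ls @ ls') \<longleftrightarrow> valid ar u ls \<and> valid ar (final ar u ls) ls'"
  by (induction ls arbitrary: u) auto

lemma fits_iff: "fits ar u (i, g) \<longleftrightarrow> (\<exists>a b. u = a @ fst (ar g) @ b \<and> length a = i)"
proof
  assume *: "fits ar u (i, g)"
  then have "u = take i u @ fst (ar g) @ drop (length (fst (ar g))) (drop i u)"
    by (metis append_take_drop_id fits_def fst_conv snd_conv)
  moreover have "length (take i u) = i" using * by (simp add: fits_def)
  ultimately show "\<exists>a b. u = a @ fst (ar g) @ b \<and> length a = i" by blast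
qed (auto simp: fits_def)

lemma advance_append: "advance ar (a @ fst (ar g) @ b) (length a, g) = a @ snd (ar g) @ b"
  by (simp add: advance_def)

text \<open>Locates two neighbouring layers relative to each other: \<open>m\<close> is the stretch
  of wires between the output of one and the input of the other.\<close>

lemma append_longer:
  assumes "p @ y = q @ z" and "length q \<le> length p"
  shows "\<exists>m. p = q @ m \<and> z = m @ y"
  using assms by (intro exI[of _ "drop (length q) p"]) (metis append_eq_append_conv_if append_take_drop_id)

lemma shift_Nil [simp]: "shift n [] = []"
  and shift_Cons [simp]: "shift n ((i, g) # ls) = (n + i, g) # shift n ls"
  and shift_length [simp]: "length (shift n ls) = length ls"
  by (simp_all add: shift_def)

lemma fits_whisker:
  assumes "fits ar u (i, g)"
  shows "fits ar (a @ u @ b) (length a + i, g)"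
    and "advance ar (a @ u @ b) (length a + i, g) = a @ advance ar u (i, g) @ b"
proof -
  obtain p q where u: "u = p @ fst (ar g) @ q" "length p = i"
    using assms by (auto simp: fits_iff)
  show "fits ar (a @ u @ b) (length a + i, g)"
    unfolding fits_iff using u by (intro exI[of _ "a @ p"] exI[of _ "q @ b"]) simp
  show "advance ar (a @ u @ b) (length a + i, g) = a @ advance ar u (i, g) @ b"
    using advance_append[of ar "a @ p" g "q @ b"] advance_append[of ar p g q] u by simp
qed

lemma valid_whisker:
  "valid ar u ls \<Longrightarrow> valid ar (a @ u @ b) (shift (length a) ls)
     \<and> final ar (a @ u @ b) (shift (length a) ls) = a @ final ar u ls @ b"
proof (induction ls arbitrary: u)
  case (Cons l ls)
  obtain i g where "l = (i, g)" by force
  with Cons show ?case by (simp add: fits_whisker)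
qed simp

lemma valid_layers:
  "well_typed ar t \<Longrightarrow> valid ar (source ar t) (layers ar t) \<and> final ar (source ar t) (layers ar t) = target ar t"
proof (induction t)
  case (Beside s t)
  then show ?case
    using valid_whisker[of ar "source ar t" "layers ar t" "source ar s" "[]"]
      valid_whisker[of ar "source ar s" "layers ar s" "[]" "target ar t"]
    by (simp add: shift_def)
qed (auto simp: fits_def advance_def)


section \<open>Certificates: exchange of layers and rewriting\<close>

text \<open>
  A rule is either an axiom or one of a list of local hypotheses.  In \<open>RightOf k\<close> and \<open>LeftOf k\<close>
  the layers at positions \<open>k\<close> and \<open>k + 1\<close> are exchanged, the later one lying to the right,
  respectively to the left, of the earlier one.  \<open>Fwd k n r\<close> replaces the left-hand side of
  \<open>r\<close>, which starts at layer \<open>k\<close> and has \<open>n\<close> wires on its left, by the right-hand side; \<open>Bwd\<close>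
  does the opposite.
\<close>

datatype 'r rule = Ax 'r | Hyp nat

datatype 'r step = RightOf nat | LeftOf nat | Fwd nat nat "'r rule" | Bwd nat nat "'r rule"

type_synonym ('w, 'g) equation = "('w, 'g) diag \<times> ('w, 'g) diag"

primrec equation_of :: "('r \<Rightarrow> ('w, 'g) equation) \<Rightarrow> ('w, 'g) equation list \<Rightarrow> 'r rule \<Rightarrow> ('w, 'g) equation" where
  "equation_of ax hyps (Ax r) = ax r"
| "equation_of ax hyps (Hyp n) = hyps ! n"

primrec at_layer :: "('w, 'g) arity \<Rightarrow> ('w list \<Rightarrow> 'g layer list \<Rightarrow> 'g layer list option)
    \<Rightarrow> nat \<Rightarrow> 'w list \<Rightarrow> 'g layer list \<Rightarrow> 'g layer list option" where
  "at_layer ar f 0 u ls = f u ls"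
| "at_layer ar f (Suc k) u ls =
     (case ls of [] \<Rightarrow> None | l # ls' \<Rightarrow> map_option ((#) l) (at_layer ar f k (advance ar u l) ls'))"

text \<open>The new offset of \<open>h\<close> counts the inputs of \<open>g\<close> instead of its
  outputs; adding before subtracting keeps the subtraction on \<open>nat\<close> exact. Exchange to
  the right and to the left are separate because both are possible, with different results, when
  \<open>g\<close> has no outputs and \<open>h\<close> has no inputs at the same place.\<close>

fun exchange_right :: "('w, 'g) arity \<Rightarrow> 'w list \<Rightarrow> 'g layer list \<Rightarrow> 'g layer list option" where
  "exchange_right ar u ((i, g) # (j, h) # ls) =
     (if i + length (snd (ar g)) \<le> j
      then Some ((j + length (fst (ar g)) - length (snd (ar g)), h) # (i, g) # ls) else None)"
| "exchange_right ar u ls = None"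

fun exchange_left :: "('w, 'g) arity \<Rightarrow> 'w list \<Rightarrow> 'g layer list \<Rightarrow> 'g layer list option" where
  "exchange_left ar u ((i, g) # (j, h) # ls) =
     (if j + length (fst (ar h)) \<le> i
      then Some ((j, h) # (i + length (snd (ar h)) - length (fst (ar h)), g) # ls) else None)"
| "exchange_left ar u ls = None"

text \<open>The layers of the side to be replaced must form a literal prefix of the list. Bringing
  them together in this order is the purpose of the long runs of exchanges in the
  certificates.\<close>

definition rewrite :: "('w, 'g) arity \<Rightarrow> ('w, 'g) diag \<Rightarrow> ('w, 'g) diag \<Rightarrow> nat
    \<Rightarrow> 'w list \<Rightarrow> 'g layer list \<Rightarrow> 'g layer list option" where
  "rewrite ar s t n u ls =
     (let p = shift n (layers ar s); d = source ar s in
      if well_typed ar s \<and> well_typed ar t \<and> d = source ar t \<and> target ar s = target ar t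
         \<and> n \<le> length u \<and> take (length d) (drop n u) = d \<and> take (length p) ls = p
      then Some (shift n (layers ar t) @ drop (length p) ls) else None)"

primrec perform :: "('w, 'g) arity \<Rightarrow> ('r \<Rightarrow> ('w, 'g) equation) \<Rightarrow> ('w, 'g) equation list
    \<Rightarrow> 'r step \<Rightarrow> 'w list \<Rightarrow> 'g layer list \<Rightarrow> 'g layer list option" where
  "perform ar ax hyps (RightOf k) = at_layer ar (exchange_right ar) k"
| "perform ar ax hyps (LeftOf k) = at_layer ar (exchange_left ar) k"
| "perform ar ax hyps (Fwd k n r) =
     (let e = equation_of ax hyps r in at_layer ar (rewrite ar (fst e) (snd e) n) k)"
| "perform ar ax hyps (Bwd k n r) =
     (let e = equation_of ax hyps r in at_layer ar (rewrite ar (snd e) (fst e) n) k)"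

primrec perform_all :: "('w, 'g) arity \<Rightarrow> ('r \<Rightarrow> ('w, 'g) equation) \<Rightarrow> ('w, 'g) equation list
    \<Rightarrow> 'r step list \<Rightarrow> 'w list \<Rightarrow> 'g layer list \<Rightarrow> 'g layer list option" where
  "perform_all ar ax hyps [] u ls = Some ls"
| "perform_all ar ax hyps (s # ss) u ls =
     (case perform ar ax hyps s u ls of None \<Rightarrow> None | Some ls' \<Rightarrow> perform_all ar ax hyps ss u ls')"

text \<open>Needed because \<open>hyps ! n\<close> is unspecified beyond the end of the
  list.\<close>

primrec hyps_in_range :: "nat \<Rightarrow> 'r rule \<Rightarrow> bool" where
  "hyps_in_range n (Ax r) \<longleftrightarrow> True"
| "hyps_in_range n (Hyp m) \<longleftrightarrow> m < n"

primrec step_in_range :: "nat \<Rightarrow> 'r step \<Rightarrow> bool" where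
  "step_in_range n (RightOf k) \<longleftrightarrow> True"
| "step_in_range n (LeftOf k) \<longleftrightarrow> True"
| "step_in_range n (Fwd k m r) \<longleftrightarrow> hyps_in_range n r"
| "step_in_range n (Bwd k m r) \<longleftrightarrow> hyps_in_range n r"

definition certifies :: "('w, 'g) arity \<Rightarrow> ('r \<Rightarrow> ('w, 'g) equation) \<Rightarrow> ('w, 'g) equation list
    \<Rightarrow> 'r step list \<Rightarrow> ('w, 'g) diag \<Rightarrow> ('w, 'g) diag \<Rightarrow> bool" where
  "certifies ar ax hyps ss s t \<longleftrightarrow> well_typed ar s \<and> well_typed ar t \<and> source ar s = source ar t
     \<and> list_all (step_in_range (length hyps)) ss
     \<and> perform_all ar ax hyps ss (source ar s) (layers ar s) = Some (layers ar t)"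


section \<open>Interpretation in the endo-1-cells of a 0-cell\<close>

text \<open>Singletons are treated separately so that no identity 1-cell trails at the end; the
  interpretation of a word is then literally the composite written in the definitions.\<close>

fun word :: "('o, 'c, 'd) two_cat \<Rightarrow> 'o \<Rightarrow> ('w \<Rightarrow> 'c) \<Rightarrow> 'w list \<Rightarrow> 'c" where
  "word K A c [] = id1 K A"
| "word K A c [x] = c x"
| "word K A c (x # y # u) = comp1 K (c x) (word K A c (y # u))"

locale string_diagrams = two_category K for K :: "('o, 'c, 'd) two_cat" (structure) +
  fixes A :: 'o and wire :: "'w \<Rightarrow> 'c" and ar :: "('w, 'g) arity" and gen :: "'g \<Rightarrow> 'd"
  assumes base: "A \<in> zero_cells K"
    and wire: "wire x \<in> endo K A"
    and gen: "gen g \<in> Hom (word K A wire (fst (ar g))) (word K A wire (snd (ar g)))"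
begin

abbreviation wd :: "'w list \<Rightarrow> 'c" where "wd \<equiv> word K A wire"
abbreviation cells :: "'w list \<Rightarrow> 'w list \<Rightarrow> 'd set" where "cells u w \<equiv> Hom (wd u) (wd w)"
abbreviation one :: "'w list \<Rightarrow> 'd" where "one u \<equiv> id2 K (wd u)"

primrec sem :: "('w, 'g) diag \<Rightarrow> 'd" where
  "sem (Wires u) = one u"
| "sem (Cell g) = gen g"
| "sem (s \<boxtimes> t) = sem s \<otimes> sem t"
| "sem (s \<odot> t) = sem s \<bullet> sem t"

lemma wd_endo: "wd u \<in> endo K A"
proof (induction u rule: induct_list012)
  case 1
  then show ?case using id1[OF base] by (simp add: endo_def)
next
  case (3 x y u)
  then show ?case using comp1[of "wd (y # u)" "wire x"] wire[of x] by (simp add: endo_def)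
qed (simp add: wire)

lemma wd_one_cell [simp]: "wd u \<in> one_cells K" and wd_src [simp]: "src K (wd u) = A"
  and wd_tgt [simp]: "tgt K (wd u) = A"
  using wd_endo[of u] by (auto simp: endo_def)

lemma wd_Cons: "wd (x # u) = wire x \<star> wd u"
  using comp1_unit[of "wire x"] wire[of x] by (cases u) (auto simp: endo_def)

lemma wd_append: "wd (u @ w) = wd u \<star> wd w"
proof (induction u)
  case Nil
  then show ?case using comp1_unit[of "wd w"] by simp
next
  case (Cons x u)
  then show ?case
    using comp1_assoc[of "wd w" "wd u" "wire x"] wire[of x] by (simp add: wd_Cons endo_def)
qed

lemma one_cells: "one u \<in> cells u u"
  by (simp add: id2)

lemma after_cells: "\<lbrakk>\<alpha> \<in> cells u v; \<beta> \<in> cells v w\<rbrakk> \<Longrightarrow> \<beta> \<bullet> \<alpha> \<in> cells u w"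
  by (rule vcomp)

lemma beside_cells: "\<lbrakk>\<beta> \<in> cells v v'; \<alpha> \<in> cells u u'\<rbrakk> \<Longrightarrow> \<beta> \<otimes> \<alpha> \<in> cells (v @ u) (v' @ u')"
  using hcomp[of \<alpha> "wd u" "wd u'" \<beta> "wd v" "wd v'"] by (simp add: wd_append)

lemma beside_assoc:
  "\<lbrakk>\<alpha> \<in> cells u u'; \<beta> \<in> cells v v'; \<gamma> \<in> cells w w'\<rbrakk> \<Longrightarrow> (\<gamma> \<otimes> \<beta>) \<otimes> \<alpha> = \<gamma> \<otimes> \<beta> \<otimes> \<alpha>"
  by (rule hcomp_assoc) auto

lemma beside_Nil: "\<alpha> \<in> cells u u' \<Longrightarrow> one [] \<otimes> \<alpha> = \<alpha>" "\<alpha> \<in> cells u u' \<Longrightarrow> \<alpha> \<otimes> one [] = \<alpha>"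
  using hcomp_unit[of \<alpha> "wd u" "wd u'"] by auto

lemma one_append: "one (u @ w) = one u \<otimes> one w"
  using id2_comp1[of "wd w" "wd u"] by (simp add: wd_append)

lemma after_one: "\<alpha> \<in> cells u w \<Longrightarrow> one w \<bullet> \<alpha> = \<alpha>" "\<alpha> \<in> cells u w \<Longrightarrow> \<alpha> \<bullet> one u = \<alpha>"
  using vcomp_unit by blast+

lemma exchange: "\<lbrakk>\<alpha> \<in> cells u u'; \<alpha>' \<in> cells u' u''; \<beta> \<in> cells v v'; \<beta>' \<in> cells v' v''\<rbrakk>
    \<Longrightarrow> (\<beta>' \<bullet> \<beta>) \<otimes> (\<alpha>' \<bullet> \<alpha>) = (\<beta>' \<otimes> \<alpha>') \<bullet> (\<beta> \<otimes> \<alpha>)"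
  by (rule interchange) auto

lemma sem_cells: "well_typed ar t \<Longrightarrow> sem t \<in> cells (source ar t) (target ar t)"
  by (induction t) (auto simp: one_cells gen intro: after_cells beside_cells)

section \<open>The 2-cell denoted by a list of layers\<close>

definition layer_cell :: "'w list \<Rightarrow> 'g layer \<Rightarrow> 'd" where
  "layer_cell u l = one (take (fst l) u) \<otimes> gen (snd l) \<otimes> one (drop (fst l + length (fst (ar (snd l)))) u)"

primrec value_of :: "'w list \<Rightarrow> 'g layer list \<Rightarrow> 'd" where
  "value_of u [] = one u"
| "value_of u (l # ls) = value_of (advance ar u l) ls \<bullet> layer_cell u l"

lemma layer_cell_append:
  "layer_cell (a @ fst (ar g) @ b) (length a, g) = one a \<otimes> gen g \<otimes> one b"
  by (simp add: layer_cell_def)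

lemma whisker_cells: "\<alpha> \<in> cells u w \<Longrightarrow> one a \<otimes> \<alpha> \<otimes> one b \<in> cells (a @ u @ b) (a @ w @ b)"
  by (intro beside_cells one_cells)

lemma layer_cell_cells: "fits ar u l \<Longrightarrow> layer_cell u l \<in> cells u (advance ar u l)"
proof -
  assume *: "fits ar u l"
  obtain i g where "l = (i, g)" by force
  with * obtain a b where "u = a @ fst (ar g) @ b" "l = (length a, g)"
    by (auto simp: fits_iff)
  then show ?thesis
    by (simp only: layer_cell_append advance_append whisker_cells gen)
qed

lemma value_cells: "valid ar u ls \<Longrightarrow> value_of u ls \<in> cells u (final ar u ls)"
  by (induction ls arbitrary: u) (auto simp: one_cells intro: after_cells layer_cell_cells)

lemma value_append:
  "valid ar u (ls @ ls') \<Longrightarrow> value_of u (ls @ ls') = value_of (final ar u ls) ls' \<bullet> value_of u ls"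
proof (induction ls arbitrary: u)
  case Nil
  then show ?case using after_one(2)[OF value_cells[of u ls']] by simp
next
  case (Cons l ls)
  then show ?case
    using vcomp_assoc[OF layer_cell_cells[of u l] value_cells[of "advance ar u l" ls]
        value_cells[of "final ar (advance ar u l) ls" ls']] by simp
qed

lemma one_beside_after:
  assumes "\<alpha> \<in> cells u v" "\<beta> \<in> cells v w"
  shows "one a \<otimes> (\<beta> \<bullet> \<alpha>) \<otimes> one b = (one a \<otimes> \<beta> \<otimes> one b) \<bullet> (one a \<otimes> \<alpha> \<otimes> one b)"
proof -
  have "(\<beta> \<bullet> \<alpha>) \<otimes> one b = (\<beta> \<otimes> one b) \<bullet> (\<alpha> \<otimes> one b)"
    using exchange[OF one_cells one_cells assms] after_one(1)[OF one_cells] by simp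
  moreover have "one a \<otimes> ((\<beta> \<otimes> one b) \<bullet> (\<alpha> \<otimes> one b)) = (one a \<otimes> \<beta> \<otimes> one b) \<bullet> (one a \<otimes> \<alpha> \<otimes> one b)"
    using exchange[OF beside_cells[OF assms(1) one_cells] beside_cells[OF assms(2) one_cells] one_cells one_cells]
      after_one(1)[OF one_cells] by simp
  ultimately show ?thesis by simp
qed

lemma whisker_whisker:
  assumes "\<alpha> \<in> cells u w"
  shows "one a \<otimes> (one p \<otimes> \<alpha> \<otimes> one q) \<otimes> one b = one (a @ p) \<otimes> \<alpha> \<otimes> one (q @ b)"
proof -
  have "(one p \<otimes> \<alpha> \<otimes> one q) \<otimes> one b = one p \<otimes> (\<alpha> \<otimes> one q) \<otimes> one b"
    by (rule beside_assoc[OF one_cells beside_cells[OF assms one_cells] one_cells])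
  also have "\<dots> = one p \<otimes> \<alpha> \<otimes> one (q @ b)"
    using beside_assoc[OF one_cells one_cells assms] by (simp add: one_append)
  finally show ?thesis
    using beside_assoc[OF beside_cells[OF assms one_cells[of "q @ b"]] one_cells one_cells, of a p]
    by (simp add: one_append[of a p])
qed

lemma value_whisker:
  "valid ar u ls \<Longrightarrow> value_of (a @ u @ b) (shift (length a) ls) = one a \<otimes> value_of u ls \<otimes> one b"
proof (induction ls arbitrary: u)
  case Nil
  then show ?case by (simp add: one_append)
next
  case (Cons l ls)
  obtain i g where l: "l = (i, g)" by force
  obtain p q where u: "u = p @ fst (ar g) @ q" "length p = i"
    using Cons.prems l by (auto simp: fits_iff)
  have "layer_cell (a @ u @ b) (length a + i, g) = one a \<otimes> layer_cell u l \<otimes> one b"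
    using layer_cell_append[of "a @ p" g "q @ b"] layer_cell_append[of p g q] u l
      whisker_whisker[OF gen] by simp
  then show ?case
    using Cons l fits_whisker(2)[of ar u i g a b]
      one_beside_after[OF layer_cell_cells[of u l] value_cells[of "advance ar u l" ls]]
    by simp
qed

lemma sem_layers: "well_typed ar t \<Longrightarrow> value_of (source ar t) (layers ar t) = sem t"
proof (induction t)
  case (Cell g)
  then show ?case
    using layer_cell_append[of "[]" g "[]"] advance_append[of ar "[]" g "[]"] beside_Nil gen[of g]
      after_one(1)[of "gen g"] by simp
next
  case (Beside s t)
  have s: "sem s \<in> cells (source ar s) (target ar s)" and t: "sem t \<in> cells (source ar t) (target ar t)"
    using Beside.prems sem_cells by auto
  have vs: "valid ar (source ar s) (layers ar s)" "final ar (source ar s) (layers ar s) = target ar s"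
    and vt: "valid ar (source ar t) (layers ar t)" "final ar (source ar t) (layers ar t) = target ar t"
    using Beside.prems valid_layers by auto
  have "value_of (source ar s @ source ar t) (shift (length (source ar s)) (layers ar t)) = one (source ar s) \<otimes> sem t"
    using value_whisker[OF vt(1), of "source ar s" "[]"] Beside beside_Nil(2)[OF t] by simp
  moreover have "value_of (source ar s @ target ar t) (layers ar s) = sem s \<otimes> one (target ar t)"
    using value_whisker[OF vs(1), of "[]" "target ar t"] Beside
      beside_Nil(1)[OF beside_cells[OF s one_cells]] by (simp add: shift_def)
  moreover have "valid ar (source ar s @ source ar t) (shift (length (source ar s)) (layers ar t) @ layers ar s)"
    using valid_layers[of ar "s \<boxtimes> t"] Beside.prems by simp
  ultimately have "value_of (source ar (s \<boxtimes> t)) (layers ar (s \<boxtimes> t))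
      = (sem s \<otimes> one (target ar t)) \<bullet> (one (source ar s) \<otimes> sem t)"
    using value_append valid_whisker[OF vt(1), of "source ar s" "[]"] vt(2) by simp
  \<comment> \<open>The interchange law: performing the right factor first and the left one
    afterwards is their horizontal composite.\<close>
  also have "\<dots> = sem s \<otimes> sem t"
    using exchange[OF t one_cells one_cells s] after_one[OF s] after_one[OF t] by simp
  finally show ?case by simp
next
  case (After s t)
  then show ?case
    using value_append[of "source ar t" "layers ar t" "layers ar s"] valid_layers[of ar t]
      valid_layers[of ar s] by auto
qed simp

section \<open>Soundness of exchange and rewriting\<close>

text \<open>Conditional on validity of the first list: an exchange does not test the types of its
  layers, it only has to preserve validity, which holds initially for the layers of a well typed
  diagram.\<close>

definition same_cell :: "'w list \<Rightarrow> 'g layer list \<Rightarrow> 'g layer list \<Rightarrow> bool" where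
  "same_cell u ls ls' \<longleftrightarrow> (valid ar u ls \<longrightarrow>
     valid ar u ls' \<and> final ar u ls' = final ar u ls \<and> value_of u ls' = value_of u ls)"

lemma same_cell_at_layer:
  assumes "\<And>u ls ls'. f u ls = Some ls' \<Longrightarrow> same_cell u ls ls'"
  shows "at_layer ar f k u ls = Some ls' \<Longrightarrow> same_cell u ls ls'"
proof (induction k arbitrary: u ls ls')
  case (Suc k)
  then show ?case by (fastforce simp: same_cell_def split: list.splits)
qed (simp add: assms)

lemma same_cell_append:
  assumes "same_cell u ls ls'"
  shows "same_cell u (ls @ ms) (ls' @ ms)"
  using assms by (auto simp: same_cell_def value_append)

lemma value_two:
  assumes "valid ar u [k, l]"
  shows "value_of u [k, l] = layer_cell (advance ar u k) l \<bullet> layer_cell u k"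
  using assms after_one(1)[OF layer_cell_cells[of "advance ar u k" l]] by simp

text \<open>Both orders give the horizontal composite of \<open>g\<close> and \<open>h\<close> with
  the identities on \<open>a\<close>, \<open>m\<close> and \<open>b\<close>.\<close>

lemma exchange_layers:
  fixes a b m :: "'w list" and g h :: 'g
  defines "u \<equiv> a @ fst (ar g) @ m @ fst (ar h) @ b"
  defines "p \<equiv> [(length a, g), (length (a @ snd (ar g) @ m), h)]"
    and "q \<equiv> [(length (a @ fst (ar g) @ m), h), (length a, g)]"
  shows "valid ar u p" "valid ar u q" "final ar u p = final ar u q" "value_of u p = value_of u q"
proof -
  let ?u1 = "a @ snd (ar g) @ m @ fst (ar h) @ b" and ?u2 = "a @ fst (ar g) @ m @ snd (ar h) @ b"
  let ?w = "a @ snd (ar g) @ m @ snd (ar h) @ b"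
  have a1: "advance ar u (length a, g) = ?u1"
    unfolding u_def by (rule advance_append)
  have a2: "advance ar ?u1 (length (a @ snd (ar g) @ m), h) = ?w"
    using advance_append[of ar "a @ snd (ar g) @ m" h b] by simp
  have a3: "advance ar u (length (a @ fst (ar g) @ m), h) = ?u2"
    using advance_append[of ar "a @ fst (ar g) @ m" h b] by (simp add: u_def)
  have a4: "advance ar ?u2 (length a, g) = ?w"
    by (rule advance_append)
  show "valid ar u p"
    unfolding p_def valid.simps a1 fits_iff
    by (intro conjI exI[of _ a] exI[of _ "m @ fst (ar h) @ b"] exI[of _ "a @ snd (ar g) @ m"] exI[of _ b])
      (simp_all add: u_def)
  show "valid ar u q"
    unfolding q_def valid.simps a3 fits_iff
    by (intro conjI exI[of _ a] exI[of _ "m @ snd (ar h) @ b"] exI[of _ "a @ fst (ar g) @ m"] exI[of _ b])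
      (simp_all add: u_def)
  show "final ar u p = final ar u q"
    unfolding p_def q_def by (simp only: final_simps a1 a2 a3 a4)
  let ?g = "gen g" and ?h = "one m \<otimes> gen h \<otimes> one b"
  have h: "?h \<in> cells (m @ fst (ar h) @ b) (m @ snd (ar h) @ b)"
    by (rule whisker_cells[OF gen])
  have split_left: "one (a @ x @ m) \<otimes> gen h \<otimes> one b = one a \<otimes> one x \<otimes> ?h" for x
  proof -
    have "one ((a @ x) @ m) \<otimes> gen h \<otimes> one b = one (a @ x) \<otimes> ?h"
      unfolding one_append[of "a @ x" m]
      by (rule beside_assoc[OF beside_cells[OF gen one_cells] one_cells one_cells])
    also have "\<dots> = one a \<otimes> one x \<otimes> ?h"
      unfolding one_append[of a x] by (rule beside_assoc[OF h one_cells one_cells])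
    finally show ?thesis by simp
  qed
  have p: "value_of u p = (one a \<otimes> one (snd (ar g)) \<otimes> ?h) \<bullet> (one a \<otimes> ?g \<otimes> one (m @ fst (ar h) @ b))"
    using value_two[OF \<open>valid ar u p\<close>[unfolded p_def]] layer_cell_append[of "a @ snd (ar g) @ m" h b]
      layer_cell_append[of a g "m @ fst (ar h) @ b"] split_left a1 by (simp add: p_def u_def)
  have q: "value_of u q = (one a \<otimes> ?g \<otimes> one (m @ snd (ar h) @ b)) \<bullet> (one a \<otimes> one (fst (ar g)) \<otimes> ?h)"
    using value_two[OF \<open>valid ar u q\<close>[unfolded q_def]] layer_cell_append[of "a @ fst (ar g) @ m" h b]
      layer_cell_append[of a g "m @ snd (ar h) @ b"] split_left a3 by (simp add: q_def u_def)
  have "(one a \<otimes> one (snd (ar g)) \<otimes> ?h) \<bullet> (one a \<otimes> ?g \<otimes> one (m @ fst (ar h) @ b)) = one a \<otimes> ?g \<otimes> ?h"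
    using exchange[OF beside_cells[OF gen one_cells] beside_cells[OF one_cells h] one_cells one_cells]
      exchange[OF one_cells h gen one_cells] after_one[OF gen] after_one[OF h] after_one(1)[OF one_cells]
    by simp
  moreover have "(one a \<otimes> ?g \<otimes> one (m @ snd (ar h) @ b)) \<bullet> (one a \<otimes> one (fst (ar g)) \<otimes> ?h) = one a \<otimes> ?g \<otimes> ?h"
    using exchange[OF beside_cells[OF one_cells h] beside_cells[OF gen one_cells] one_cells one_cells]
      exchange[OF h one_cells one_cells gen] after_one[OF gen] after_one[OF h] after_one(1)[OF one_cells]
    by simp
  ultimately show "value_of u p = value_of u q"
    using p q by simp
qed

lemma same_cell_exchange_right: "exchange_right ar u ls = Some ls' \<Longrightarrow> same_cell u ls ls'"
proof (cases "(ar, u, ls)" rule: exchange_right.cases)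
  case (1 ar' u' i g j h ms)
  assume "exchange_right ar u ls = Some ls'"
  with 1 have le: "i + length (snd (ar g)) \<le> j"
    and ls': "ls' = [(j + length (fst (ar g)) - length (snd (ar g)), h), (i, g)] @ ms"
    and ls: "ls = [(i, g), (j, h)] @ ms"
    by (auto split: if_splits)
  have "same_cell u [(i, g), (j, h)] [(j + length (fst (ar g)) - length (snd (ar g)), h), (i, g)]"
    unfolding same_cell_def
  proof (rule impI)
    assume v: "valid ar u [(i, g), (j, h)]"
    then obtain a r where a: "u = a @ fst (ar g) @ r" "length a = i"
      by (auto simp: fits_iff)
    with v advance_append[of ar a g r] obtain p b
      where p: "(a @ snd (ar g)) @ r = p @ fst (ar h) @ b" "length p = j"
      by (auto simp: fits_iff)
    then obtain m where m: "p = (a @ snd (ar g)) @ m" "r = m @ fst (ar h) @ b"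
      using append_longer[of p "fst (ar h) @ b" "a @ snd (ar g)" r] le a(2) by auto
    have j: "j = length (a @ snd (ar g) @ m)"
      "j + length (fst (ar g)) - length (snd (ar g)) = length (a @ fst (ar g) @ m)"
      using p(2) m(1) by auto
    show "valid ar u [(j + length (fst (ar g)) - length (snd (ar g)), h), (i, g)] \<and>
      final ar u [(j + length (fst (ar g)) - length (snd (ar g)), h), (i, g)] = final ar u [(i, g), (j, h)] \<and>
      value_of u [(j + length (fst (ar g)) - length (snd (ar g)), h), (i, g)] = value_of u [(i, g), (j, h)]"
      using exchange_layers[of a g m h b] a m(2) j by (simp add: add_ac)
  qed
  then show ?thesis unfolding ls ls' by (rule same_cell_append)
qed auto

lemma same_cell_exchange_left: "exchange_left ar u ls = Some ls' \<Longrightarrow> same_cell u ls ls'"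
proof (cases "(ar, u, ls)" rule: exchange_left.cases)
  case (1 ar' u' i g j h ms)
  assume "exchange_left ar u ls = Some ls'"
  with 1 have le: "j + length (fst (ar h)) \<le> i"
    and ls': "ls' = [(j, h), (i + length (snd (ar h)) - length (fst (ar h)), g)] @ ms"
    and ls: "ls = [(i, g), (j, h)] @ ms"
    by (auto split: if_splits)
  have "same_cell u [(i, g), (j, h)] [(j, h), (i + length (snd (ar h)) - length (fst (ar h)), g)]"
    unfolding same_cell_def
  proof (rule impI)
    assume v: "valid ar u [(i, g), (j, h)]"
    then obtain p b where p: "u = p @ fst (ar g) @ b" "length p = i"
      by (auto simp: fits_iff)
    with v advance_append[of ar p g b] obtain a r
      where a: "p @ snd (ar g) @ b = (a @ fst (ar h)) @ r" "length a = j"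
      by (auto simp: fits_iff)
    then obtain m where m: "p = (a @ fst (ar h)) @ m"
      using append_longer[of p "snd (ar g) @ b" "a @ fst (ar h)" r] le p(2) by auto
    have i: "i = length (a @ fst (ar h) @ m)"
      "i + length (snd (ar h)) - length (fst (ar h)) = length (a @ snd (ar h) @ m)"
      using p(2) m(1) by auto
    \<comment> \<open>The same square as for the exchange to the right, read backwards and with
      \<open>g\<close> and \<open>h\<close> interchanged: now \<open>h\<close> is the left
      one.\<close>
    show "valid ar u [(j, h), (i + length (snd (ar h)) - length (fst (ar h)), g)] \<and>
      final ar u [(j, h), (i + length (snd (ar h)) - length (fst (ar h)), g)] = final ar u [(i, g), (j, h)] \<and>
      value_of u [(j, h), (i + length (snd (ar h)) - length (fst (ar h)), g)] = value_of u [(i, g), (j, h)]"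
      using exchange_layers[of a h m g b] p a m i by (simp add: add_ac)
  qed
  then show ?thesis unfolding ls ls' by (rule same_cell_append)
qed auto

lemma same_cell_rewrite:
  assumes "rewrite ar s t n u ls = Some ls'" and "sem s = sem t"
  shows "same_cell u ls ls'"
proof -
  have wt: "well_typed ar s" "well_typed ar t" "source ar s = source ar t" "target ar s = target ar t"
    and n: "n \<le> length u" "take (length (source ar s)) (drop n u) = source ar s"
    and p: "take (length (layers ar s)) ls = shift n (layers ar s)"
    and ls': "ls' = shift n (layers ar t) @ drop (length (layers ar s)) ls"
    using assms(1) by (auto simp: rewrite_def Let_def split: if_splits)
  define a b where "a = take n u" and "b = drop (length (source ar s)) (drop n u)"
  have u: "u = a @ source ar s @ b" and a: "length a = n"
    using n by (auto simp: a_def b_def) (metis append_take_drop_id drop_drop)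
  have "same_cell u (shift n (layers ar s)) (shift n (layers ar t))"
    unfolding same_cell_def u a[symmetric]
    using valid_whisker[of ar "source ar s" "layers ar s" a b] valid_whisker[of ar "source ar t" "layers ar t" a b]
      valid_layers[OF wt(1)] valid_layers[OF wt(2)] wt value_whisker sem_layers[OF wt(1)] sem_layers[OF wt(2)]
      assms(2) by simp
  moreover have "ls = shift n (layers ar s) @ drop (length (layers ar s)) ls"
    using p by (metis append_take_drop_id)
  ultimately show ?thesis using same_cell_append ls' by metis
qed

lemma same_cell_perform_all:
  assumes ax: "\<And>r. sem (fst (ax r)) = sem (snd (ax r))"
    and hyps: "list_all (\<lambda>e. sem (fst e) = sem (snd e)) hyps"
  shows "\<lbrakk>perform_all ar ax hyps ss u ls = Some ls'; list_all (step_in_range (length hyps)) ss\<rbrakk>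
    \<Longrightarrow> same_cell u ls ls'"
proof (induction ss arbitrary: ls)
  case Nil
  then show ?case by (simp add: same_cell_def)
next
  case (Cons s ss)
  obtain ms where ms: "perform ar ax hyps s u ls = Some ms" "perform_all ar ax hyps ss u ms = Some ls'"
    using Cons.prems by (auto split: option.splits)
  have eq: "hyps_in_range (length hyps) r
      \<Longrightarrow> sem (fst (equation_of ax hyps r)) = sem (snd (equation_of ax hyps r))" for r
    using ax hyps by (cases r) (auto simp: list_all_length)
  have "same_cell u ls ms"
    using ms(1) Cons.prems(2)
    by (cases s) (auto simp: Let_def dest!: eq elim!: same_cell_at_layer[rotated]
      intro: same_cell_exchange_right same_cell_exchange_left same_cell_rewrite same_cell_rewrite[OF _ sym])
  moreover have "same_cell u ms ls'"
    using Cons.IH ms(2) Cons.prems(2) by simp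
  ultimately show ?case by (auto simp: same_cell_def)
qed

text \<open>The third premise involves no 2-category and is decided by evaluation. The 2-cells enter
  only through the first two, that is through the soundness of axioms and hypotheses.\<close>

theorem sem_eqI:
  assumes "\<And>r. sem (fst (ax r)) = sem (snd (ax r))"
    and "list_all (\<lambda>e. sem (fst e) = sem (snd e)) hyps"
    and "certifies ar ax hyps ss s t"
  shows "sem s = sem t"
  using same_cell_perform_all[where ax = ax and hyps = hyps and ss = ss and u = "source ar s"
      and ls = "layers ar s" and ls' = "layers ar t"] assms(1,2) assms(3)
    sem_layers[of s] sem_layers[of t] valid_layers[of ar s]
  by (auto simp: certifies_def same_cell_def)

end


section \<open>Diagrams in right Tambara comodules\<close>

text \<open>
  \<open>Reg\<close> stands for \<open>F\<close> as an object of \<open>C\<close>, and \<open>Mor n\<close> for a morphism from \<open>Ob n\<close> to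
  \<open>Im n\<close>.  Thus \<open>Coact Reg\<close> is \<open>\<Delta>\<close>, \<open>TauF Reg\<close> is \<open>\<tau>\<^bsub>F,F\<^esub>\<close> and \<open>TauB Reg\<close> is \<open>\<tau>\<^bsub>B,F\<^esub>\<close>.
\<close>

datatype ob = Reg | Ob nat | Im nat

datatype wire = Wi ob | WB

text \<open>\<open>SigInv\<close> is for a convolution inverse of \<sigma>, and \<open>Aux\<close>
  for an inverse, in the sense of (ii), of the given 2-cell at F, F. No axiom below speaks of them;
  what is known about \<open>Aux\<close> is supplied as local hypotheses.\<close>

datatype gen = Mul | Unit | Counit | Omega | OmegaInv | Act | MulB | UnitB | Sig | SigInv | Aux
  | Coact ob | TauF ob | TauB ob | Mor nat

abbreviation "WF \<equiv> Wi Reg"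

primrec arity :: "gen \<Rightarrow> wire list \<times> wire list" where
  "arity Mul = ([WF, WF], [WF])"
| "arity Unit = ([], [WF])"
| "arity Counit = ([WF], [])"
| "arity Omega = ([WF, WF, WF], [])"
| "arity OmegaInv = ([WF, WF, WF], [])"
| "arity Act = ([WB, WF], [WB])"
| "arity MulB = ([WB, WB], [WB])"
| "arity UnitB = ([], [WB])"
| "arity Sig = ([WF, WF], [WB])"
| "arity SigInv = ([WF, WF], [WB])"
| "arity Aux = ([WF, WF], [WF, WF, WB])"
| "arity (Coact x) = ([Wi x], [Wi x, WF])"
| "arity (TauF x) = ([WF, Wi x], [Wi x, WF])"
| "arity (TauB x) = ([WB, Wi x], [Wi x, WB])"
| "arity (Mor n) = ([Wi (Ob n)], [Wi (Im n)])"

type_synonym diagram = "(wire, gen) diag"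

abbreviation wF :: diagram where "wF \<equiv> Wires [WF]"
abbreviation wB :: diagram where "wB \<equiv> Wires [WB]"
abbreviation wX :: "ob \<Rightarrow> diagram" where "wX x \<equiv> Wires [Wi x]"
abbreviation rco :: "ob \<Rightarrow> diagram" where "rco x \<equiv> Cell (Coact x)"
abbreviation tF :: "ob \<Rightarrow> diagram" where "tF x \<equiv> Cell (TauF x)"
abbreviation tB :: "ob \<Rightarrow> diagram" where "tB x \<equiv> Cell (TauB x)"
abbreviation eps :: diagram where "eps \<equiv> Cell Counit"

definition delta2 :: "ob \<Rightarrow> ob \<Rightarrow> diagram" where
  "delta2 x y = (wX x \<boxtimes> tF y \<boxtimes> wF) \<odot> (rco x \<boxtimes> rco y)"
definition delta3 :: "ob \<Rightarrow> ob \<Rightarrow> ob \<Rightarrow> diagram" where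
  "delta3 x y z = (wX x \<boxtimes> wX y \<boxtimes> tF z \<boxtimes> wF \<boxtimes> wF) \<odot> (wX x \<boxtimes> tF y \<boxtimes> tF z \<boxtimes> wF)
     \<odot> (rco x \<boxtimes> rco y \<boxtimes> rco z)"

datatype law_name = Coassoc ob | CounitR ob | CounitL | Colin ob | TFMul ob | TFUnit ob | TFComul ob
  | TFCounit ob | YB ob | TauCounit | OmB | MulCounit | UnitCounit | OmOmInv | OmInvOm | AssocB
  | UnitLB | UnitRB | TBUnit ob | TBColin ob | TBTF ob | TBAct ob | ActUnit | ActUnitB | SigNat ob
  | MorCo nat | MorTF nat

primrec law :: "law_name \<Rightarrow> (wire, gen) equation" where
  "law (Coassoc x) = ((rco x \<boxtimes> wF) \<odot> rco x, (wX x \<boxtimes> rco Reg) \<odot> rco x)"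
| "law (CounitR x) = ((wX x \<boxtimes> eps) \<odot> rco x, wX x)"
| "law CounitL = ((eps \<boxtimes> wF) \<odot> rco Reg, wF)"
| "law (Colin x) = ((rco x \<boxtimes> wF) \<odot> tF x, (wX x \<boxtimes> tF Reg) \<odot> (tF x \<boxtimes> wF) \<odot> (wF \<boxtimes> rco x))"
| "law (TFMul x) = (tF x \<odot> (Cell Mul \<boxtimes> wX x), (wX x \<boxtimes> Cell Mul) \<odot> (tF x \<boxtimes> wF) \<odot> (wF \<boxtimes> tF x))"
| "law (TFUnit x) = (tF x \<odot> (Cell Unit \<boxtimes> wX x), wX x \<boxtimes> Cell Unit)"
| "law (TFComul x) = ((wX x \<boxtimes> rco Reg) \<odot> tF x, (tF x \<boxtimes> wF) \<odot> (wF \<boxtimes> tF x) \<odot> (rco Reg \<boxtimes> wX x))"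
| "law (TFCounit x) = ((wX x \<boxtimes> eps) \<odot> tF x, eps \<boxtimes> wX x)"
| "law (YB x) = ((wX x \<boxtimes> tF Reg) \<odot> (tF x \<boxtimes> wF) \<odot> (wF \<boxtimes> tF x),
     (tF x \<boxtimes> wF) \<odot> (wF \<boxtimes> tF x) \<odot> (tF Reg \<boxtimes> wX x))"
| "law TauCounit = ((eps \<boxtimes> wF) \<odot> tF Reg, wF \<boxtimes> eps)"
| "law OmB = (wB \<boxtimes> Cell Omega, (Cell Omega \<boxtimes> wB) \<odot> (wF \<boxtimes> wF \<boxtimes> tB Reg) \<odot> (wF \<boxtimes> tB Reg \<boxtimes> wF)
     \<odot> (tB Reg \<boxtimes> wF \<boxtimes> wF))"
| "law MulCounit = (eps \<odot> Cell Mul, eps \<boxtimes> eps)"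
| "law UnitCounit = (eps \<odot> Cell Unit, Wires [])"
| "law OmOmInv = ((Cell Omega \<boxtimes> Cell OmegaInv) \<odot> delta3 Reg Reg Reg, eps \<boxtimes> eps \<boxtimes> eps)"
| "law OmInvOm = ((Cell OmegaInv \<boxtimes> Cell Omega) \<odot> delta3 Reg Reg Reg, eps \<boxtimes> eps \<boxtimes> eps)"
| "law AssocB = (Cell MulB \<odot> (Cell MulB \<boxtimes> wB), Cell MulB \<odot> (wB \<boxtimes> Cell MulB))"
| "law UnitLB = (Cell MulB \<odot> (Cell UnitB \<boxtimes> wB), wB)"
| "law UnitRB = (Cell MulB \<odot> (wB \<boxtimes> Cell UnitB), wB)"
| "law (TBUnit x) = (tB x \<odot> (Cell UnitB \<boxtimes> wX x), wX x \<boxtimes> Cell UnitB)"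
| "law (TBColin x) = ((rco x \<boxtimes> wB) \<odot> tB x, (wX x \<boxtimes> tB Reg) \<odot> (tB x \<boxtimes> wF) \<odot> (wB \<boxtimes> rco x))"
| "law (TBTF x) = ((wX x \<boxtimes> tB Reg) \<odot> (tB x \<boxtimes> wF) \<odot> (wB \<boxtimes> tF x),
     (tF x \<boxtimes> wB) \<odot> (wF \<boxtimes> tB x) \<odot> (tB Reg \<boxtimes> wX x))"
| "law (TBAct x) = (tB x \<odot> (Cell Act \<boxtimes> wX x), (wX x \<boxtimes> Cell Act) \<odot> (tB x \<boxtimes> wF) \<odot> (wB \<boxtimes> tF x))"
| "law ActUnit = (Cell Act \<odot> (wB \<boxtimes> Cell Unit), wB)"
| "law ActUnitB = (Cell Act \<odot> (Cell UnitB \<boxtimes> wF), Cell UnitB \<odot> eps)"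
| "law (SigNat x) = (tB x \<odot> (Cell Sig \<boxtimes> wX x), (wX x \<boxtimes> Cell Sig) \<odot> (tF x \<boxtimes> wF) \<odot> (wF \<boxtimes> tF x))"
| "law (MorCo n) = (rco (Im n) \<odot> Cell (Mor n), (Cell (Mor n) \<boxtimes> wF) \<odot> rco (Ob n))"
| "law (MorTF n) = (tF (Im n) \<odot> (wF \<boxtimes> Cell (Mor n)), (Cell (Mor n) \<boxtimes> wF) \<odot> tF (Ob n))"

text \<open>The families \<open>E\<close>, \<open>E'\<close>, \<open>m\<close> interpret
  \<open>Ob\<close>, \<open>Im\<close> and \<open>Mor\<close>. Statements without morphisms are
  obtained by taking \<open>E'\<close> equal to \<open>E\<close> and identities for
  \<open>m\<close>.\<close>

locale right_comodules = two_category K for K :: "('o, 'c, 'd) two_cat" (structure) +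
  fixes A :: 'o and F :: "('c, 'd) coquasi_data" and B :: "('c, 'd) module_data"
    and \<sigma> \<omega>inv :: 'd and E E' :: "nat \<Rightarrow> ('c, 'd) tobj" and m :: "nat \<Rightarrow> 'd" and \<sigma>inv aux :: 'd
  assumes base: "A \<in> zero_cells K"
    and coquasi: "coquasi_bimonad K A F"
    and module_monad: "right_module_monad K A F B"
    and setting: "TB_setting K A F B"
    and sigma: "\<sigma> \<in> Hom (cell F \<star> cell F) (cell B)"
    and sigma_natural: "X \<in> TB_objects K A F B \<Longrightarrow>
      (\<langle>X\<rangle> \<otimes> \<sigma>) \<bullet> (tauF X \<otimes> \<langle>F\<rangle>) \<bullet> (\<langle>F\<rangle> \<otimes> tauF X) = tauB X \<bullet> (\<sigma> \<otimes> \<langle>X\<rangle>)"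
    and omega_inv: "omega_inverse K A F \<omega>inv"
    and E: "E n \<in> TB_objects K A F B" and E': "E' n \<in> TB_objects K A F B"
    and m: "m n \<in> TB_morphisms K F B (E n) (E' n)"
    and sigma_inv: "\<sigma>inv \<in> Hom (cell F \<star> cell F) (cell B)"
    and aux: "aux \<in> Hom (cell F \<star> cell F) (cell F \<star> cell F \<star> cell B)"
begin

primrec obj :: "ob \<Rightarrow> ('c, 'd) tobj" where
  "obj Reg = regular F B" | "obj (Ob n) = E n" | "obj (Im n) = E' n"

primrec one_cell :: "wire \<Rightarrow> 'c" where
  "one_cell (Wi x) = cell (obj x)" | "one_cell WB = cell B"

primrec two_cell :: "gen \<Rightarrow> 'd" where
  "two_cell Mul = \<mu>\<^bsub>F\<^esub>"
| "two_cell Unit = \<eta>\<^bsub>F\<^esub>"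
| "two_cell Counit = \<epsilon>\<^bsub>F\<^esub>"
| "two_cell Omega = \<omega>\<^bsub>F\<^esub>"
| "two_cell OmegaInv = \<omega>inv"
| "two_cell Act = \<lhd>\<^bsub>B\<^esub>"
| "two_cell MulB = \<mu>\<^bsub>B\<^esub>"
| "two_cell UnitB = \<eta>\<^bsub>B\<^esub>"
| "two_cell Sig = \<sigma>"
| "two_cell SigInv = \<sigma>inv"
| "two_cell Aux = aux"
| "two_cell (Coact x) = \<rho>\<^bsub>obj x\<^esub>"
| "two_cell (TauF x) = tauF (obj x)"
| "two_cell (TauB x) = tauB (obj x)"
| "two_cell (Mor n) = m n"

lemma obj_TB: "obj x \<in> TB_objects K A F B"
  using E E' setting by (cases x) (auto simp: TB_setting_def)

lemma regular_simps [simp]: "cell (regular F B) = cell F" "tauF (regular F B) = \<tau>\<^bsub>F\<^esub>"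
  "tauB (regular F B) = tauBF B" "\<rho>\<^bsub>regular F B\<^esub> = \<Delta>\<^bsub>F\<^esub>"
  by (simp_all add: regular_def)

lemmas object_facts = obj_TB[unfolded TB_objects_def Tambara_comodule_def CQB_object_def
  left_monadic_def right_comonadic_def, simplified]

lemmas coquasi_facts = coquasi[unfolded coquasi_bimonad_def comonad_def left_monadic_def
  right_monadic_def left_comonadic_def right_comonadic_def]

lemmas module_facts = module_monad[unfolded right_module_monad_def monad_def Let_def]

sublocale string_diagrams K A one_cell arity two_cell
proof
  show "one_cell x \<in> endo K A" for x
    using object_facts module_facts by (cases x) auto
  show "two_cell g \<in> Hom (word K A one_cell (fst (arity g))) (word K A one_cell (snd (arity g)))" for g
    using object_facts coquasi_facts module_facts sigma sigma_inv aux omega_inv m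
    by (cases g) (auto simp: omega_inverse_def TB_morphisms_def)
qed (rule base)

lemma sem_delta3: "sem (delta3 Reg Reg Reg) = Delta3 K F"
  by (simp add: delta3_def Delta3_def)

text \<open>Convolution of 2-cells into the identity 1-cell has an identity 2-cell as
  multiplication; it is removed here so that the axioms on \<omega> take the form of
  diagrams.\<close>

lemma one_after_scalar:
  "\<lbrakk>well_typed arity s; target arity s = []\<rbrakk> \<Longrightarrow> id2 K (id1 K A) \<bullet> sem s = sem s"
  using after_one(1)[OF sem_cells, of s] by simp

lemma omega_conv:
  "(\<omega>\<^bsub>F\<^esub> \<otimes> \<omega>inv) \<bullet> Delta3 K F = \<epsilon>\<^bsub>F\<^esub> \<otimes> \<epsilon>\<^bsub>F\<^esub> \<otimes> \<epsilon>\<^bsub>F\<^esub>"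
  "(\<omega>inv \<otimes> \<omega>\<^bsub>F\<^esub>) \<bullet> Delta3 K F = \<epsilon>\<^bsub>F\<^esub> \<otimes> \<epsilon>\<^bsub>F\<^esub> \<otimes> \<epsilon>\<^bsub>F\<^esub>"
  using omega_inv one_after_scalar[of "(Cell Omega \<boxtimes> Cell OmegaInv) \<odot> delta3 Reg Reg Reg"]
    one_after_scalar[of "(Cell OmegaInv \<boxtimes> Cell Omega) \<odot> delta3 Reg Reg Reg"]
    one_after_scalar[of "eps \<boxtimes> eps \<boxtimes> eps"]
  by (simp_all add: omega_inverse_def is_conv_inverse_def conv_def delta3_def Delta3_def)

lemma act_unit: "\<lhd>\<^bsub>B\<^esub> \<bullet> (\<langle>B\<rangle> \<otimes> \<eta>\<^bsub>F\<^esub>) = \<langle>B\<rangle>" "\<lhd>\<^bsub>B\<^esub> \<bullet> (\<eta>\<^bsub>B\<^esub> \<otimes> \<langle>F\<rangle>) = \<eta>\<^bsub>B\<^esub> \<bullet> \<epsilon>\<^bsub>F\<^esub>"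
  using module_facts by blast+

lemma law_sound: "sem (fst (law r)) = sem (snd (law r))"
proof (cases r)
  case OmB
  then show ?thesis using setting by (simp add: TB_setting_def omega_natural_left_def)
next
  case OmOmInv
  then show ?thesis using omega_conv by (simp add: sem_delta3)
next
  case OmInvOm
  then show ?thesis using omega_conv by (simp add: sem_delta3)
next
  case (SigNat x)
  then show ?thesis using sigma_natural[OF obj_TB] by simp
next
  case (MorCo n)
  then show ?thesis using m[of n] by (simp add: TB_morphisms_def)
next
  case (MorTF n)
  then show ?thesis using m[of n] by (simp add: TB_morphisms_def)
next
  case (Coassoc x)
  then show ?thesis using object_facts[of x] by simp
next
  case (CounitR x)
  then show ?thesis using object_facts[of x] by simp
next
  case (Colin x)
  then show ?thesis using object_facts[of x] by simp
next
  case (TFMul x)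
  then show ?thesis using object_facts[of x] by simp
next
  case (TFUnit x)
  then show ?thesis using object_facts[of x] by simp
next
  case (TFComul x)
  then show ?thesis using object_facts[of x] by simp
next
  case (TFCounit x)
  then show ?thesis using object_facts[of x] by simp
next
  case (YB x)
  then show ?thesis using object_facts[of x] by simp
next
  case (TBUnit x)
  then show ?thesis using object_facts[of x] by simp
next
  case (TBColin x)
  then show ?thesis using object_facts[of x] by simp
next
  case (TBTF x)
  then show ?thesis using object_facts[of x] by simp
next
  case (TBAct x)
  then show ?thesis using object_facts[of x] by simp
next
  case ActUnit
  then show ?thesis using act_unit by simp
next
  case ActUnitB
  then show ?thesis using act_unit by simp
qed (use coquasi_facts module_facts in simp_all)

lemmas diagrammatic = sem_eqI[where ax = law, OF law_sound]

end


section \<open>Diagrams for the conditions (ii)-(v) and for Sweedler's conditions\<close>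

definition psi_diag :: "ob \<Rightarrow> diagram" where
  "psi_diag x = (wX x \<boxtimes> Cell Act) \<odot> (tB x \<boxtimes> wF) \<odot> (wB \<boxtimes> rco x)"

definition cocycle_diag :: "ob \<Rightarrow> ob \<Rightarrow> diagram" where
  "cocycle_diag x y = (wX x \<boxtimes> wX y \<boxtimes> Cell Sig) \<odot> (wX x \<boxtimes> tF y \<boxtimes> wF) \<odot> (rco x \<boxtimes> rco y)"

definition tensor_coact :: "ob \<Rightarrow> ob \<Rightarrow> diagram" where
  "tensor_coact x y = (wX x \<boxtimes> wX y \<boxtimes> Cell Mul) \<odot> (wX x \<boxtimes> tF y \<boxtimes> wF) \<odot> (rco x \<boxtimes> rco y)"

definition tensor_tF :: "ob \<Rightarrow> ob \<Rightarrow> diagram" where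
  "tensor_tF x y = (wX x \<boxtimes> tF y) \<odot> (tF x \<boxtimes> wX y)"

definition tensor_tB :: "ob \<Rightarrow> ob \<Rightarrow> diagram" where
  "tensor_tB x y = (wX x \<boxtimes> tB y) \<odot> (tB x \<boxtimes> wX y)"

text \<open>The word of two wires is interpreted as the identity of the single 1-cell XY, so that
  unfolding yields \<open>psi\<close> of \<open>TB_tensor\<close> verbatim.\<close>

definition tensor_psi :: "ob \<Rightarrow> ob \<Rightarrow> diagram" where
  "tensor_psi x y = (Wires [Wi x, Wi y] \<boxtimes> Cell Act) \<odot> (tensor_tB x y \<boxtimes> wF) \<odot> (wB \<boxtimes> tensor_coact x y)"

definition assoc_diag :: "ob \<Rightarrow> ob \<Rightarrow> ob \<Rightarrow> diagram" where
  "assoc_diag x y z = (wX x \<boxtimes> wX y \<boxtimes> wX z \<boxtimes> Cell Omega) \<odot> (wX x \<boxtimes> wX y \<boxtimes> tF z \<boxtimes> wF \<boxtimes> wF)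
     \<odot> (wX x \<boxtimes> tF y \<boxtimes> tF z \<boxtimes> wF) \<odot> (rco x \<boxtimes> rco y \<boxtimes> rco z)"

definition cocycle_XY_Z :: "ob \<Rightarrow> ob \<Rightarrow> ob \<Rightarrow> diagram" where
  "cocycle_XY_Z x y z = (Wires [Wi x, Wi y] \<boxtimes> wX z \<boxtimes> Cell Sig) \<odot> (Wires [Wi x, Wi y] \<boxtimes> tF z \<boxtimes> wF)
     \<odot> (tensor_coact x y \<boxtimes> rco z)"

definition cocycle_X_YZ :: "ob \<Rightarrow> ob \<Rightarrow> ob \<Rightarrow> diagram" where
  "cocycle_X_YZ x y z = (wX x \<boxtimes> Wires [Wi y, Wi z] \<boxtimes> Cell Sig) \<odot> (wX x \<boxtimes> tensor_tF y z \<boxtimes> wF)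
     \<odot> (rco x \<boxtimes> tensor_coact y z)"

definition mu_M :: diagram where
  "mu_M = (Cell Mul \<boxtimes> Cell Sig) \<odot> (wF \<boxtimes> tF Reg \<boxtimes> wF) \<odot> (rco Reg \<boxtimes> rco Reg)"

definition eta_M :: diagram where
  "eta_M = Cell Unit \<boxtimes> Cell UnitB"

definition convolution :: "diagram \<Rightarrow> diagram \<Rightarrow> diagram" where
  "convolution s t = Cell MulB \<odot> (s \<boxtimes> t) \<odot> delta2 Reg Reg"

text \<open>The two sides of Sweedler's third and fifth condition, the latter without \<open>\<beta>\<close>.\<close>

definition module_left :: diagram where
  "module_left = Cell MulB \<odot> (Cell Sig \<boxtimes> wB) \<odot> (wF \<boxtimes> psi_diag Reg) \<odot> (psi_diag Reg \<boxtimes> wF)"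

definition module_right :: diagram where
  "module_right = Cell MulB \<odot> (Cell Act \<boxtimes> wB) \<odot> (wB \<boxtimes> mu_M)"

definition cocycle_left :: diagram where
  "cocycle_left = Cell MulB \<odot> (Cell Sig \<boxtimes> wB) \<odot> (wF \<boxtimes> psi_diag Reg) \<odot> (mu_M \<boxtimes> wF)"

definition cocycle_right :: diagram where
  "cocycle_right = Cell MulB \<odot> (Cell Sig \<boxtimes> wB) \<odot> (wF \<boxtimes> mu_M)"

definition twisted_cocycle_right :: diagram where
  "twisted_cocycle_right = Cell MulB \<odot> (Cell Sig \<boxtimes> wB) \<odot> (wF \<boxtimes> mu_M)
     \<odot> (Cell OmegaInv \<boxtimes> wF \<boxtimes> wF \<boxtimes> wF) \<odot> delta3 Reg Reg Reg"

text \<open>The 2-cell from BXY to XYBFF to whose last three wires the 2-cells BFF \<rightarrow> B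
  belonging to (iii) are applied.\<close>

definition tauB_delta2 :: "ob \<Rightarrow> ob \<Rightarrow> diagram" where
  "tauB_delta2 x y = (tensor_tB x y \<boxtimes> wF \<boxtimes> wF) \<odot> (wB \<boxtimes> delta2 x y)"

abbreviation "oX \<equiv> Ob 0"
abbreviation "oY \<equiv> Ob 1"
abbreviation "oZ \<equiv> Ob 2"

section \<open>Passing the counit through \<open>tauBF\<close>\<close>

context right_comodules
begin

text \<open>
  \<open>\<epsilon>\<close> is not assumed to pass through \<open>\<tau>\<^bsub>B,F\<^esub>\<close>.  Since \<open>\<tau>\<^bsub>B,F\<^esub>\<close> is compatible with \<open>\<Delta>\<close>, it
  absorbs the 2-cell \<open>(\<epsilon> \<times> B)\<tau>\<^bsub>B,F\<^esub>\<close>, hence so does \<open>B \<times> \<omega>\<close>, and \<open>\<omega>\<close> can be cancelled.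
\<close>

lemma omega_absorbs:
  "sem (wB \<boxtimes> Cell Omega) = sem ((((eps \<boxtimes> wB) \<odot> tB Reg) \<boxtimes> Cell Omega) \<odot> (wB \<boxtimes> rco Reg \<boxtimes> wF \<boxtimes> wF))"
  by (rule diagrammatic[where hyps = "[]" and ss = "
    [Fwd 0 0 (Ax OmB), Bwd 1 0 (Ax CounitL), Fwd 0 0 (Ax (TBColin Reg)), LeftOf 2,
     Bwd 3 0 (Ax OmB), RightOf 2, RightOf 1]"], simp, code_simp)

text \<open>Write the three counits as the convolution of \<omega> with its inverse and let \<omega>
  absorb; coassociativity separates the absorbed 2-cell from \<omega> and its inverse, which then
  collapse to counits again.\<close>

lemma tauB_counits:
  "sem (wB \<boxtimes> eps \<boxtimes> eps \<boxtimes> eps) = sem (((eps \<boxtimes> wB) \<odot> tB Reg) \<boxtimes> eps \<boxtimes> eps)"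
  by (rule diagrammatic[where hyps = "[(wB \<boxtimes> Cell Omega,
      (((eps \<boxtimes> wB) \<odot> tB Reg) \<boxtimes> Cell Omega) \<odot> (wB \<boxtimes> rco Reg \<boxtimes> wF \<boxtimes> wF))]" and ss = "
    [Bwd 0 1 (Ax OmOmInv), Fwd 7 0 (Hyp 0), RightOf 2, LeftOf 6, LeftOf 5, LeftOf 4,
     Fwd 3 1 (Ax (Coassoc Reg)), LeftOf 2, LeftOf 1, LeftOf 0, LeftOf 3, Fwd 1 2 (Ax OmOmInv),
     LeftOf 2, LeftOf 1, Fwd 0 1 (Ax (CounitR Reg))]"],
    use omega_absorbs in simp, code_simp)

lemma tauB_counit: "sem ((eps \<boxtimes> wB) \<odot> tB Reg) = sem (wB \<boxtimes> eps)"
  by (rule diagrammatic[where hyps = "[(wB \<boxtimes> eps \<boxtimes> eps \<boxtimes> eps, ((eps \<boxtimes> wB) \<odot> tB Reg) \<boxtimes> eps \<boxtimes> eps)]"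
      and ss = "
    [Bwd 0 2 (Ax UnitCounit), Bwd 0 2 (Ax UnitCounit), RightOf 1, RightOf 2, Bwd 2 0 (Hyp 0),
     Fwd 1 3 (Ax UnitCounit), Fwd 0 2 (Ax UnitCounit)]"], use tauB_counits in simp, code_simp)

section \<open>Recovering \<sigma>, and the unit conditions\<close>

text \<open>The counit is multiplicative, so it falls on both factors, passes through \<tau> and
  cancels the two comultiplications.\<close>

lemma sweedler_sigma: "sem ((eps \<boxtimes> wB) \<odot> mu_M) = sem (Cell Sig)"
  by (rule diagrammatic[where hyps = "[]" and ss = "
    [Fwd 4 0 (Ax MulCounit), LeftOf 3, Fwd 2 1 (Ax TauCounit), LeftOf 0, Fwd 1 2 (Ax CounitL),
     LeftOf 1, Fwd 0 0 (Ax CounitL)]"], simp, code_simp)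

text \<open>Both sides are the identity of B, by the unit laws of the monad and of the
  action.\<close>

lemma eta_M_central:
  "sem (Cell MulB \<odot> (eps \<boxtimes> wB \<boxtimes> wB) \<odot> (eta_M \<boxtimes> wB)) = sem (Cell MulB \<odot> (Cell Act \<boxtimes> wB) \<odot> (wB \<boxtimes> eta_M))"
  by (rule diagrammatic[where hyps = "[]" and ss = "
    [Fwd 1 0 (Ax UnitCounit), Fwd 0 0 (Ax UnitLB), Bwd 0 0 (Ax UnitRB), Bwd 1 0 (Ax ActUnit)]"], simp, code_simp)

text \<open>The unit of B slides through \<psi>, so that \<psi> disappears from Sweedler's unit
  condition.\<close>

lemma sigma_unit_left:
  "sem (Cell MulB \<odot> (Cell Sig \<boxtimes> wB) \<odot> (wF \<boxtimes> psi_diag Reg) \<odot> (eta_M \<boxtimes> wF)) = sem (Cell Sig \<odot> (Cell Unit \<boxtimes> wF))"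
  by (rule diagrammatic[where hyps = "[]" and ss = "
    [LeftOf 0, RightOf 1, Fwd 2 1 (Ax (TBUnit Reg)), Fwd 2 2 (Ax ActUnitB),
     Fwd 1 1 (Ax (CounitR Reg)), LeftOf 1, Fwd 2 0 (Ax UnitRB)]"], simp, code_simp)

lemma sigma_unit_right:
  "sem (Cell MulB \<odot> (Cell Sig \<boxtimes> wB) \<odot> (wF \<boxtimes> eta_M)) = sem (Cell Sig \<odot> (wF \<boxtimes> Cell Unit))"
  by (rule diagrammatic[where hyps = "[]" and ss = "
    [LeftOf 0, LeftOf 1, Fwd 2 0 (Ax UnitRB)]"], simp, code_simp)

text \<open>The unit object has coaction \<eta> and an identity as \<open>tauF\<close>, so at X, Id
  the given 2-cell is the coaction of X followed by a 2-cell F \<rightarrow> B. The next lemma does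
  the same for Id, X.\<close>

lemma cocycle_right_unit:
  "sem ((wX oX \<boxtimes> Wires [] \<boxtimes> Cell Sig) \<odot> (wX oX \<boxtimes> wF \<boxtimes> wF) \<odot> (rco oX \<boxtimes> Cell Unit))
   = sem ((wX oX \<boxtimes> (Cell Sig \<odot> (wF \<boxtimes> Cell Unit))) \<odot> rco oX)"
  by (rule diagrammatic[where hyps = "[]" and ss = "
    [LeftOf 0]"], simp, code_simp)

lemma cocycle_left_unit:
  "sem ((Wires [] \<boxtimes> wX oX \<boxtimes> Cell Sig) \<odot> (Wires [] \<boxtimes> tF oX \<boxtimes> wF) \<odot> (Cell Unit \<boxtimes> rco oX))
   = sem ((wX oX \<boxtimes> (Cell Sig \<odot> (Cell Unit \<boxtimes> wF))) \<odot> rco oX)"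
  by (rule diagrammatic[where hyps = "[]" and ss = "
    [Fwd 1 0 (Ax (TFUnit (Ob 0)))]"], simp, code_simp)

lemma unit_coact: "sem ((wX oX \<boxtimes> (Cell UnitB \<odot> eps)) \<odot> rco oX) = sem (wX oX \<boxtimes> Cell UnitB)"
  by (rule diagrammatic[where hyps = "[]" and ss = "
    [Fwd 0 0 (Ax (CounitR (Ob 0)))]"], simp, code_simp)

lemma counit_sigma_unit:
  "sem ((eps \<boxtimes> wB) \<odot> (wF \<boxtimes> (Cell Sig \<odot> (wF \<boxtimes> Cell Unit))) \<odot> rco Reg) = sem (Cell Sig \<odot> (wF \<boxtimes> Cell Unit))"
  "sem ((eps \<boxtimes> wB) \<odot> (wF \<boxtimes> (Cell Sig \<odot> (Cell Unit \<boxtimes> wF))) \<odot> rco Reg) = sem (Cell Sig \<odot> (Cell Unit \<boxtimes> wF))"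
  "sem ((eps \<boxtimes> wB) \<odot> (wF \<boxtimes> Cell UnitB)) = sem (Cell UnitB \<odot> eps)"
  by (rule diagrammatic[where hyps = "[]" and ss = "
    [RightOf 0, LeftOf 2, Fwd 1 0 (Ax CounitL)]"], simp, code_simp)
    (rule diagrammatic[where hyps = "[]" and ss = "
    [LeftOf 2, LeftOf 1, Fwd 0 0 (Ax CounitL)]"], simp, code_simp,
     rule diagrammatic[where hyps = "[]" and ss = "
    [LeftOf 0]"], simp, code_simp)

lemma cocycle_natural:
  "sem ((Cell (Mor 0) \<boxtimes> Cell (Mor 1) \<boxtimes> wB) \<odot> cocycle_diag oX oY)
   = sem (cocycle_diag (Im 0) (Im 1) \<odot> (Cell (Mor 0) \<boxtimes> Cell (Mor 1)))"
  by (rule diagrammatic[where hyps = "[]" and ss = "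
    [LeftOf 4, LeftOf 3, LeftOf 2, LeftOf 4, Bwd 3 1 (Ax (MorTF 1)), RightOf 2, RightOf 1,
     Bwd 0 1 (Ax (MorCo 1)), Bwd 2 0 (Ax (MorCo 0)), LeftOf 1]"], simp, code_simp)

section \<open>Invertibility\<close>

text \<open>By coassociativity of the coaction of FF on XY, composing two such 2-cells and
  multiplying in B amounts to convolution; the one applied last receives the inner legs and becomes
  the left factor.\<close>

lemma inverse_product:
  "sem ((wX oX \<boxtimes> wX oY \<boxtimes> Cell MulB) \<odot> (((wX oX \<boxtimes> wX oY \<boxtimes> Cell SigInv) \<odot> delta2 oX oY) \<boxtimes> wB) \<odot> cocycle_diag oX oY)
   = sem ((wX oX \<boxtimes> wX oY \<boxtimes> convolution (Cell SigInv) (Cell Sig)) \<odot> delta2 oX oY)"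
  "sem ((wX oX \<boxtimes> wX oY \<boxtimes> Cell MulB) \<odot> (cocycle_diag oX oY \<boxtimes> wB) \<odot> (wX oX \<boxtimes> wX oY \<boxtimes> Cell SigInv) \<odot> delta2 oX oY)
   = sem ((wX oX \<boxtimes> wX oY \<boxtimes> convolution (Cell Sig) (Cell SigInv)) \<odot> delta2 oX oY)"
  by (rule diagrammatic[where hyps = "[]" and ss = "
    [LeftOf 3, Fwd 2 1 (Ax (Colin (Ob 1))), RightOf 1, LeftOf 5, LeftOf 4, LeftOf 3,
     Fwd 2 0 (Ax (Coassoc (Ob 0))), Fwd 0 1 (Ax (Coassoc (Ob 1))), LeftOf 1, LeftOf 6,
     LeftOf 5, Bwd 3 1 (Ax (TFComul (Ob 1))), LeftOf 2]"], simp, code_simp)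
    (rule diagrammatic[where hyps = "[]" and ss = "
    [LeftOf 3, Fwd 2 1 (Ax (Colin (Ob 1))), RightOf 1, LeftOf 5, LeftOf 4, LeftOf 3,
     Fwd 2 0 (Ax (Coassoc (Ob 0))), Fwd 0 1 (Ax (Coassoc (Ob 1))), LeftOf 1, LeftOf 6,
     LeftOf 5, Bwd 3 1 (Ax (TFComul (Ob 1))), LeftOf 2]"], simp, code_simp)

lemma unit_delta2:
  "sem ((wX oX \<boxtimes> wX oY \<boxtimes> (Cell UnitB \<odot> (eps \<boxtimes> eps))) \<odot> delta2 oX oY) = sem (wX oX \<boxtimes> wX oY \<boxtimes> Cell UnitB)"
  by (rule diagrammatic[where hyps = "[]" and ss = "
    [LeftOf 0, RightOf 2, Fwd 1 2 (Ax (CounitR (Ob 1))), Fwd 1 1 (Ax (TFCounit (Ob 1))),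
     Fwd 0 0 (Ax (CounitR (Ob 0)))]"], simp, code_simp)

text \<open>
  A two-sided inverse of \<open>\<sigma>\<close> in the form of a 2-cell \<open>FF \<rightarrow> FFB\<close> is left \<open>FF\<close>-colinear, because
  \<open>(FF \<times> \<sigma>)\<Delta>\<^bsub>FF\<^esub>\<close> is; hence it comes from a convolution inverse.
\<close>

context
  assumes aux_left: "sem ((wF \<boxtimes> wF \<boxtimes> Cell MulB) \<odot> (Cell Aux \<boxtimes> wB) \<odot> cocycle_diag Reg Reg) = sem (wF \<boxtimes> wF \<boxtimes> Cell UnitB)"
    and aux_right: "sem ((wF \<boxtimes> wF \<boxtimes> Cell MulB) \<odot> (cocycle_diag Reg Reg \<boxtimes> wB) \<odot> Cell Aux) = sem (wF \<boxtimes> wF \<boxtimes> Cell UnitB)"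
begin

lemma delta2_coassoc:
  "sem ((delta2 Reg Reg \<boxtimes> wF \<boxtimes> wF) \<odot> delta2 Reg Reg) = sem ((wF \<boxtimes> wF \<boxtimes> delta2 Reg Reg) \<odot> delta2 Reg Reg)"
  by (rule diagrammatic[where hyps = "[]" and ss = "
    [Fwd 2 1 (Ax (Colin Reg)), LeftOf 0, Fwd 1 2 (Ax (Coassoc Reg)), RightOf 0, RightOf 1,
     LeftOf 4, LeftOf 3, Fwd 2 0 (Ax (Coassoc Reg)), LeftOf 1, LeftOf 5,
     Bwd 3 1 (Ax (TFComul Reg)), LeftOf 2]"], simp, code_simp)

text \<open>The first hypothesis inserts, after the comultiplication of FF, the given 2-cell
  followed by a second \<open>Aux\<close>. Coassociativity pulls the inserted 2-cell in front of the
  comultiplication, where the second hypothesis cancels it against the original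
  \<open>Aux\<close>.\<close>

lemma aux_colinear: "sem ((delta2 Reg Reg \<boxtimes> wB) \<odot> Cell Aux) = sem ((wF \<boxtimes> wF \<boxtimes> Cell Aux) \<odot> delta2 Reg Reg)"
  by (rule diagrammatic[where
      hyps = "[((wF \<boxtimes> wF \<boxtimes> Cell MulB) \<odot> (Cell Aux \<boxtimes> wB) \<odot> cocycle_diag Reg Reg, wF \<boxtimes> wF \<boxtimes> Cell UnitB),
        ((wF \<boxtimes> wF \<boxtimes> Cell MulB) \<odot> (cocycle_diag Reg Reg \<boxtimes> wB) \<odot> Cell Aux, wF \<boxtimes> wF \<boxtimes> Cell UnitB),
        ((delta2 Reg Reg \<boxtimes> wF \<boxtimes> wF) \<odot> delta2 Reg Reg, (wF \<boxtimes> wF \<boxtimes> delta2 Reg Reg) \<odot> delta2 Reg Reg)]"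
      and ss = "
    [Bwd 4 4 (Ax UnitLB), Bwd 4 2 (Hyp 0), Fwd 9 4 (Ax AssocB), RightOf 8, Bwd 1 0 (Hyp 2),
     RightOf 6, RightOf 5, RightOf 4, RightOf 7, RightOf 6, RightOf 5, Fwd 0 0 (Hyp 1),
     LeftOf 0, LeftOf 1, LeftOf 2, LeftOf 3, Fwd 4 4 (Ax UnitRB)]"], use aux_left aux_right delta2_coassoc in simp, code_simp)

text \<open>The first equation is \<open>aux_left\<close> followed by counits. In the second the
  counits stand between \<open>Aux\<close> and the comultiplication of FF; colinearity lets them
  cancel the latter, and what remains is \<open>aux_right\<close> followed by counits.\<close>

lemma aux_conv:
  "sem (convolution ((eps \<boxtimes> eps \<boxtimes> wB) \<odot> Cell Aux) (Cell Sig)) = sem (Cell UnitB \<odot> (eps \<boxtimes> eps))"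
  "sem (convolution (Cell Sig) ((eps \<boxtimes> eps \<boxtimes> wB) \<odot> Cell Aux)) = sem (Cell UnitB \<odot> (eps \<boxtimes> eps))"
  by (rule diagrammatic[where
      hyps = "[((wF \<boxtimes> wF \<boxtimes> Cell MulB) \<odot> (Cell Aux \<boxtimes> wB) \<odot> cocycle_diag Reg Reg, wF \<boxtimes> wF \<boxtimes> Cell UnitB)]"
      and ss = "
    [RightOf 6, RightOf 5, Fwd 0 0 (Hyp 0), LeftOf 0, LeftOf 1]"], use aux_left in simp, code_simp)
    (rule diagrammatic[where
      hyps = "[((wF \<boxtimes> wF \<boxtimes> Cell MulB) \<odot> (cocycle_diag Reg Reg \<boxtimes> wB) \<odot> Cell Aux, wF \<boxtimes> wF \<boxtimes> Cell UnitB),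
        ((delta2 Reg Reg \<boxtimes> wB) \<odot> Cell Aux, (wF \<boxtimes> wF \<boxtimes> Cell Aux) \<odot> delta2 Reg Reg)]"
      and ss = "
    [Bwd 0 0 (Hyp 1), RightOf 3, Fwd 4 1 (Ax (TFCounit Reg)), LeftOf 1,
     Fwd 2 2 (Ax (CounitR Reg)), Fwd 1 0 (Ax (CounitR Reg)), Bwd 1 0 (Ax CounitL), RightOf 2,
     RightOf 3, Bwd 2 2 (Ax CounitL), RightOf 1, Bwd 3 1 (Ax TauCounit), RightOf 4, RightOf 5,
     Fwd 0 0 (Hyp 0), LeftOf 0, LeftOf 1]"], use aux_right aux_colinear in simp, code_simp)

end

section \<open>Linearity over B\<close>

text \<open>Coactions taken after B has crossed a cell are moved in front of the crossing by
  \<open>TBColin\<close>, and actions performed before B crosses are postponed by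
  \<open>TBAct\<close>. \<open>TBTF\<close> then reorders the crossings of Y by B and F.\<close>

lemma linearity_left:
  "sem ((wX oX \<boxtimes> wX oY \<boxtimes> Cell MulB) \<odot> (cocycle_diag oX oY \<boxtimes> wB) \<odot> (wX oX \<boxtimes> psi_diag oY) \<odot> (psi_diag oX \<boxtimes> wX oY))
   = sem ((wX oX \<boxtimes> wX oY \<boxtimes> module_left) \<odot> tauB_delta2 oX oY)"
  by (rule diagrammatic[where hyps = "[]" and ss = "
    [RightOf 2, LeftOf 6, RightOf 1, LeftOf 5, LeftOf 4, LeftOf 3,
     Fwd 2 0 (Ax (TBColin (Ob 0))), LeftOf 7, Fwd 6 2 (Ax (TBColin (Ob 1))), RightOf 0,
     Fwd 1 1 (Ax (Coassoc (Ob 0))), LeftOf 0, LeftOf 1, LeftOf 2, LeftOf 3, LeftOf 4,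
     Fwd 5 3 (Ax (Coassoc (Ob 1))), RightOf 4, RightOf 5, Fwd 6 2 (Ax (TBAct (Ob 1))),
     Fwd 8 3 (Ax (TBAct Reg)), RightOf 3, RightOf 4, LeftOf 11, RightOf 2, RightOf 3,
     LeftOf 10, RightOf 1, RightOf 0, RightOf 5, LeftOf 9, LeftOf 8,
     Bwd 6 1 (Ax (TBTF (Ob 1))), LeftOf 3, LeftOf 4, LeftOf 5, LeftOf 6, LeftOf 7, LeftOf 2,
     Bwd 9 3 (Ax (TBAct Reg)), LeftOf 8, Bwd 3 2 (Ax (TFComul (Ob 1))), LeftOf 4, RightOf 2]"], simp, code_simp)

lemma linearity_right:
  "sem ((wX oX \<boxtimes> wX oY \<boxtimes> Cell MulB) \<odot> (tensor_psi oX oY \<boxtimes> wB) \<odot> (wB \<boxtimes> cocycle_diag oX oY))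
   = sem ((wX oX \<boxtimes> wX oY \<boxtimes> module_right) \<odot> tauB_delta2 oX oY)"
  by (rule diagrammatic[where hyps = "[]" and ss = "
    [LeftOf 3, Fwd 2 2 (Ax (Colin (Ob 1))), RightOf 1, LeftOf 5, LeftOf 4, LeftOf 3,
     Fwd 2 1 (Ax (Coassoc (Ob 0))), Fwd 0 2 (Ax (Coassoc (Ob 1))), LeftOf 1, LeftOf 8,
     LeftOf 7, LeftOf 6, LeftOf 5, LeftOf 4, LeftOf 3, LeftOf 2, LeftOf 7, LeftOf 6, LeftOf 9,
     LeftOf 8, LeftOf 7, Bwd 4 2 (Ax (TFComul (Ob 1))), LeftOf 3, LeftOf 5, LeftOf 4, RightOf 2]"], simp, code_simp)

text \<open>The counits have to pass through the crossings of B with both copies of F, which is what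
  \<open>tauB_counit\<close> is for.\<close>

lemma linearity_regular:
  "sem ((eps \<boxtimes> eps \<boxtimes> wB) \<odot> (wF \<boxtimes> wF \<boxtimes> module_left) \<odot> tauB_delta2 Reg Reg) = sem module_left"
  "sem ((eps \<boxtimes> eps \<boxtimes> wB) \<odot> (wF \<boxtimes> wF \<boxtimes> module_right) \<odot> tauB_delta2 Reg Reg) = sem module_right"
  by (rule diagrammatic[where hyps = "[((eps \<boxtimes> wB) \<odot> tB Reg, wB \<boxtimes> eps)]" and ss = "
    [RightOf 4, RightOf 7, LeftOf 13, RightOf 3, RightOf 6, LeftOf 12, RightOf 5, LeftOf 11,
     RightOf 4, LeftOf 10, LeftOf 9, LeftOf 8, LeftOf 7, LeftOf 6, Fwd 5 0 (Hyp 0), LeftOf 12,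
     LeftOf 11, LeftOf 10, LeftOf 9, LeftOf 8, LeftOf 7, Fwd 6 0 (Hyp 0), RightOf 3, LeftOf 4,
     RightOf 2, LeftOf 3, RightOf 1, Fwd 2 1 (Ax CounitL), LeftOf 3, Fwd 2 1 (Ax TauCounit),
     LeftOf 1, Fwd 0 2 (Ax CounitL), Fwd 3 1 (Ax (TBAct Reg)), LeftOf 0, LeftOf 1,
     Bwd 3 1 (Ax (TBAct Reg)), LeftOf 2]"],
      use tauB_counit in simp, code_simp)
    (rule diagrammatic[where hyps = "[((eps \<boxtimes> wB) \<odot> tB Reg, wB \<boxtimes> eps)]" and ss = "
    [RightOf 4, RightOf 5, RightOf 6, RightOf 7, RightOf 8, LeftOf 12, RightOf 3, RightOf 4,
     RightOf 5, RightOf 6, RightOf 7, LeftOf 11, LeftOf 10, LeftOf 9, Fwd 8 0 (Hyp 0),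
     LeftOf 11, LeftOf 10, Fwd 9 0 (Hyp 0), RightOf 2, LeftOf 7, RightOf 1, LeftOf 6, LeftOf 5,
     LeftOf 4, LeftOf 3, Fwd 2 1 (Ax CounitL), LeftOf 6, LeftOf 5, LeftOf 4, LeftOf 3,
     Fwd 2 1 (Ax TauCounit), LeftOf 1, Fwd 0 2 (Ax CounitL)]"],
      use tauB_counit in simp, code_simp)

section \<open>Associativity\<close>

text \<open>The B produced at X, Y must cross Z and its coaction. \<open>SigNat\<close> lets the
  arguments of \<sigma> cross instead, and \<open>TFMul\<close> does this for the multiplication in
  the coaction of XY. All legs are then on the right of XYZ and are regrouped by \<open>YB\<close>
  and \<open>TFComul\<close>. The associator acts last, so \<omega> is the left convolution
  factor.\<close>

lemma associativity_left:
  "sem ((assoc_diag oX oY oZ \<boxtimes> Cell MulB) \<odot> (cocycle_XY_Z oX oY oZ \<boxtimes> wB)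
     \<odot> (wX oX \<boxtimes> wX oY \<boxtimes> psi_diag oZ) \<odot> (cocycle_diag oX oY \<boxtimes> wX oZ))
   = sem ((wX oX \<boxtimes> wX oY \<boxtimes> wX oZ \<boxtimes> ((Cell Omega \<boxtimes> cocycle_left) \<odot> delta3 Reg Reg Reg)) \<odot> delta3 oX oY oZ)"
  by (rule diagrammatic[where hyps = "[]" and ss = "
    [RightOf 3, LeftOf 7, RightOf 2, LeftOf 6, LeftOf 5, LeftOf 4, Fwd 3 1 (Ax (Colin (Ob 1))),
     LeftOf 16, LeftOf 15, LeftOf 14, LeftOf 13, LeftOf 12, Fwd 11 1 (Ax (Colin (Ob 1))),
     LeftOf 9, LeftOf 10, LeftOf 8, LeftOf 9, LeftOf 7, LeftOf 8, LeftOf 6, LeftOf 7, LeftOf 5,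
     LeftOf 6, LeftOf 4, Fwd 5 2 (Ax (Colin (Ob 1))), LeftOf 18, LeftOf 17,
     Fwd 16 3 (Ax (Colin (Ob 2))), LeftOf 11, Fwd 10 5 (Ax (TBColin (Ob 2))), LeftOf 13,
     LeftOf 14, LeftOf 15, LeftOf 16, LeftOf 12, LeftOf 13, LeftOf 14, LeftOf 15, LeftOf 11,
     LeftOf 12, LeftOf 13, Fwd 14 4 (Ax (TBColin (Ob 2))), RightOf 1, RightOf 2,
     Fwd 3 0 (Ax (Coassoc (Ob 0))), RightOf 4, RightOf 9, RightOf 13, LeftOf 22, RightOf 3,
     RightOf 8, RightOf 12, LeftOf 21, RightOf 7, RightOf 11, LeftOf 20, RightOf 6, RightOf 10,
     LeftOf 19, RightOf 5, RightOf 9, LeftOf 18, RightOf 4, RightOf 8, LeftOf 17, RightOf 7,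
     LeftOf 16, RightOf 6, LeftOf 15, RightOf 5, LeftOf 14, LeftOf 13, LeftOf 12, LeftOf 11,
     LeftOf 10, LeftOf 9, LeftOf 8, LeftOf 7, Fwd 6 0 (Ax (Coassoc (Ob 0))), RightOf 0,
     Fwd 1 1 (Ax (Coassoc (Ob 1))), LeftOf 2, Fwd 1 1 (Ax (Coassoc (Ob 1))), LeftOf 0,
     LeftOf 1, LeftOf 2, Fwd 3 5 (Ax (Coassoc (Ob 2))), LeftOf 4,
     Fwd 3 5 (Ax (Coassoc (Ob 2))), RightOf 15, RightOf 16, RightOf 17, RightOf 18,
     Fwd 19 4 (Ax (TFMul (Ob 2))), Fwd 21 5 (Ax (TFMul Reg)), LeftOf 12, LeftOf 13,
     Fwd 14 6 (Ax (SigNat (Ob 2))), Fwd 16 7 (Ax (SigNat Reg)), Fwd 18 8 (Ax (SigNat Reg)),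
     LeftOf 21, LeftOf 22, LeftOf 23, LeftOf 24, LeftOf 28, LeftOf 29, LeftOf 30, LeftOf 20,
     LeftOf 21, LeftOf 22, LeftOf 23, LeftOf 27, LeftOf 28, LeftOf 29, LeftOf 26, LeftOf 27,
     LeftOf 28, LeftOf 25, LeftOf 26, LeftOf 27, LeftOf 24, LeftOf 25, LeftOf 26, RightOf 2,
     RightOf 1, RightOf 0, LeftOf 5, LeftOf 4, LeftOf 3, LeftOf 2, RightOf 4, RightOf 3,
     LeftOf 6, LeftOf 7, RightOf 13, RightOf 12, RightOf 11, RightOf 10, RightOf 9, RightOf 14,
     RightOf 13, LeftOf 19, LeftOf 18, LeftOf 17, LeftOf 16, RightOf 15, RightOf 14,
     Bwd 12 5 (Ax (YB (Ob 2))), RightOf 11, RightOf 10, LeftOf 20, LeftOf 19, LeftOf 18,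
     LeftOf 17, LeftOf 23, LeftOf 22, LeftOf 21, LeftOf 20, LeftOf 19, LeftOf 18,
     Bwd 16 3 (Ax (YB (Ob 2))), RightOf 15, LeftOf 14, Bwd 12 4 (Ax (YB (Ob 2))), RightOf 11,
     RightOf 18, RightOf 17, RightOf 16, RightOf 15, RightOf 14, RightOf 13, RightOf 12,
     RightOf 19, RightOf 18, RightOf 17, LeftOf 22, LeftOf 21, RightOf 20, RightOf 19,
     RightOf 18, Bwd 16 6 (Ax (YB Reg)), RightOf 15, RightOf 14, RightOf 13, LeftOf 18,
     LeftOf 17, LeftOf 16, LeftOf 15, LeftOf 24, LeftOf 23, LeftOf 22, LeftOf 21, LeftOf 20,
     LeftOf 19, LeftOf 18, LeftOf 17, LeftOf 16, LeftOf 20, LeftOf 19, LeftOf 18, LeftOf 25,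
     LeftOf 24, LeftOf 23, LeftOf 22, LeftOf 21, LeftOf 20, LeftOf 19, LeftOf 22, LeftOf 21,
     LeftOf 25, LeftOf 24, LeftOf 23, LeftOf 28, LeftOf 27, LeftOf 8, LeftOf 9, LeftOf 10,
     LeftOf 11, LeftOf 12, LeftOf 13, LeftOf 14, LeftOf 15, LeftOf 16, LeftOf 17, LeftOf 18,
     LeftOf 19, LeftOf 20, RightOf 7, LeftOf 21, RightOf 8, LeftOf 22, RightOf 9, RightOf 6,
     LeftOf 23, RightOf 10, RightOf 7, LeftOf 26, LeftOf 25, LeftOf 24, RightOf 11, RightOf 8,
     Bwd 26 7 (Ax (SigNat Reg)), LeftOf 25, RightOf 24, Bwd 12 2 (Ax (TFComul (Ob 1))),
     LeftOf 11, LeftOf 10, LeftOf 13, LeftOf 12, LeftOf 11, Bwd 14 3 (Ax (TFComul (Ob 2))),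
     LeftOf 13, LeftOf 12, LeftOf 15, LeftOf 14, LeftOf 13, Bwd 9 1 (Ax (TFComul (Ob 1))),
     LeftOf 8, LeftOf 7, LeftOf 6, LeftOf 5, LeftOf 4, LeftOf 3,
     Bwd 10 2 (Ax (TFComul (Ob 2))), Bwd 6 4 (Ax (TFComul (Ob 2))), LeftOf 7, LeftOf 8,
     LeftOf 9, Bwd 5 3 (Ax (TFComul (Ob 2))), LeftOf 4, LeftOf 6, LeftOf 5, RightOf 3,
     Bwd 12 4 (Ax (TFComul Reg)), LeftOf 11, LeftOf 10, LeftOf 9, Bwd 13 5 (Ax (TFComul Reg)),
     Bwd 10 6 (Ax (TFComul Reg)), LeftOf 11, RightOf 9]"], simp, code_simp)

lemma associativity_right:
  "sem ((wX oX \<boxtimes> wX oY \<boxtimes> wX oZ \<boxtimes> Cell MulB) \<odot> (cocycle_X_YZ oX oY oZ \<boxtimes> wB) \<odot> (wX oX \<boxtimes> cocycle_diag oY oZ))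
   = sem ((wX oX \<boxtimes> wX oY \<boxtimes> wX oZ \<boxtimes> cocycle_right) \<odot> delta3 oX oY oZ)"
  by (rule diagrammatic[where hyps = "[]" and ss = "
    [LeftOf 3, Fwd 2 2 (Ax (Colin (Ob 2))), RightOf 1, LeftOf 5, LeftOf 4, LeftOf 3,
     Fwd 2 1 (Ax (Coassoc (Ob 1))), Fwd 0 2 (Ax (Coassoc (Ob 2))), LeftOf 1, LeftOf 8,
     LeftOf 7, LeftOf 6, LeftOf 5, LeftOf 4, LeftOf 3, LeftOf 2, LeftOf 9, LeftOf 8, LeftOf 7,
     LeftOf 6, LeftOf 5, LeftOf 4, LeftOf 3, LeftOf 8, LeftOf 7, LeftOf 10, LeftOf 9, LeftOf 8,
     Bwd 5 3 (Ax (TFComul (Ob 2))), LeftOf 4, LeftOf 6, LeftOf 5, RightOf 3]"], simp, code_simp)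

lemma counit_delta3_left: "sem ((eps \<boxtimes> eps \<boxtimes> eps \<boxtimes> wF \<boxtimes> wF \<boxtimes> wF) \<odot> delta3 Reg Reg Reg) = sem (wF \<boxtimes> wF \<boxtimes> wF)"
  by (rule diagrammatic[where hyps = "[]" and ss = "
    [Fwd 5 2 (Ax TauCounit), LeftOf 3, Fwd 4 3 (Ax TauCounit), RightOf 3,
     Fwd 4 1 (Ax TauCounit), LeftOf 0, LeftOf 1, Fwd 2 4 (Ax CounitL), LeftOf 0,
     Fwd 1 2 (Ax CounitL), Fwd 0 0 (Ax CounitL)]"], simp, code_simp)

lemma associativity_regular:
  "sem ((eps \<boxtimes> eps \<boxtimes> eps \<boxtimes> wB) \<odot> (wF \<boxtimes> wF \<boxtimes> wF \<boxtimes> cocycle_right) \<odot> delta3 Reg Reg Reg) = sem cocycle_right"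
  "sem ((eps \<boxtimes> eps \<boxtimes> eps \<boxtimes> wB) \<odot> (wF \<boxtimes> wF \<boxtimes> wF \<boxtimes> ((Cell Omega \<boxtimes> cocycle_left) \<odot> delta3 Reg Reg Reg)) \<odot> delta3 Reg Reg Reg)
   = sem ((Cell Omega \<boxtimes> cocycle_left) \<odot> delta3 Reg Reg Reg)"
  by (rule diagrammatic[where hyps = "[]" and ss = "
    [RightOf 5, RightOf 6, RightOf 7, RightOf 8, RightOf 9, LeftOf 12, LeftOf 11,
     Fwd 10 2 (Ax TauCounit), LeftOf 3, RightOf 4, LeftOf 9, LeftOf 8, LeftOf 7, LeftOf 6,
     Fwd 5 3 (Ax TauCounit), LeftOf 0, LeftOf 1, LeftOf 2, LeftOf 4, Fwd 3 4 (Ax CounitL),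
     RightOf 2, RightOf 3, RightOf 4, RightOf 5, RightOf 6, LeftOf 9, LeftOf 8,
     Fwd 7 1 (Ax TauCounit), LeftOf 0, RightOf 1, LeftOf 6, LeftOf 5, LeftOf 4, LeftOf 3,
     Fwd 2 2 (Ax CounitL), RightOf 0, RightOf 1, RightOf 2, RightOf 3, RightOf 4, LeftOf 7,
     LeftOf 6, Fwd 5 0 (Ax CounitL)]"], simp, code_simp)
    (rule diagrammatic[where hyps = "[]" and ss = "
    [RightOf 5, RightOf 6, RightOf 8, RightOf 11, RightOf 16, LeftOf 22, RightOf 7, RightOf 10,
     RightOf 15, LeftOf 21, RightOf 9, RightOf 14, LeftOf 20, RightOf 8, RightOf 13, LeftOf 19,
     RightOf 12, LeftOf 18, RightOf 11, LeftOf 17, RightOf 10, LeftOf 16, RightOf 9, LeftOf 15,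
     LeftOf 14, LeftOf 13, LeftOf 12, LeftOf 11, Fwd 10 2 (Ax TauCounit), LeftOf 3, RightOf 4,
     RightOf 8, LeftOf 9, RightOf 7, LeftOf 8, RightOf 6, LeftOf 7, RightOf 5,
     Fwd 6 3 (Ax TauCounit), LeftOf 0, LeftOf 1, LeftOf 2, LeftOf 5, LeftOf 4,
     Fwd 3 4 (Ax CounitL), RightOf 2, RightOf 3, RightOf 4, RightOf 5, RightOf 6, LeftOf 19,
     LeftOf 18, LeftOf 17, LeftOf 16, LeftOf 15, LeftOf 14, LeftOf 13, LeftOf 12, LeftOf 11,
     LeftOf 10, LeftOf 9, LeftOf 8, Fwd 7 1 (Ax TauCounit), LeftOf 0, RightOf 1, RightOf 2,
     LeftOf 6, LeftOf 5, LeftOf 4, Fwd 3 2 (Ax CounitL), RightOf 0, RightOf 1, RightOf 2,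
     RightOf 3, RightOf 4, LeftOf 17, LeftOf 16, LeftOf 15, LeftOf 14, LeftOf 13, LeftOf 12,
     LeftOf 11, LeftOf 10, LeftOf 9, LeftOf 8, LeftOf 7, LeftOf 6, Fwd 5 0 (Ax CounitL),
     LeftOf 1, LeftOf 4, LeftOf 3, LeftOf 2, LeftOf 3, LeftOf 5, LeftOf 4, LeftOf 6, LeftOf 5,
     LeftOf 6, LeftOf 7, LeftOf 8, LeftOf 9, LeftOf 10]"], simp, code_simp)

lemma delta3_coassoc:
  "sem ((delta3 Reg Reg Reg \<boxtimes> wF \<boxtimes> wF \<boxtimes> wF) \<odot> delta3 Reg Reg Reg)
   = sem ((wF \<boxtimes> wF \<boxtimes> wF \<boxtimes> delta3 Reg Reg Reg) \<odot> delta3 Reg Reg Reg)"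
  by (rule diagrammatic[where hyps = "[]" and ss = "
    [Fwd 5 2 (Ax (Colin Reg)), LeftOf 3, Fwd 4 3 (Ax (Colin Reg)), LeftOf 0, LeftOf 1,
     LeftOf 2, Fwd 3 4 (Ax (Coassoc Reg)), RightOf 2, RightOf 3, RightOf 4, RightOf 5,
     LeftOf 8, LeftOf 7, Fwd 6 1 (Ax (Colin Reg)), LeftOf 0, RightOf 1, RightOf 2, LeftOf 5,
     LeftOf 4, Fwd 3 2 (Ax (Coassoc Reg)), RightOf 0, RightOf 1, RightOf 2, RightOf 3,
     RightOf 4, RightOf 5, LeftOf 10, LeftOf 9, LeftOf 8, LeftOf 7, Fwd 6 0 (Ax (Coassoc Reg)),
     LeftOf 1, LeftOf 5, LeftOf 4, LeftOf 3, LeftOf 2, LeftOf 6, LeftOf 5, LeftOf 11,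
     Bwd 9 3 (Ax (YB Reg)), RightOf 8, LeftOf 7, LeftOf 8, LeftOf 12, LeftOf 11, LeftOf 10,
     LeftOf 9, LeftOf 10, LeftOf 13, LeftOf 12, LeftOf 11, RightOf 5, RightOf 6,
     Bwd 7 1 (Ax (TFComul Reg)), LeftOf 6, LeftOf 5, LeftOf 4, LeftOf 3,
     Bwd 5 3 (Ax (TFComul Reg)), LeftOf 4, RightOf 3, Bwd 7 2 (Ax (TFComul Reg)), LeftOf 6,
     LeftOf 5]"], simp, code_simp)

text \<open>Convolve with the inverse of \<omega> from the left: coassociativity of the comonad FFF
  brings it together with \<omega>, and the remaining counits vanish. The converse is the same
  argument with the two exchanged.\<close>

lemma twisted_from_associativity:
  assumes "sem ((Cell Omega \<boxtimes> cocycle_left) \<odot> delta3 Reg Reg Reg) = sem cocycle_right"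
  shows "sem twisted_cocycle_right = sem cocycle_left"
  by (rule diagrammatic[where hyps = "[((Cell Omega \<boxtimes> cocycle_left) \<odot> delta3 Reg Reg Reg, cocycle_right),
        ((delta3 Reg Reg Reg \<boxtimes> wF \<boxtimes> wF \<boxtimes> wF) \<odot> delta3 Reg Reg Reg,
          (wF \<boxtimes> wF \<boxtimes> wF \<boxtimes> delta3 Reg Reg Reg) \<odot> delta3 Reg Reg Reg),
        ((eps \<boxtimes> eps \<boxtimes> eps \<boxtimes> wF \<boxtimes> wF \<boxtimes> wF) \<odot> delta3 Reg Reg Reg, wF \<boxtimes> wF \<boxtimes> wF)]"
      and ss = "
    [Bwd 7 0 (Hyp 0), RightOf 6, RightOf 7, RightOf 8, RightOf 9, RightOf 10, RightOf 11,
     Bwd 0 0 (Hyp 1), RightOf 12, RightOf 13, RightOf 14, RightOf 15, RightOf 16, RightOf 17,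
     RightOf 18, RightOf 19, RightOf 20, RightOf 21, RightOf 22, RightOf 11, RightOf 12,
     RightOf 13, RightOf 14, RightOf 15, RightOf 16, RightOf 17, RightOf 18, RightOf 19,
     RightOf 20, RightOf 10, RightOf 11, RightOf 12, RightOf 13, RightOf 14, RightOf 15,
     RightOf 16, RightOf 17, RightOf 18, RightOf 19, RightOf 9, RightOf 10, RightOf 11,
     RightOf 12, RightOf 13, RightOf 14, RightOf 15, RightOf 16, RightOf 17, RightOf 18,
     RightOf 8, RightOf 9, RightOf 10, RightOf 11, RightOf 12, RightOf 13, RightOf 14,
     RightOf 15, RightOf 16, RightOf 17, RightOf 7, RightOf 8, RightOf 9, RightOf 10,
     RightOf 11, RightOf 12, RightOf 13, RightOf 14, RightOf 15, RightOf 16, RightOf 6,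
     RightOf 7, RightOf 8, RightOf 9, RightOf 10, RightOf 11, RightOf 12, RightOf 13,
     RightOf 14, RightOf 15, Fwd 16 0 (Ax OmInvOm), LeftOf 15, LeftOf 16, LeftOf 17, LeftOf 14,
     LeftOf 15, LeftOf 16, LeftOf 13, LeftOf 14, LeftOf 15, LeftOf 12, LeftOf 13, LeftOf 14,
     LeftOf 11, LeftOf 12, LeftOf 13, LeftOf 10, LeftOf 11, LeftOf 12, LeftOf 9, LeftOf 10,
     LeftOf 11, LeftOf 8, LeftOf 9, LeftOf 10, LeftOf 7, LeftOf 8, LeftOf 9, LeftOf 6,
     LeftOf 7, LeftOf 8, Fwd 0 0 (Hyp 2)]"], use assms delta3_coassoc counit_delta3_left in simp, code_simp)

lemma associativity_from_twisted:
  assumes "sem twisted_cocycle_right = sem cocycle_left"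
  shows "sem ((Cell Omega \<boxtimes> cocycle_left) \<odot> delta3 Reg Reg Reg) = sem cocycle_right"
  by (rule diagrammatic[where hyps = "[(twisted_cocycle_right, cocycle_left),
        ((delta3 Reg Reg Reg \<boxtimes> wF \<boxtimes> wF \<boxtimes> wF) \<odot> delta3 Reg Reg Reg,
          (wF \<boxtimes> wF \<boxtimes> wF \<boxtimes> delta3 Reg Reg Reg) \<odot> delta3 Reg Reg Reg),
        ((eps \<boxtimes> eps \<boxtimes> eps \<boxtimes> wF \<boxtimes> wF \<boxtimes> wF) \<odot> delta3 Reg Reg Reg, wF \<boxtimes> wF \<boxtimes> wF)]"
      and ss = "
    [LeftOf 15, LeftOf 14, LeftOf 13, LeftOf 12, LeftOf 11, LeftOf 10, LeftOf 9, LeftOf 8,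
     LeftOf 7, LeftOf 6, Bwd 7 0 (Hyp 0), RightOf 6, RightOf 7, RightOf 8, RightOf 9,
     RightOf 10, RightOf 11, Bwd 0 0 (Hyp 1), RightOf 12, Fwd 6 0 (Ax OmOmInv), Fwd 0 0 (Hyp 2)]"], use assms delta3_coassoc counit_delta3_left in simp, code_simp)

end


section \<open>Diagrams in left Tambara comodules\<close>

datatype lgen = LMul | LCounit | LOmega | LOmegaInv | LCoact ob | LTau ob | LMor nat

primrec larity :: "lgen \<Rightarrow> ob list \<times> ob list" where
  "larity LMul = ([Reg, Reg], [Reg])"
| "larity LCounit = ([Reg], [])"
| "larity LOmega = ([Reg, Reg, Reg], [])"
| "larity LOmegaInv = ([Reg, Reg, Reg], [])"
| "larity (LCoact x) = ([x], [Reg, x])"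
| "larity (LTau x) = ([x, Reg], [Reg, x])"
| "larity (LMor n) = ([Ob n], [Im n])"

type_synonym ldiagram = "(ob, lgen) diag"

abbreviation vF :: ldiagram where "vF \<equiv> Wires [Reg]"
abbreviation vX :: "ob \<Rightarrow> ldiagram" where "vX x \<equiv> Wires [x]"
abbreviation lco :: "ob \<Rightarrow> ldiagram" where "lco x \<equiv> Cell (LCoact x)"
abbreviation lt :: "ob \<Rightarrow> ldiagram" where "lt x \<equiv> Cell (LTau x)"
abbreviation leps :: ldiagram where "leps \<equiv> Cell LCounit"

definition lambda3 :: "ob \<Rightarrow> ob \<Rightarrow> ob \<Rightarrow> ldiagram" where
  "lambda3 x y z = (vF \<boxtimes> vF \<boxtimes> lt x \<boxtimes> vX y \<boxtimes> vX z) \<odot> (vF \<boxtimes> lt x \<boxtimes> lt y \<boxtimes> vX z)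
     \<odot> (lco x \<boxtimes> lco y \<boxtimes> lco z)"

definition lambda4 :: "ob \<Rightarrow> ob \<Rightarrow> ob \<Rightarrow> ob \<Rightarrow> ldiagram" where
  "lambda4 x y z w = (vF \<boxtimes> vF \<boxtimes> vF \<boxtimes> lt x \<boxtimes> vX y \<boxtimes> vX z \<boxtimes> vX w)
     \<odot> (vF \<boxtimes> vF \<boxtimes> lt x \<boxtimes> lt y \<boxtimes> vX z \<boxtimes> vX w) \<odot> (vF \<boxtimes> lt x \<boxtimes> lt y \<boxtimes> lt z \<boxtimes> vX w)
     \<odot> (lco x \<boxtimes> lco y \<boxtimes> lco z \<boxtimes> lco w)"

text \<open>Bracketed like the nested convolution in the axiom; convolution into the identity 1-cell
  is juxtaposition after the comultiplication of FFFF, which is \<open>lambda4\<close> at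
  \<open>Reg\<close>.\<close>

definition pentagon_left :: ldiagram where
  "pentagon_left = ((((leps \<boxtimes> Cell LOmega) \<boxtimes> (Cell LOmega \<odot> (vF \<boxtimes> Cell LMul \<boxtimes> vF))) \<odot> lambda4 Reg Reg Reg Reg)
     \<boxtimes> (Cell LOmega \<boxtimes> leps)) \<odot> lambda4 Reg Reg Reg Reg"

definition pentagon_right :: ldiagram where
  "pentagon_right = ((Cell LOmega \<odot> (vF \<boxtimes> vF \<boxtimes> Cell LMul)) \<boxtimes> (Cell LOmega \<odot> (Cell LMul \<boxtimes> vF \<boxtimes> vF)))
     \<odot> lambda4 Reg Reg Reg Reg"

datatype llaw_name = LCoassoc ob | LCounitL ob | LColin ob | LTMul ob | LTComul ob
  | LTCounit ob | LYB ob | LTauMul | LMulComul | LMulCounit | LOmOmInv | LOmInvOm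
  | LPentagon | LMorCo nat | LMorTau nat

primrec llaw :: "llaw_name \<Rightarrow> (ob, lgen) equation" where
  "llaw (LCoassoc x) = ((vF \<boxtimes> lco x) \<odot> lco x, (lco Reg \<boxtimes> vX x) \<odot> lco x)"
| "llaw (LCounitL x) = ((leps \<boxtimes> vX x) \<odot> lco x, vX x)"
| "llaw (LColin x) = ((vF \<boxtimes> lco x) \<odot> lt x, (lt Reg \<boxtimes> vX x) \<odot> (vF \<boxtimes> lt x) \<odot> (lco x \<boxtimes> vF))"
| "llaw (LTMul x) = (lt x \<odot> (vX x \<boxtimes> Cell LMul), (Cell LMul \<boxtimes> vX x) \<odot> (vF \<boxtimes> lt x) \<odot> (lt x \<boxtimes> vF))"
| "llaw (LTComul x) = ((lco Reg \<boxtimes> vX x) \<odot> lt x, (vF \<boxtimes> lt x) \<odot> (lt x \<boxtimes> vF) \<odot> (vX x \<boxtimes> lco Reg))"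
| "llaw (LTCounit x) = ((leps \<boxtimes> vX x) \<odot> lt x, vX x \<boxtimes> leps)"
| "llaw (LYB x) = ((lt Reg \<boxtimes> vX x) \<odot> (vF \<boxtimes> lt x) \<odot> (lt x \<boxtimes> vF),
     (vF \<boxtimes> lt x) \<odot> (lt x \<boxtimes> vF) \<odot> (vX x \<boxtimes> lt Reg))"
| "llaw LTauMul = (lt Reg \<odot> (Cell LMul \<boxtimes> vF), (vF \<boxtimes> Cell LMul) \<odot> (lt Reg \<boxtimes> vF) \<odot> (vF \<boxtimes> lt Reg))"
| "llaw LMulComul = (lco Reg \<odot> Cell LMul,
     (Cell LMul \<boxtimes> Cell LMul) \<odot> (vF \<boxtimes> lt Reg \<boxtimes> vF) \<odot> (lco Reg \<boxtimes> lco Reg))"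
| "llaw LMulCounit = (leps \<odot> Cell LMul, leps \<boxtimes> leps)"
| "llaw LOmOmInv = ((Cell LOmega \<boxtimes> Cell LOmegaInv) \<odot> lambda3 Reg Reg Reg, leps \<boxtimes> leps \<boxtimes> leps)"
| "llaw LOmInvOm = ((Cell LOmegaInv \<boxtimes> Cell LOmega) \<odot> lambda3 Reg Reg Reg, leps \<boxtimes> leps \<boxtimes> leps)"
| "llaw LPentagon = (pentagon_left, pentagon_right)"
| "llaw (LMorCo n) = (lco (Im n) \<odot> Cell (LMor n), (vF \<boxtimes> Cell (LMor n)) \<odot> lco (Ob n))"
| "llaw (LMorTau n) = (lt (Im n) \<odot> (Cell (LMor n) \<boxtimes> vF), (vF \<boxtimes> Cell (LMor n)) \<odot> lt (Ob n))"

definition tensor_lt :: "ob \<Rightarrow> ob \<Rightarrow> ldiagram" where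
  "tensor_lt x y = (lt x \<boxtimes> vX y) \<odot> (vX x \<boxtimes> lt y)"

definition tensor_lco :: "ob \<Rightarrow> ob \<Rightarrow> ldiagram" where
  "tensor_lco x y = (Cell LMul \<boxtimes> vX x \<boxtimes> vX y) \<odot> (vF \<boxtimes> lt x \<boxtimes> vX y) \<odot> (lco x \<boxtimes> lco y)"

definition omega_op :: "lgen \<Rightarrow> ob \<Rightarrow> ob \<Rightarrow> ob \<Rightarrow> ldiagram" where
  "omega_op g x y z = (Cell g \<boxtimes> vX x \<boxtimes> vX y \<boxtimes> vX z) \<odot> lambda3 x y z"

text \<open>Turns \<open>s\<close> from FFFF to Id into an endomorphism of XYZW. With left coactions
  the outer legs go to the operator applied first, so convolution becomes composition in the
  opposite order.\<close>

definition acting :: "ldiagram \<Rightarrow> ldiagram" where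
  "acting s = (s \<boxtimes> vX (Ob 0) \<boxtimes> vX (Ob 1) \<boxtimes> vX (Ob 2) \<boxtimes> vX (Ob 3)) \<odot> lambda4 (Ob 0) (Ob 1) (Ob 2) (Ob 3)"

abbreviation "lX \<equiv> Ob 0"
abbreviation "lY \<equiv> Ob 1"
abbreviation "lZ \<equiv> Ob 2"
abbreviation "lW \<equiv> Ob 3"

text \<open>
  What the tensor product of left Tambara comodules needs to be shown to inherit: all conditions
  except the one on \<open>\<omega>\<close> and the unit law of \<open>tauL\<close>.
\<close>

context
  fixes K :: "('o, 'c, 'd) two_cat" (structure) and A :: 'o
begin

definition left_comodule :: "('c, 'd) coquasi_data \<Rightarrow> ('c, 'd) ltobj \<Rightarrow> bool" where
  "left_comodule F X \<longleftrightarrow> cell X \<in> endo K A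
    \<and> tauL X \<in> Hom (cell X \<star> cell F) (cell F \<star> cell X) \<and> lcoact X \<in> Hom (cell X) (cell F \<star> cell X)
    \<and> tauL X \<bullet> (\<langle>X\<rangle> \<otimes> \<mu>\<^bsub>F\<^esub>) = (\<mu>\<^bsub>F\<^esub> \<otimes> \<langle>X\<rangle>) \<bullet> (\<langle>F\<rangle> \<otimes> tauL X) \<bullet> (tauL X \<otimes> \<langle>F\<rangle>)
    \<and> (\<Delta>\<^bsub>F\<^esub> \<otimes> \<langle>X\<rangle>) \<bullet> tauL X = (\<langle>F\<rangle> \<otimes> tauL X) \<bullet> (tauL X \<otimes> \<langle>F\<rangle>) \<bullet> (\<langle>X\<rangle> \<otimes> \<Delta>\<^bsub>F\<^esub>)
    \<and> (\<epsilon>\<^bsub>F\<^esub> \<otimes> \<langle>X\<rangle>) \<bullet> tauL X = \<langle>X\<rangle> \<otimes> \<epsilon>\<^bsub>F\<^esub>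
    \<and> (\<tau>\<^bsub>F\<^esub> \<otimes> \<langle>X\<rangle>) \<bullet> (\<langle>F\<rangle> \<otimes> tauL X) \<bullet> (tauL X \<otimes> \<langle>F\<rangle>)
        = (\<langle>F\<rangle> \<otimes> tauL X) \<bullet> (tauL X \<otimes> \<langle>F\<rangle>) \<bullet> (\<langle>X\<rangle> \<otimes> \<tau>\<^bsub>F\<^esub>)
    \<and> (\<langle>F\<rangle> \<otimes> lcoact X) \<bullet> lcoact X = (\<Delta>\<^bsub>F\<^esub> \<otimes> \<langle>X\<rangle>) \<bullet> lcoact X
    \<and> (\<epsilon>\<^bsub>F\<^esub> \<otimes> \<langle>X\<rangle>) \<bullet> lcoact X = \<langle>X\<rangle>
    \<and> (\<langle>F\<rangle> \<otimes> lcoact X) \<bullet> tauL X = (\<tau>\<^bsub>F\<^esub> \<otimes> \<langle>X\<rangle>) \<bullet> (\<langle>F\<rangle> \<otimes> tauL X) \<bullet> (lcoact X \<otimes> \<langle>F\<rangle>)"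

lemma left_comodule_Tambara: "left_Tambara_comodule K A F X \<Longrightarrow> left_comodule F X"
  by (simp add: left_Tambara_comodule_def left_comodule_def right_monadic_def left_comonadic_def)

end

locale left_comodules = two_category K for K :: "('o, 'c, 'd) two_cat" (structure) +
  fixes A :: 'o and F :: "('c, 'd) coquasi_data" and \<omega>inv :: 'd
    and E E' :: "nat \<Rightarrow> ('c, 'd) ltobj" and m :: "nat \<Rightarrow> 'd"
  assumes base: "A \<in> zero_cells K"
    and coquasi: "coquasi_bimonad K A F"
    and regular: "left_comodule K A F (left_regular F)"
    and omega_inv: "omega_inverse K A F \<omega>inv"
    and E: "left_comodule K A F (E n)" and E': "left_comodule K A F (E' n)"
    and m: "m n \<in> mors (left_Tambara K A F) (E n) (E' n)"
begin

primrec obj :: "ob \<Rightarrow> ('c, 'd) ltobj" where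
  "obj Reg = left_regular F" | "obj (Ob n) = E n" | "obj (Im n) = E' n"

primrec two_cell :: "lgen \<Rightarrow> 'd" where
  "two_cell LMul = \<mu>\<^bsub>F\<^esub>"
| "two_cell LCounit = \<epsilon>\<^bsub>F\<^esub>"
| "two_cell LOmega = \<omega>\<^bsub>F\<^esub>"
| "two_cell LOmegaInv = \<omega>inv"
| "two_cell (LCoact x) = lcoact (obj x)"
| "two_cell (LTau x) = tauL (obj x)"
| "two_cell (LMor n) = m n"

lemma left_regular_simps [simp]: "cell (left_regular F) = cell F" "tauL (left_regular F) = \<tau>\<^bsub>F\<^esub>"
  "lcoact (left_regular F) = \<Delta>\<^bsub>F\<^esub>"
  by (simp_all add: left_regular_def)

lemma obj_comodule: "left_comodule K A F (obj x)"
  using E E' regular by (cases x) auto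

lemmas object_facts = obj_comodule[unfolded left_comodule_def]

lemmas coquasi_facts = coquasi[unfolded coquasi_bimonad_def comonad_def left_monadic_def
  right_monadic_def left_comonadic_def right_comonadic_def]

lemma m_facts: "m n \<in> Hom (cell (E n)) (cell (E' n))" "(\<langle>F\<rangle> \<otimes> m n) \<bullet> lcoact (E n) = lcoact (E' n) \<bullet> m n"
  "(\<langle>F\<rangle> \<otimes> m n) \<bullet> tauL (E n) = tauL (E' n) \<bullet> (m n \<otimes> \<langle>F\<rangle>)"
  using m[of n] by (simp_all add: left_Tambara_def)

sublocale string_diagrams K A "\<lambda>x. cell (obj x)" larity two_cell
proof
  show "cell (obj x) \<in> endo K A" for x
    using object_facts by auto
  show "two_cell g \<in> Hom (word K A (\<lambda>x. cell (obj x)) (fst (larity g))) (word K A (\<lambda>x. cell (obj x)) (snd (larity g)))" for g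
    using object_facts coquasi_facts omega_inv m_facts
    by (cases g) (auto simp: omega_inverse_def)
qed (rule base)

lemma one_after_scalar:
  "\<lbrakk>well_typed larity s; target larity s = []\<rbrakk> \<Longrightarrow> id2 K (id1 K A) \<bullet> sem s = sem s"
  using after_one(1)[OF sem_cells, of s] by simp

lemma omega_conv:
  "(\<omega>\<^bsub>F\<^esub> \<otimes> \<omega>inv) \<bullet> Delta3 K F = \<epsilon>\<^bsub>F\<^esub> \<otimes> \<epsilon>\<^bsub>F\<^esub> \<otimes> \<epsilon>\<^bsub>F\<^esub>"
  "(\<omega>inv \<otimes> \<omega>\<^bsub>F\<^esub>) \<bullet> Delta3 K F = \<epsilon>\<^bsub>F\<^esub> \<otimes> \<epsilon>\<^bsub>F\<^esub> \<otimes> \<epsilon>\<^bsub>F\<^esub>"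
  using omega_inv one_after_scalar[of "(Cell LOmega \<boxtimes> Cell LOmegaInv) \<odot> lambda3 Reg Reg Reg"]
    one_after_scalar[of "(Cell LOmegaInv \<boxtimes> Cell LOmega) \<odot> lambda3 Reg Reg Reg"]
    one_after_scalar[of "leps \<boxtimes> leps \<boxtimes> leps"]
  by (simp_all add: omega_inverse_def is_conv_inverse_def conv_def lambda3_def Delta3_def)

lemma pentagon: "sem pentagon_left = sem pentagon_right"
  using coquasi one_after_scalar[of pentagon_left] one_after_scalar[of pentagon_right]
    one_after_scalar[of "((leps \<boxtimes> Cell LOmega) \<boxtimes> (Cell LOmega \<odot> (vF \<boxtimes> Cell LMul \<boxtimes> vF))) \<odot> lambda4 Reg Reg Reg Reg"]
  by (simp add: coquasi_bimonad_def conv_def Let_def Delta4_def lambda4_def pentagon_left_def pentagon_right_def)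

lemma llaw_sound: "sem (fst (llaw r)) = sem (snd (llaw r))"
proof (cases r)
  case (LCoassoc x)
  then show ?thesis using object_facts[of x] by simp
next
  case (LCounitL x)
  then show ?thesis using object_facts[of x] by simp
next
  case (LColin x)
  then show ?thesis using object_facts[of x] by simp
next
  case (LTMul x)
  then show ?thesis using object_facts[of x] by simp
next
  case (LTComul x)
  then show ?thesis using object_facts[of x] by simp
next
  case (LTCounit x)
  then show ?thesis using object_facts[of x] by simp
next
  case (LYB x)
  then show ?thesis using object_facts[of x] by simp
next
  case LOmOmInv
  then show ?thesis using omega_conv by (simp add: lambda3_def Delta3_def)
next
  case LOmInvOm
  then show ?thesis using omega_conv by (simp add: lambda3_def Delta3_def)
next
  case LPentagon
  then show ?thesis using pentagon by simp
next
  case (LMorCo n)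
  then show ?thesis using m_facts by simp
next
  case (LMorTau n)
  then show ?thesis using m_facts by simp
qed (use coquasi_facts in simp_all)

lemmas ldiagrammatic = sem_eqI[where ax = llaw, OF llaw_sound]

section \<open>Coactions of FFF and FFFF, and the operators given by \<omega>\<close>

lemma lambda3_coaction:
  "sem ((vF \<boxtimes> vF \<boxtimes> vF \<boxtimes> lambda3 lX lY lZ) \<odot> lambda3 lX lY lZ)
   = sem ((lambda3 Reg Reg Reg \<boxtimes> vX lX \<boxtimes> vX lY \<boxtimes> vX lZ) \<odot> lambda3 lX lY lZ)"
  by (rule ldiagrammatic[where hyps = "[]" and ss = "
    [RightOf 5, RightOf 6, Fwd 7 2 (Ax (LColin (Ob 0))), RightOf 4, RightOf 5,
     Fwd 6 1 (Ax (LColin (Ob 0))), RightOf 3, Fwd 4 3 (Ax (LColin (Ob 1))), RightOf 2,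
     RightOf 3, RightOf 4, RightOf 5, Fwd 6 0 (Ax (LCoassoc (Ob 0))), RightOf 1,
     Fwd 2 1 (Ax (LCoassoc (Ob 1))), Fwd 0 2 (Ax (LCoassoc (Ob 2))), LeftOf 1, LeftOf 5,
     LeftOf 4, LeftOf 3, LeftOf 2, LeftOf 3, LeftOf 6, LeftOf 5, LeftOf 7, LeftOf 6, RightOf 9,
     LeftOf 12, RightOf 11, RightOf 10, Bwd 8 3 (Ax (LYB (Ob 0))), LeftOf 7, RightOf 12,
     RightOf 11, RightOf 10, RightOf 9, RightOf 13, RightOf 12, RightOf 11, RightOf 5,
     RightOf 6, RightOf 7, RightOf 8, RightOf 9, LeftOf 4, RightOf 10, LeftOf 5,
     Bwd 6 4 (Ax (LTComul (Ob 1))), RightOf 5, RightOf 4, RightOf 3,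
     Bwd 7 3 (Ax (LTComul (Ob 0))), Bwd 4 1 (Ax (LTComul (Ob 0))), RightOf 5, RightOf 6]"], simp, code_simp)

lemma lambda3_counit: "sem ((leps \<boxtimes> leps \<boxtimes> leps \<boxtimes> vX lX \<boxtimes> vX lY \<boxtimes> vX lZ) \<odot> lambda3 lX lY lZ)
    = sem (vX lX \<boxtimes> vX lY \<boxtimes> vX lZ)"
  by (rule ldiagrammatic[where hyps = "[]" and ss = "
    [Fwd 5 2 (Ax (LTCounit (Ob 0))), RightOf 4, Fwd 5 1 (Ax (LTCounit (Ob 0))),
     Fwd 3 3 (Ax (LTCounit (Ob 1))), RightOf 2, RightOf 3, Fwd 4 0 (Ax (LCounitL (Ob 0))),
     RightOf 1, Fwd 2 1 (Ax (LCounitL (Ob 1))), Fwd 0 2 (Ax (LCounitL (Ob 2)))]"], simp, code_simp)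

lemma omega_op_inverse:
  "sem (omega_op LOmegaInv lX lY lZ \<odot> omega_op LOmega lX lY lZ) = sem (vX lX \<boxtimes> vX lY \<boxtimes> vX lZ)"
  "sem (omega_op LOmega lX lY lZ \<odot> omega_op LOmegaInv lX lY lZ) = sem (vX lX \<boxtimes> vX lY \<boxtimes> vX lZ)"
  by (rule ldiagrammatic[where hyps =
      "[((vF \<boxtimes> vF \<boxtimes> vF \<boxtimes> lambda3 lX lY lZ) \<odot> lambda3 lX lY lZ,
         (lambda3 Reg Reg Reg \<boxtimes> vX lX \<boxtimes> vX lY \<boxtimes> vX lZ) \<odot> lambda3 lX lY lZ),
        ((leps \<boxtimes> leps \<boxtimes> leps \<boxtimes> vX lX \<boxtimes> vX lY \<boxtimes> vX lZ) \<odot> lambda3 lX lY lZ, vX lX \<boxtimes> vX lY \<boxtimes> vX lZ)]"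
      and ss = "
    [RightOf 6, RightOf 7, RightOf 8, RightOf 9, RightOf 10, RightOf 11, Fwd 0 0 (Hyp 0),
     RightOf 12, Fwd 6 0 (Ax LOmOmInv), Fwd 0 0 (Hyp 1)]"], use lambda3_coaction lambda3_counit in simp, code_simp)
    (rule ldiagrammatic[where hyps =
      "[((vF \<boxtimes> vF \<boxtimes> vF \<boxtimes> lambda3 lX lY lZ) \<odot> lambda3 lX lY lZ,
         (lambda3 Reg Reg Reg \<boxtimes> vX lX \<boxtimes> vX lY \<boxtimes> vX lZ) \<odot> lambda3 lX lY lZ),
        ((leps \<boxtimes> leps \<boxtimes> leps \<boxtimes> vX lX \<boxtimes> vX lY \<boxtimes> vX lZ) \<odot> lambda3 lX lY lZ, vX lX \<boxtimes> vX lY \<boxtimes> vX lZ)]"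
      and ss = "
    [RightOf 6, RightOf 7, RightOf 8, RightOf 9, RightOf 10, RightOf 11, Fwd 0 0 (Hyp 0),
     RightOf 12, Fwd 6 0 (Ax LOmInvOm), Fwd 0 0 (Hyp 1)]"], use lambda3_coaction lambda3_counit in simp, code_simp)

lemma omega_op_natural:
  "sem ((Cell (LMor 0) \<boxtimes> Cell (LMor 1) \<boxtimes> Cell (LMor 2)) \<odot> omega_op LOmegaInv lX lY lZ)
   = sem (omega_op LOmegaInv (Im 0) (Im 1) (Im 2) \<odot> (Cell (LMor 0) \<boxtimes> Cell (LMor 1) \<boxtimes> Cell (LMor 2)))"
  by (rule ldiagrammatic[where hyps = "[]" and ss = "
    [RightOf 6, RightOf 5, RightOf 4, RightOf 3, RightOf 2, RightOf 1, RightOf 7, RightOf 6,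
     RightOf 5, RightOf 8, Bwd 4 3 (Ax (LMorTau 1)), RightOf 3, Bwd 7 2 (Ax (LMorTau 0)),
     Bwd 6 1 (Ax (LMorTau 0)), LeftOf 5, Bwd 0 2 (Ax (LMorCo 2)), Bwd 2 1 (Ax (LMorCo 1)),
     LeftOf 1, Bwd 4 0 (Ax (LMorCo 0)), LeftOf 3, LeftOf 2]"], simp, code_simp)

lemma lambda4_coaction:
  "sem ((vF \<boxtimes> vF \<boxtimes> vF \<boxtimes> vF \<boxtimes> lambda4 lX lY lZ lW) \<odot> lambda4 lX lY lZ lW)
   = sem ((lambda4 Reg Reg Reg Reg \<boxtimes> vX lX \<boxtimes> vX lY \<boxtimes> vX lZ \<boxtimes> vX lW) \<odot> lambda4 lX lY lZ lW)"
  by (rule ldiagrammatic[where hyps = "[]" and ss = "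
    [RightOf 9, RightOf 10, RightOf 11, Fwd 12 3 (Ax (LColin (Ob 0))), RightOf 8, RightOf 9,
     RightOf 10, Fwd 11 2 (Ax (LColin (Ob 0))), RightOf 6, RightOf 7, RightOf 8, RightOf 9,
     Fwd 10 1 (Ax (LColin (Ob 0))), RightOf 6, RightOf 7, Fwd 8 4 (Ax (LColin (Ob 1))),
     RightOf 5, RightOf 6, Fwd 7 3 (Ax (LColin (Ob 1))), RightOf 4,
     Fwd 5 5 (Ax (LColin (Ob 2))), RightOf 3, RightOf 4, RightOf 5, RightOf 6, RightOf 7,
     RightOf 8, RightOf 9, RightOf 10, RightOf 11, Fwd 12 0 (Ax (LCoassoc (Ob 0))), RightOf 2,
     RightOf 3, RightOf 4, RightOf 5, Fwd 6 1 (Ax (LCoassoc (Ob 1))), RightOf 1,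
     Fwd 2 2 (Ax (LCoassoc (Ob 2))), Fwd 0 3 (Ax (LCoassoc (Ob 3))), LeftOf 1, LeftOf 5,
     LeftOf 4, LeftOf 3, LeftOf 2, LeftOf 11, LeftOf 10, LeftOf 9, LeftOf 8, LeftOf 7,
     LeftOf 6, LeftOf 5, LeftOf 4, LeftOf 3, LeftOf 7, LeftOf 6, LeftOf 5, LeftOf 4, LeftOf 5,
     LeftOf 12, LeftOf 11, LeftOf 10, LeftOf 9, LeftOf 8, LeftOf 7, LeftOf 13, LeftOf 12,
     LeftOf 11, LeftOf 10, LeftOf 9, LeftOf 8, RightOf 15, LeftOf 14, LeftOf 13, RightOf 17,
     RightOf 16, LeftOf 21, LeftOf 20, RightOf 19, RightOf 18, RightOf 17,
     Bwd 15 4 (Ax (LYB (Ob 0))), LeftOf 14, Bwd 12 3 (Ax (LYB (Ob 0))), LeftOf 11, LeftOf 10,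
     LeftOf 9, LeftOf 11, LeftOf 10, RightOf 14, RightOf 13, LeftOf 21, RightOf 20, RightOf 19,
     RightOf 18, RightOf 17, RightOf 16, RightOf 15, RightOf 14, Bwd 12 6 (Ax (LYB (Ob 1))),
     LeftOf 11, LeftOf 14, LeftOf 13, LeftOf 12, RightOf 16, LeftOf 23, LeftOf 22, RightOf 21,
     RightOf 20, RightOf 19, RightOf 18, RightOf 17, Bwd 15 5 (Ax (LYB (Ob 0))), LeftOf 14,
     LeftOf 13, RightOf 22, RightOf 21, RightOf 20, RightOf 19, RightOf 18, RightOf 17,
     RightOf 16, RightOf 15, RightOf 23, RightOf 22, RightOf 21, RightOf 20, RightOf 19,
     RightOf 18, RightOf 17, RightOf 24, RightOf 23, RightOf 22, RightOf 21, RightOf 20,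
     RightOf 19, LeftOf 22, RightOf 7, RightOf 8, RightOf 9, RightOf 10, RightOf 11,
     RightOf 12, RightOf 13, LeftOf 6, RightOf 14, LeftOf 7, RightOf 15, LeftOf 8, RightOf 16,
     LeftOf 9, RightOf 17, LeftOf 10, LeftOf 5, RightOf 18, LeftOf 11, LeftOf 6,
     Bwd 12 7 (Ax (LTComul (Ob 2))), RightOf 11, RightOf 10, RightOf 9, RightOf 8, RightOf 7,
     RightOf 6, RightOf 5, RightOf 4, Bwd 13 6 (Ax (LTComul (Ob 1))), RightOf 12, RightOf 11,
     Bwd 8 4 (Ax (LTComul (Ob 1))), RightOf 7, RightOf 6, RightOf 5, RightOf 9, RightOf 8,
     RightOf 7, RightOf 6, Bwd 13 5 (Ax (LTComul (Ob 0))), Bwd 10 3 (Ax (LTComul (Ob 0))),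
     RightOf 11, RightOf 12, Bwd 7 1 (Ax (LTComul (Ob 0))), RightOf 8, RightOf 9, RightOf 10,
     RightOf 11, LeftOf 6]"], simp, code_simp)

text \<open>A cell on which the operator does not depend contributes a counit. The coaction of a
  tensor product contributes a multiplication, which \<open>LTMul\<close> carries past the cells on
  its left; when XY is the tensor product there are none.\<close>

lemma acting_factors:
  "sem (omega_op LOmega lX lY lZ \<boxtimes> vX lW) = sem (acting (Cell LOmega \<boxtimes> leps))"
  "sem ((Cell LOmega \<boxtimes> vX lX \<boxtimes> Wires [lY, lZ] \<boxtimes> vX lW) \<odot> (vF \<boxtimes> vF \<boxtimes> lt lX \<boxtimes> Wires [lY, lZ] \<boxtimes> vX lW)
     \<odot> (vF \<boxtimes> lt lX \<boxtimes> tensor_lt lY lZ \<boxtimes> vX lW) \<odot> (lco lX \<boxtimes> tensor_lco lY lZ \<boxtimes> lco lW))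
   = sem (acting (Cell LOmega \<odot> (vF \<boxtimes> Cell LMul \<boxtimes> vF)))"
  "sem ((Cell LOmega \<boxtimes> Wires [lX, lY] \<boxtimes> vX lZ \<boxtimes> vX lW) \<odot> (vF \<boxtimes> vF \<boxtimes> tensor_lt lX lY \<boxtimes> vX lZ \<boxtimes> vX lW)
     \<odot> (vF \<boxtimes> tensor_lt lX lY \<boxtimes> lt lZ \<boxtimes> vX lW) \<odot> (tensor_lco lX lY \<boxtimes> lco lZ \<boxtimes> lco lW))
   = sem (acting (Cell LOmega \<odot> (Cell LMul \<boxtimes> vF \<boxtimes> vF)))"
  "sem ((Cell LOmega \<boxtimes> vX lX \<boxtimes> vX lY \<boxtimes> Wires [lZ, lW]) \<odot> (vF \<boxtimes> vF \<boxtimes> lt lX \<boxtimes> vX lY \<boxtimes> Wires [lZ, lW])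
     \<odot> (vF \<boxtimes> lt lX \<boxtimes> lt lY \<boxtimes> Wires [lZ, lW]) \<odot> (lco lX \<boxtimes> lco lY \<boxtimes> tensor_lco lZ lW))
   = sem (acting (Cell LOmega \<odot> (vF \<boxtimes> vF \<boxtimes> Cell LMul)))"
  by (rule ldiagrammatic[where hyps = "[]" and ss = "
    [Bwd 6 6 (Ax (LCounitL (Ob 3))), RightOf 5, RightOf 4, RightOf 3, RightOf 2, RightOf 1,
     RightOf 0, Bwd 7 5 (Ax (LTCounit (Ob 2))), RightOf 6, RightOf 5, RightOf 4,
     Bwd 8 4 (Ax (LTCounit (Ob 1))), RightOf 7, Bwd 9 3 (Ax (LTCounit (Ob 0)))]"], simp, code_simp)
    (rule ldiagrammatic[where hyps = "[]" and ss = "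
    [LeftOf 4, RightOf 5, RightOf 6, Fwd 7 1 (Ax (LTMul (Ob 0))), LeftOf 3, RightOf 4,
     LeftOf 6, RightOf 9]"], simp, code_simp,
     rule ldiagrammatic[where hyps = "[]" and ss = "
    [RightOf 5, RightOf 4, RightOf 6, RightOf 5, RightOf 8, RightOf 7, RightOf 8, RightOf 9]"], simp, code_simp,
     rule ldiagrammatic[where hyps = "[]" and ss = "
    [LeftOf 3, LeftOf 4, Fwd 5 3 (Ax (LTMul (Ob 1))), LeftOf 7, Fwd 8 2 (Ax (LTMul (Ob 0))),
     LeftOf 2, LeftOf 3, LeftOf 6]"], simp, code_simp)

text \<open>The only factor in which \<omega> arises to the right of a cell. Letting it cross X is
  the condition on \<omega> in \<open>left_Tambara_comodule\<close>, and so in the pentagon X is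
  such a comodule while Y, Z, W are of the weaker kind.\<close>

lemma acting_last_factor:
  assumes "sem (vX lX \<boxtimes> Cell LOmega) = sem ((Cell LOmega \<boxtimes> vX lX) \<odot> (vF \<boxtimes> vF \<boxtimes> lt lX)
     \<odot> (vF \<boxtimes> lt lX \<boxtimes> vF) \<odot> (lt lX \<boxtimes> vF \<boxtimes> vF))"
  shows "sem (vX lX \<boxtimes> omega_op LOmega lY lZ lW) = sem (acting (leps \<boxtimes> Cell LOmega))"
  by (rule ldiagrammatic[where hyps = "[(vX lX \<boxtimes> Cell LOmega, (Cell LOmega \<boxtimes> vX lX) \<odot> (vF \<boxtimes> vF \<boxtimes> lt lX)
     \<odot> (vF \<boxtimes> lt lX \<boxtimes> vF) \<odot> (lt lX \<boxtimes> vF \<boxtimes> vF))]" and ss = "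
    [Fwd 6 0 (Hyp 0), Bwd 6 0 (Ax (LCounitL (Ob 0))), RightOf 7, RightOf 8, RightOf 9,
     LeftOf 5, RightOf 10, LeftOf 6, LeftOf 4, LeftOf 3]"], use assms in simp, code_simp)

text \<open>Coassociativity, used twice, turns the left composite into the operator of one
  convolution product; the pentagon axiom replaces this product, and coassociativity splits the
  result again.\<close>

lemma acting_pentagon:
  "sem (acting (Cell LOmega \<boxtimes> leps) \<odot> acting (Cell LOmega \<odot> (vF \<boxtimes> Cell LMul \<boxtimes> vF)) \<odot> acting (leps \<boxtimes> Cell LOmega))
   = sem (acting (Cell LOmega \<odot> (Cell LMul \<boxtimes> vF \<boxtimes> vF)) \<odot> acting (Cell LOmega \<odot> (vF \<boxtimes> vF \<boxtimes> Cell LMul)))"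
  by (rule ldiagrammatic[where hyps =
      "[((vF \<boxtimes> vF \<boxtimes> vF \<boxtimes> vF \<boxtimes> lambda4 lX lY lZ lW) \<odot> lambda4 lX lY lZ lW,
         (lambda4 Reg Reg Reg Reg \<boxtimes> vX lX \<boxtimes> vX lY \<boxtimes> vX lZ \<boxtimes> vX lW) \<odot> lambda4 lX lY lZ lW)]"
      and ss = "
    [RightOf 11, RightOf 12, RightOf 13, RightOf 14, RightOf 15, RightOf 16, RightOf 17,
     RightOf 18, RightOf 19, RightOf 20, RightOf 10, RightOf 11, RightOf 12, RightOf 13,
     RightOf 14, RightOf 15, RightOf 16, RightOf 17, RightOf 18, RightOf 19, Fwd 0 0 (Hyp 0),
     RightOf 23, RightOf 24, RightOf 25, RightOf 26, RightOf 27, RightOf 28, RightOf 29,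
     RightOf 30, RightOf 31, RightOf 32, RightOf 22, RightOf 23, RightOf 24, RightOf 25,
     RightOf 26, RightOf 27, RightOf 28, RightOf 29, RightOf 30, RightOf 31, RightOf 21,
     RightOf 22, RightOf 23, RightOf 24, RightOf 25, RightOf 26, RightOf 27, RightOf 28,
     RightOf 29, RightOf 30, RightOf 20, RightOf 21, RightOf 22, RightOf 23, RightOf 24,
     RightOf 25, RightOf 26, RightOf 27, RightOf 28, RightOf 29, RightOf 19, RightOf 20,
     RightOf 21, RightOf 22, RightOf 23, RightOf 24, RightOf 25, RightOf 26, RightOf 27,
     RightOf 28, RightOf 18, RightOf 19, RightOf 20, RightOf 21, RightOf 22, RightOf 23,
     RightOf 24, RightOf 25, RightOf 26, RightOf 27, RightOf 17, RightOf 18, RightOf 19,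
     RightOf 20, RightOf 21, RightOf 22, RightOf 23, RightOf 24, RightOf 25, RightOf 26,
     RightOf 16, RightOf 17, RightOf 18, RightOf 19, RightOf 20, RightOf 21, RightOf 22,
     RightOf 23, RightOf 24, RightOf 25, RightOf 15, RightOf 16, RightOf 17, RightOf 18,
     RightOf 19, RightOf 20, RightOf 21, RightOf 22, RightOf 23, RightOf 24, RightOf 14,
     RightOf 15, RightOf 16, RightOf 17, RightOf 18, RightOf 19, RightOf 20, RightOf 21,
     RightOf 22, RightOf 23, RightOf 13, RightOf 14, RightOf 15, RightOf 16, RightOf 17,
     RightOf 18, RightOf 19, RightOf 20, RightOf 21, RightOf 22, RightOf 12, RightOf 13,
     RightOf 14, RightOf 15, RightOf 16, RightOf 17, RightOf 18, RightOf 19, RightOf 20,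
     RightOf 21, RightOf 11, RightOf 12, RightOf 13, RightOf 14, RightOf 15, RightOf 16,
     RightOf 17, RightOf 18, RightOf 19, RightOf 20, RightOf 10, RightOf 11, RightOf 12,
     RightOf 13, RightOf 14, RightOf 15, RightOf 16, RightOf 17, RightOf 18, RightOf 19,
     Fwd 0 0 (Hyp 0), RightOf 31, RightOf 32, RightOf 33, RightOf 34, RightOf 30, RightOf 31,
     RightOf 32, RightOf 33, RightOf 31, RightOf 32, RightOf 30, RightOf 31, RightOf 29,
     RightOf 30, RightOf 28, RightOf 29, RightOf 27, RightOf 28, RightOf 26, RightOf 27,
     RightOf 25, RightOf 26, RightOf 24, RightOf 25, RightOf 23, RightOf 24, RightOf 22,
     RightOf 23, RightOf 21, RightOf 22, RightOf 20, RightOf 21, Fwd 10 0 (Ax LPentagon),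
     LeftOf 21, LeftOf 20, LeftOf 22, LeftOf 21, Bwd 0 0 (Hyp 0), LeftOf 19, LeftOf 18,
     LeftOf 17, LeftOf 16, LeftOf 15, LeftOf 14, LeftOf 13, LeftOf 12, LeftOf 11, LeftOf 10,
     LeftOf 20, LeftOf 19, LeftOf 18, LeftOf 17, LeftOf 16, LeftOf 15, LeftOf 14, LeftOf 13,
     LeftOf 12, LeftOf 11]"], use lambda4_coaction in simp, code_simp)

text \<open>Coassociativity of the coaction on XY rests on multiplicativity of \<Delta>, colinearity
  of its \<open>tauL\<close> on the braid relation together with \<open>LTauMul\<close>. The
  3-cocycle relation evaluates the operator at such tensor products.\<close>

lemma tensor_comodule:
  "left_comodule K A F (tens (left_Tambara K A F) (E 0) (E 1))"
proof -
  have "sem (tensor_lt lX lY \<odot> (Wires [lX, lY] \<boxtimes> Cell LMul))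
      = sem ((Cell LMul \<boxtimes> Wires [lX, lY]) \<odot> (vF \<boxtimes> tensor_lt lX lY) \<odot> (tensor_lt lX lY \<boxtimes> vF))"
    by (rule ldiagrammatic[where hyps = "[]" and ss = "
    [Fwd 0 1 (Ax (LTMul (Ob 1))), Fwd 2 0 (Ax (LTMul (Ob 0))), LeftOf 1]"], simp, code_simp)
  moreover have "sem ((lco Reg \<boxtimes> Wires [lX, lY]) \<odot> tensor_lt lX lY)
      = sem ((vF \<boxtimes> tensor_lt lX lY) \<odot> (tensor_lt lX lY \<boxtimes> vF) \<odot> (Wires [lX, lY] \<boxtimes> lco Reg))"
    by (rule ldiagrammatic[where hyps = "[]" and ss = "
    [Fwd 1 0 (Ax (LTComul (Ob 0))), Fwd 0 1 (Ax (LTComul (Ob 1))), LeftOf 2]"], simp, code_simp)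
  moreover have "sem ((leps \<boxtimes> Wires [lX, lY]) \<odot> tensor_lt lX lY) = sem (Wires [lX, lY] \<boxtimes> leps)"
    by (rule ldiagrammatic[where hyps = "[]" and ss = "
    [Fwd 1 0 (Ax (LTCounit (Ob 0))), Fwd 0 1 (Ax (LTCounit (Ob 1)))]"], simp, code_simp)
  moreover have "sem ((lt Reg \<boxtimes> Wires [lX, lY]) \<odot> (vF \<boxtimes> tensor_lt lX lY) \<odot> (tensor_lt lX lY \<boxtimes> vF))
      = sem ((vF \<boxtimes> tensor_lt lX lY) \<odot> (tensor_lt lX lY \<boxtimes> vF) \<odot> (Wires [lX, lY] \<boxtimes> lt Reg))"
    by (rule ldiagrammatic[where hyps = "[]" and ss = "
    [RightOf 1, Fwd 2 0 (Ax (LYB (Ob 0))), Fwd 0 1 (Ax (LYB (Ob 1))), LeftOf 2]"], simp, code_simp)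
  moreover have "sem ((vF \<boxtimes> tensor_lco lX lY) \<odot> tensor_lco lX lY)
      = sem ((lco Reg \<boxtimes> Wires [lX, lY]) \<odot> tensor_lco lX lY)"
    by (rule ldiagrammatic[where hyps = "[]" and ss = "
    [RightOf 3, RightOf 4, RightOf 2, Fwd 3 1 (Ax (LColin (Ob 0))), RightOf 1,
     Fwd 2 0 (Ax (LCoassoc (Ob 0))), Fwd 0 1 (Ax (LCoassoc (Ob 1))), LeftOf 1, RightOf 3,
     RightOf 6, RightOf 5, RightOf 4, RightOf 7, Bwd 2 1 (Ax (LTComul (Ob 0))),
     Bwd 3 0 (Ax LMulComul)]"], simp, code_simp)
  moreover have "sem ((leps \<boxtimes> Wires [lX, lY]) \<odot> tensor_lco lX lY) = sem (Wires [lX, lY])"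
    by (rule ldiagrammatic[where hyps = "[]" and ss = "
    [Fwd 3 0 (Ax LMulCounit), Fwd 2 1 (Ax (LTCounit (Ob 0))), RightOf 1,
     Fwd 2 0 (Ax (LCounitL (Ob 0))), Fwd 0 1 (Ax (LCounitL (Ob 1)))]"], simp, code_simp)
  moreover have "sem ((vF \<boxtimes> tensor_lco lX lY) \<odot> tensor_lt lX lY)
      = sem ((lt Reg \<boxtimes> Wires [lX, lY]) \<odot> (vF \<boxtimes> tensor_lt lX lY) \<odot> (tensor_lco lX lY \<boxtimes> vF))"
    by (rule ldiagrammatic[where hyps = "[]" and ss = "
    [RightOf 1, Fwd 2 0 (Ax (LColin (Ob 0))), Fwd 0 1 (Ax (LColin (Ob 1))), LeftOf 2, LeftOf 1,
     RightOf 5, Bwd 3 1 (Ax (LYB (Ob 0))), LeftOf 2, Bwd 5 0 (Ax LTauMul), LeftOf 4, LeftOf 3]"], simp, code_simp)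
  ultimately show ?thesis
    using sem_cells[of "tensor_lt lX lY"] sem_cells[of "tensor_lco lX lY"] wd_endo[of "[lX, lY]"]
      wd_append[of "[lX]" "[lY, Reg]"] wd_append[of "[lX, lY]" "[Reg]"]
    unfolding left_comodule_def
    by (simp add: tensor_lt_def tensor_lco_def left_Tambara_def)
qed

end


section \<open>The 3-cocycle given by the inverse of the associator\<close>

text \<open>Makes families indexed by all of \<open>nat\<close>, as the locales require, out of four
  entries; every index from 3 on gives \<open>w\<close>.\<close>

definition select :: "'x \<Rightarrow> 'x \<Rightarrow> 'x \<Rightarrow> 'x \<Rightarrow> nat \<Rightarrow> 'x" where
  "select x y z w n = (if n = 0 then x else if n = 1 then y else if n = 2 then z else w)"

lemma select_simps [simp]: "select x y z w 0 = x" "select x y z w (Suc 0) = y" "select x y z w 1 = y"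
  "select x y z w 2 = z" "select x y z w 3 = w"
  by (simp_all add: select_def)

lemma (in two_category) two_sided_inverse_unique:
  assumes "\<alpha> \<in> Hom f f" "\<beta> \<in> Hom f f" "\<gamma> \<in> Hom f f"
    and "\<beta> \<bullet> \<alpha> = id2 K f" "\<alpha> \<bullet> \<gamma> = id2 K f"
  shows "\<beta> = \<gamma>"
  by (metis assms vcomp_assoc vcomp_unit)

locale sweedler_setting = two_category K for K :: "('o, 'c, 'd) two_cat" (structure) +
  fixes A :: 'o and F :: "('c, 'd) coquasi_data" and B :: "('c, 'd) module_data" and \<sigma> \<omega>inv :: 'd
  assumes base: "A \<in> zero_cells K"
    and zero_cell: "CQB_zero_cell K A F"
    and module_monad: "right_module_monad K A F B"
    and setting: "TB_setting K A F B"
    and sigma: "\<sigma> \<in> Hom (cell F \<star> cell F) (cell B)"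
    and sigma_natural: "X \<in> TB_objects K A F B \<Longrightarrow>
      (\<langle>X\<rangle> \<otimes> \<sigma>) \<bullet> (tauF X \<otimes> \<langle>F\<rangle>) \<bullet> (\<langle>F\<rangle> \<otimes> tauF X) = tauB X \<bullet> (\<sigma> \<otimes> \<langle>X\<rangle>)"
    and omega_inv: "omega_inverse K A F \<omega>inv"
begin

lemma coquasi: "coquasi_bimonad K A F"
  using zero_cell by (simp add: CQB_zero_cell_def)

lemma left_regular_Tambara: "left_Tambara_comodule K A F (left_regular F)"
proof -
  \<comment> \<open>Supplies the braid relation for \<tau>, which is not part of
    \<open>coquasi_bimonad\<close>.\<close>
  have "CQB_object K A F (regular F B)"
    using setting by (simp add: TB_setting_def TB_objects_def Tambara_comodule_def)
  then show ?thesis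
    using zero_cell
    by (simp add: left_Tambara_comodule_def CQB_zero_cell_def coquasi_bimonad_def CQB_object_def
        comonad_def omega_natural_left_def right_monadic_def left_comonadic_def right_comonadic_def
        left_regular_def regular_def)
qed

lemma identity_left_morphism:
  assumes "left_comodule K A F X"
  shows "\<langle>X\<rangle> \<in> mors (left_Tambara K A F) X X"
proof -
  have X: "cell X \<in> endo K A" and F: "cell F \<in> endo K A"
    using assms coquasi by (auto simp: left_comodule_def coquasi_bimonad_def comonad_def)
  have l: "lcoact X \<in> Hom (cell X) (cell F \<star> cell X)"
    and t: "tauL X \<in> Hom (cell X \<star> cell F) (cell F \<star> cell X)"
    using assms by (auto simp: left_comodule_def)
  have "\<langle>F\<rangle> \<otimes> \<langle>X\<rangle> = id2 K (cell F \<star> cell X)" "\<langle>X\<rangle> \<otimes> \<langle>F\<rangle> = id2 K (cell X \<star> cell F)"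
    using X F id2_comp1 by (auto simp: endo_def)
  then show ?thesis
    using vcomp_unit[OF l] vcomp_unit[OF t] id2 X by (simp add: left_Tambara_def endo_def)
qed

text \<open>The mirror image of \<open>TB_assoc\<close>, for an arbitrary \<open>w\<close>. With
  \<open>w\<close> the inverse of \<omega> and all three objects F it is \<beta>.\<close>

definition left_omega :: "'d \<Rightarrow> ('c, 'd) ltobj \<Rightarrow> ('c, 'd) ltobj \<Rightarrow> ('c, 'd) ltobj \<Rightarrow> 'd" where
  "left_omega w X Y Z = (w \<otimes> \<langle>X\<rangle> \<otimes> \<langle>Y\<rangle> \<otimes> \<langle>Z\<rangle>) \<bullet> (\<langle>F\<rangle> \<otimes> \<langle>F\<rangle> \<otimes> tauL X \<otimes> \<langle>Y\<rangle> \<otimes> \<langle>Z\<rangle>)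
     \<bullet> (\<langle>F\<rangle> \<otimes> tauL X \<otimes> tauL Y \<otimes> \<langle>Z\<rangle>) \<bullet> (lcoact X \<otimes> lcoact Y \<otimes> lcoact Z)"

lemma left_comodulesI:
  assumes "left_comodule K A F X" "left_comodule K A F Y" "left_comodule K A F Z" "left_comodule K A F W"
    and "left_comodule K A F X'" "left_comodule K A F Y'" "left_comodule K A F Z'" "left_comodule K A F W'"
    and "f \<in> mors (left_Tambara K A F) X X'" "g \<in> mors (left_Tambara K A F) Y Y'"
    and "h \<in> mors (left_Tambara K A F) Z Z'" "k \<in> mors (left_Tambara K A F) W W'"
  shows "left_comodules K A F \<omega>inv (select X Y Z W) (select X' Y' Z' W') (select f g h k)"
  using assms base coquasi omega_inv left_comodule_Tambara[OF left_regular_Tambara]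
  by unfold_locales (auto simp: select_def)

lemma left_comodules_id:
  assumes "left_comodule K A F X" "left_comodule K A F Y" "left_comodule K A F Z" "left_comodule K A F W"
  shows "left_comodules K A F \<omega>inv (select X Y Z W) (select X Y Z W) (select \<langle>X\<rangle> \<langle>Y\<rangle> \<langle>Z\<rangle> \<langle>W\<rangle>)"
  using left_comodulesI[OF assms assms] assms identity_left_morphism by blast

lemma tensor_left_comodule:
  assumes "left_comodule K A F X" "left_comodule K A F Y"
  shows "left_comodule K A F (tens (left_Tambara K A F) X Y)"
proof -
  interpret left_comodules K A F \<omega>inv "select X Y Y Y" "select X Y Y Y" "select \<langle>X\<rangle> \<langle>Y\<rangle> \<langle>Y\<rangle> \<langle>Y\<rangle>"
    using left_comodules_id assms by blast
  show ?thesis using tensor_comodule by simp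
qed

lemma left_omega_inverse:
  assumes "left_comodule K A F X" "left_comodule K A F Y" "left_comodule K A F Z"
  defines "N \<equiv> cell X \<star> cell Y \<star> cell Z"
  shows "left_omega \<omega>inv X Y Z \<in> Hom N N" "left_omega \<omega>\<^bsub>F\<^esub> X Y Z \<in> Hom N N"
    and "left_omega \<omega>inv X Y Z \<bullet> left_omega \<omega>\<^bsub>F\<^esub> X Y Z = id2 K N"
    and "left_omega \<omega>\<^bsub>F\<^esub> X Y Z \<bullet> left_omega \<omega>inv X Y Z = id2 K N"
proof -
  interpret left_comodules K A F \<omega>inv "select X Y Z Z" "select X Y Z Z" "select \<langle>X\<rangle> \<langle>Y\<rangle> \<langle>Z\<rangle> \<langle>Z\<rangle>"
    using left_comodules_id assms(1-3) by blast
  have sem: "sem (omega_op LOmegaInv lX lY lZ) = left_omega \<omega>inv X Y Z"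
    "sem (omega_op LOmega lX lY lZ) = left_omega \<omega>\<^bsub>F\<^esub> X Y Z"
    by (simp_all add: omega_op_def lambda3_def left_omega_def)
  have one: "sem (vX lX \<boxtimes> vX lY \<boxtimes> vX lZ) = id2 K N"
    using one_append[of "[lX]" "[lY, lZ]"] one_append[of "[lY]" "[lZ]"] by (simp add: N_def)
  show "left_omega \<omega>inv X Y Z \<in> Hom N N" "left_omega \<omega>\<^bsub>F\<^esub> X Y Z \<in> Hom N N"
    using sem_cells[of "omega_op LOmegaInv lX lY lZ"] sem_cells[of "omega_op LOmega lX lY lZ"] sem
    by (simp_all add: omega_op_def lambda3_def N_def)
  show "left_omega \<omega>inv X Y Z \<bullet> left_omega \<omega>\<^bsub>F\<^esub> X Y Z = id2 K N"
    "left_omega \<omega>\<^bsub>F\<^esub> X Y Z \<bullet> left_omega \<omega>inv X Y Z = id2 K N"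
    using omega_op_inverse one by (simp_all only: sem.simps sem)
qed

lemma left_omega_natural:
  assumes "left_comodule K A F X" "left_comodule K A F Y" "left_comodule K A F Z"
    and "left_comodule K A F X'" "left_comodule K A F Y'" "left_comodule K A F Z'"
    and "f \<in> mors (left_Tambara K A F) X X'" "g \<in> mors (left_Tambara K A F) Y Y'"
    and "h \<in> mors (left_Tambara K A F) Z Z'"
  shows "(f \<otimes> g \<otimes> h) \<bullet> left_omega \<omega>inv X Y Z = left_omega \<omega>inv X' Y' Z' \<bullet> (f \<otimes> g \<otimes> h)"
proof -
  interpret left_comodules K A F \<omega>inv "select X Y Z Z" "select X' Y' Z' Z'" "select f g h h"
    using left_comodulesI assms by blast
  show ?thesis using omega_op_natural by (simp add: omega_op_def lambda3_def left_omega_def)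
qed

section \<open>The pentagon for \<omega> and the 3-cocycle relation for its inverse\<close>

lemma left_omega_pentagon:
  fixes X Y Z W
  assumes X: "left_Tambara_comodule K A F X" and YZW: "left_comodule K A F Y" "left_comodule K A F Z" "left_comodule K A F W"
  defines "T \<equiv> tens (left_Tambara K A F)"
  shows "(left_omega \<omega>\<^bsub>F\<^esub> X Y Z \<otimes> \<langle>W\<rangle>) \<bullet> left_omega \<omega>\<^bsub>F\<^esub> X (T Y Z) W \<bullet> (\<langle>X\<rangle> \<otimes> left_omega \<omega>\<^bsub>F\<^esub> Y Z W)
    = left_omega \<omega>\<^bsub>F\<^esub> (T X Y) Z W \<bullet> left_omega \<omega>\<^bsub>F\<^esub> X Y (T Z W)"
proof -
  interpret left_comodules K A F \<omega>inv "select X Y Z W" "select X Y Z W" "select \<langle>X\<rangle> \<langle>Y\<rangle> \<langle>Z\<rangle> \<langle>W\<rangle>"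
    by (rule left_comodules_id[OF left_comodule_Tambara[OF X] YZW])
  have "sem (vX lX \<boxtimes> Cell LOmega) = sem ((Cell LOmega \<boxtimes> vX lX) \<odot> (vF \<boxtimes> vF \<boxtimes> lt lX)
     \<odot> (vF \<boxtimes> lt lX \<boxtimes> vF) \<odot> (lt lX \<boxtimes> vF \<boxtimes> vF))"
    using X by (simp add: left_Tambara_comodule_def omega_natural_left_def)
  note last = acting_last_factor[OF this]
  note defs = left_omega_def omega_op_def lambda3_def T_def left_Tambara_def tensor_lt_def tensor_lco_def
  have "sem (acting (Cell LOmega \<boxtimes> leps)) = left_omega \<omega>\<^bsub>F\<^esub> X Y Z \<otimes> \<langle>W\<rangle>"
    unfolding acting_factors(1)[symmetric] by (simp add: defs)
  moreover have "sem (acting (Cell LOmega \<odot> (vF \<boxtimes> Cell LMul \<boxtimes> vF))) = left_omega \<omega>\<^bsub>F\<^esub> X (T Y Z) W"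
    unfolding acting_factors(2)[symmetric] by (simp add: defs)
  moreover have "sem (acting (leps \<boxtimes> Cell LOmega)) = \<langle>X\<rangle> \<otimes> left_omega \<omega>\<^bsub>F\<^esub> Y Z W"
    unfolding last[symmetric] by (simp add: defs)
  moreover have "sem (acting (Cell LOmega \<odot> (Cell LMul \<boxtimes> vF \<boxtimes> vF))) = left_omega \<omega>\<^bsub>F\<^esub> (T X Y) Z W"
    unfolding acting_factors(3)[symmetric] by (simp add: defs)
  moreover have "sem (acting (Cell LOmega \<odot> (vF \<boxtimes> vF \<boxtimes> Cell LMul))) = left_omega \<omega>\<^bsub>F\<^esub> X Y (T Z W)"
    unfolding acting_factors(4)[symmetric] by (simp add: defs)
  ultimately show ?thesis
    using acting_pentagon by (simp only: sem.simps(4))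
qed

text \<open>One side is a left inverse of the first composite in the pentagon of \<omega>, the other
  a right inverse of the second. The two composites are equal, hence so are these inverses.\<close>

lemma left_omega_inv_pentagon:
  fixes X Y Z W
  assumes X: "left_Tambara_comodule K A F X" and Y: "left_comodule K A F Y" and Z: "left_comodule K A F Z"
    and W: "left_comodule K A F W"
  defines "T \<equiv> tens (left_Tambara K A F)"
  shows "(\<langle>X\<rangle> \<otimes> left_omega \<omega>inv Y Z W) \<bullet> left_omega \<omega>inv X (T Y Z) W \<bullet> (left_omega \<omega>inv X Y Z \<otimes> \<langle>W\<rangle>)
    = left_omega \<omega>inv X Y (T Z W) \<bullet> left_omega \<omega>inv (T X Y) Z W"
proof -
  have X': "left_comodule K A F X" using X by (rule left_comodule_Tambara)
  define N where "N = cell X \<star> cell Y \<star> cell Z \<star> cell W"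
  have T: "cell (T P Q) = cell P \<star> cell Q" for P Q
    by (simp add: T_def left_Tambara_def)
  have endo: "cell X \<in> endo K A" "cell Y \<in> endo K A" "cell Z \<in> endo K A" "cell W \<in> endo K A"
    using X' Y Z W by (auto simp: left_comodule_def)
  note ops = endo_def comp1 comp1_assoc
  let ?a = "\<langle>X\<rangle> \<otimes> left_omega \<omega>\<^bsub>F\<^esub> Y Z W" and ?a' = "\<langle>X\<rangle> \<otimes> left_omega \<omega>inv Y Z W"
  let ?b = "left_omega \<omega>\<^bsub>F\<^esub> X (T Y Z) W" and ?b' = "left_omega \<omega>inv X (T Y Z) W"
  let ?c = "left_omega \<omega>\<^bsub>F\<^esub> X Y Z \<otimes> \<langle>W\<rangle>" and ?c' = "left_omega \<omega>inv X Y Z \<otimes> \<langle>W\<rangle>"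
  let ?d = "left_omega \<omega>\<^bsub>F\<^esub> X Y (T Z W)" and ?d' = "left_omega \<omega>inv X Y (T Z W)"
  let ?e = "left_omega \<omega>\<^bsub>F\<^esub> (T X Y) Z W" and ?e' = "left_omega \<omega>inv (T X Y) Z W"
  have TL: "left_comodule K A F (T P Q)" if "left_comodule K A F P" "left_comodule K A F Q" for P Q
    unfolding T_def using that by (rule tensor_left_comodule)
  have b: "?b \<in> Hom N N" "?b' \<in> Hom N N" "?b' \<bullet> ?b = id2 K N"
    using left_omega_inverse[OF X' TL[OF Y Z] W] endo by (simp_all add: T N_def ops)
  have d: "?d \<in> Hom N N" "?d' \<in> Hom N N" "?d \<bullet> ?d' = id2 K N"
    using left_omega_inverse[OF X' Y TL[OF Z W]] endo by (simp_all add: T N_def ops)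
  have e: "?e \<in> Hom N N" "?e' \<in> Hom N N" "?e \<bullet> ?e' = id2 K N"
    using left_omega_inverse[OF TL[OF X' Y] Z W] endo by (simp_all add: T N_def ops)
  note yzw = left_omega_inverse[OF Y Z W] and xyz = left_omega_inverse[OF X' Y Z]
  have one: "\<langle>P\<rangle> \<in> Hom (cell P) (cell P)" "\<langle>P\<rangle> \<bullet> \<langle>P\<rangle> = \<langle>P\<rangle>" if "cell P \<in> endo K A" for P :: "('c, 'd) ltobj"
    using id2[of "cell P"] vcomp_unit that by (auto simp: endo_def)
  have split: "id2 K (cell X \<star> cell Y \<star> cell Z \<star> cell W) = \<langle>X\<rangle> \<otimes> id2 K (cell Y \<star> cell Z \<star> cell W)"
    "id2 K ((cell X \<star> cell Y \<star> cell Z) \<star> cell W) = id2 K (cell X \<star> cell Y \<star> cell Z) \<otimes> \<langle>W\<rangle>"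
    using endo by (auto intro!: id2_comp1 simp: endo_def comp1)
  have a: "?a \<in> Hom N N" "?a' \<in> Hom N N" "?a' \<bullet> ?a = id2 K N"
    using hcomp[OF yzw(2) one(1)[OF endo(1)]] hcomp[OF yzw(1) one(1)[OF endo(1)]]
      interchange[OF yzw(2,1) one(1)[OF endo(1)] one(1)[OF endo(1)]] yzw(3) one(2)[OF endo(1)] split endo
    by (simp_all add: N_def ops)
  have c: "?c \<in> Hom N N" "?c' \<in> Hom N N" "?c' \<bullet> ?c = id2 K N"
    using hcomp[OF one(1)[OF endo(4)] xyz(2)] hcomp[OF one(1)[OF endo(4)] xyz(1)]
      interchange[OF one(1)[OF endo(4)] one(1)[OF endo(4)] xyz(2,1)] xyz(3) one(2)[OF endo(4)] split endo
    by (simp_all add: N_def ops)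
  have left_inverse: "(?a' \<bullet> ?b' \<bullet> ?c') \<bullet> (?c \<bullet> ?b \<bullet> ?a) = id2 K N"
    using a b c by (smt (verit) vcomp vcomp_assoc vcomp_unit)
  have right_inverse: "(?e \<bullet> ?d) \<bullet> (?d' \<bullet> ?e') = id2 K N"
    using d e by (smt (verit) vcomp vcomp_assoc vcomp_unit)
  show ?thesis
  proof (rule two_sided_inverse_unique)
    show "?c \<bullet> ?b \<bullet> ?a \<in> Hom N N" "?a' \<bullet> ?b' \<bullet> ?c' \<in> Hom N N" "?d' \<bullet> ?e' \<in> Hom N N"
      using a b c d e vcomp by meson+
    show "(?c \<bullet> ?b \<bullet> ?a) \<bullet> (?d' \<bullet> ?e') = id2 K N"
      using right_inverse left_omega_pentagon[OF X Y Z W] by (simp add: T_def)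
  qed (rule left_inverse)
qed

lemma left_omega_three_cocycle: "three_cocycle K (left_Tambara K A F) (left_omega \<omega>inv)"
proof -
  have simps: "objs (left_Tambara K A F) = {X. left_Tambara_comodule K A F X}" "under (left_Tambara K A F) = cell"
    by (simp_all add: left_Tambara_def)
  show ?thesis
    unfolding three_cocycle_def Let_def simps
    by (intro conjI ballI left_omega_inverse(1) left_omega_natural left_omega_inv_pentagon)
      (simp_all add: left_comodule_Tambara)
qed

end


section \<open>The conditions on the given 2-cell\<close>

context sweedler_setting
begin

lemma F_endo: "cell F \<in> endo K A"
  using coquasi by (simp add: coquasi_bimonad_def comonad_def)

lemma monad_B: "monad K A B"
  using module_monad by (simp add: right_module_monad_def)

lemma regular_TB: "regular F B \<in> TB_objects K A F B"
  using setting by (simp add: TB_setting_def)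

text \<open>A value of the right type for the parameter \<open>aux\<close> when no inverse is under
  consideration; \<sigma> itself then fills the slot of \<open>SigInv\<close>.\<close>

lemma unit_aux: "\<langle>F\<rangle> \<otimes> \<langle>F\<rangle> \<otimes> \<eta>\<^bsub>B\<^esub> \<in> Hom (cell F \<star> cell F) (cell F \<star> cell F \<star> cell B)"
proof -
  have F: "cell F \<in> one_cells K" "src K (cell F) = A" "tgt K (cell F) = A"
    and B: "cell B \<in> one_cells K" "src K (cell B) = A" "tgt K (cell B) = A"
    and \<eta>: "\<eta>\<^bsub>B\<^esub> \<in> Hom (id1 K A) (cell B)"
    using F_endo monad_B by (auto simp: endo_def monad_def)
  show ?thesis
    using hcomp[OF hcomp[OF \<eta> id2[OF F(1)]] id2[OF F(1)]] F B comp1_unit[OF F(1)] id1[OF base]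
    by (simp add: comp1)
qed

lemma identity_TB_morphism:
  assumes "X \<in> TB_objects K A F B"
  shows "\<langle>X\<rangle> \<in> TB_morphisms K F B X X"
proof -
  have X: "cell X \<in> endo K A" and F: "cell F \<in> endo K A" and B: "cell B \<in> endo K A"
    using assms F_endo monad_B by (auto simp: TB_objects_def Tambara_comodule_def CQB_object_def monad_def)
  have r: "\<rho>\<^bsub>X\<^esub> \<in> Hom (cell X) (cell X \<star> cell F)"
    and t: "tauF X \<in> Hom (cell F \<star> cell X) (cell X \<star> cell F)"
    and u: "tauB X \<in> Hom (cell B \<star> cell X) (cell X \<star> cell B)"
    using assms by (auto simp: TB_objects_def Tambara_comodule_def CQB_object_def left_monadic_def)
  have "\<langle>X\<rangle> \<otimes> \<langle>F\<rangle> = id2 K (cell X \<star> cell F)" "\<langle>F\<rangle> \<otimes> \<langle>X\<rangle> = id2 K (cell F \<star> cell X)"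
    "\<langle>X\<rangle> \<otimes> \<langle>B\<rangle> = id2 K (cell X \<star> cell B)" "\<langle>B\<rangle> \<otimes> \<langle>X\<rangle> = id2 K (cell B \<star> cell X)"
    using X F B id2_comp1 by (auto simp: endo_def)
  then show ?thesis
    using vcomp_unit[OF r] vcomp_unit[OF t] vcomp_unit[OF u] id2 X by (simp add: TB_morphisms_def endo_def)
qed

lemma right_comodulesI:
  assumes "X \<in> TB_objects K A F B" "Y \<in> TB_objects K A F B" "Z \<in> TB_objects K A F B"
    and "X' \<in> TB_objects K A F B" "Y' \<in> TB_objects K A F B" "Z' \<in> TB_objects K A F B"
    and "f \<in> TB_morphisms K F B X X'" "g \<in> TB_morphisms K F B Y Y'" "h \<in> TB_morphisms K F B Z Z'"
    and "s \<in> Hom (cell F \<star> cell F) (cell B)" "a \<in> Hom (cell F \<star> cell F) (cell F \<star> cell F \<star> cell B)"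
  shows "right_comodules K A F B \<sigma> \<omega>inv (select X Y Z Z) (select X' Y' Z' Z') (select f g h h) s a"
  using assms base coquasi omega_inv module_monad setting sigma sigma_natural
  by unfold_locales (auto simp: select_def)

lemma right_comodules_id:
  assumes "X \<in> TB_objects K A F B" "Y \<in> TB_objects K A F B" "Z \<in> TB_objects K A F B"
    and "s \<in> Hom (cell F \<star> cell F) (cell B)" "a \<in> Hom (cell F \<star> cell F) (cell F \<star> cell F \<star> cell B)"
  shows "right_comodules K A F B \<sigma> \<omega>inv (select X Y Z Z) (select X Y Z Z) (select \<langle>X\<rangle> \<langle>Y\<rangle> \<langle>Z\<rangle> \<langle>Z\<rangle>) s a"
  by (rule right_comodulesI[OF assms(1-3) assms(1-3)]) (use assms identity_TB_morphism in auto)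

abbreviation "C \<equiv> TB_objects K A F B"

lemmas right_comodules_objects = right_comodules_id[OF _ _ _ sigma unit_aux]

lemma right_comodules_regular:
  assumes "a \<in> Hom (cell F \<star> cell F) (cell F \<star> cell F \<star> cell B)"
  defines "R \<equiv> regular F B"
  shows "right_comodules K A F B \<sigma> \<omega>inv (select R R R R) (select R R R R) (select \<langle>F\<rangle> \<langle>F\<rangle> \<langle>F\<rangle> \<langle>F\<rangle>) \<sigma> a"
  using right_comodules_id[OF regular_TB regular_TB regular_TB sigma assms(1)] by (simp add: R_def regular_def)

definition rho :: "('c, 'd) tobj \<Rightarrow> ('c, 'd) tobj \<Rightarrow> 'd" where
  "rho X Y = (\<langle>X\<rangle> \<otimes> \<langle>Y\<rangle> \<otimes> \<sigma>) \<bullet> (\<langle>X\<rangle> \<otimes> tauF Y \<otimes> \<langle>F\<rangle>) \<bullet> (\<rho>\<^bsub>X\<^esub> \<otimes> \<rho>\<^bsub>Y\<^esub>)"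

definition mult_M :: 'd where
  "mult_M = (\<mu>\<^bsub>F\<^esub> \<otimes> \<sigma>) \<bullet> (\<langle>F\<rangle> \<otimes> \<tau>\<^bsub>F\<^esub> \<otimes> \<langle>F\<rangle>) \<bullet> (\<Delta>\<^bsub>F\<^esub> \<otimes> \<Delta>\<^bsub>F\<^esub>)"

abbreviation psi_F :: 'd where "psi_F \<equiv> psi K F B (regular F B)"

definition beta :: 'd where
  "beta = (\<omega>inv \<otimes> \<langle>F\<rangle> \<otimes> \<langle>F\<rangle> \<otimes> \<langle>F\<rangle>) \<bullet> Delta3 K F"

lemma rho_hom:
  assumes "X \<in> C" "Y \<in> C"
  shows "rho X Y \<in> Hom (cell X \<star> cell Y) (cell X \<star> cell Y \<star> cell B)"
proof -
  interpret right_comodules K A F B \<sigma> \<omega>inv "select X Y Y Y" "select X Y Y Y" "select \<langle>X\<rangle> \<langle>Y\<rangle> \<langle>Y\<rangle> \<langle>Y\<rangle>" \<sigma> "\<langle>F\<rangle> \<otimes> \<langle>F\<rangle> \<otimes> \<eta>\<^bsub>B\<^esub>"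
    by (rule right_comodules_objects[OF assms assms(2)])
  show ?thesis
    using sem_cells[of "cocycle_diag oX oY"] by (simp add: cocycle_diag_def rho_def)
qed

lemma rho_natural:
  assumes "X \<in> C" "X' \<in> C" "Y \<in> C" "Y' \<in> C" and f: "\<zeta> \<in> TB_morphisms K F B X X'" "\<xi> \<in> TB_morphisms K F B Y Y'"
  shows "(\<zeta> \<otimes> \<xi> \<otimes> \<langle>B\<rangle>) \<bullet> rho X Y = rho X' Y' \<bullet> (\<zeta> \<otimes> \<xi>)"
proof -
  interpret right_comodules K A F B \<sigma> \<omega>inv "select X Y Y Y" "select X' Y' Y' Y'" "select \<zeta> \<xi> \<xi> \<xi>" \<sigma> "\<langle>F\<rangle> \<otimes> \<langle>F\<rangle> \<otimes> \<eta>\<^bsub>B\<^esub>"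
    by (rule right_comodulesI[OF assms(1,3,3,2,4,4) f f(2) sigma unit_aux])
  show ?thesis
    using cocycle_natural by (simp add: cocycle_diag_def rho_def)
qed

lemma invertible_iff:
  "(\<forall>X\<in>C. \<forall>Y\<in>C. \<exists>s \<in> Hom (cell X \<star> cell Y) (cell X \<star> cell Y \<star> cell B).
       (\<langle>X\<rangle> \<otimes> \<langle>Y\<rangle> \<otimes> \<mu>\<^bsub>B\<^esub>) \<bullet> (s \<otimes> \<langle>B\<rangle>) \<bullet> rho X Y = \<langle>X\<rangle> \<otimes> \<langle>Y\<rangle> \<otimes> \<eta>\<^bsub>B\<^esub>
     \<and> (\<langle>X\<rangle> \<otimes> \<langle>Y\<rangle> \<otimes> \<mu>\<^bsub>B\<^esub>) \<bullet> (rho X Y \<otimes> \<langle>B\<rangle>) \<bullet> s = \<langle>X\<rangle> \<otimes> \<langle>Y\<rangle> \<otimes> \<eta>\<^bsub>B\<^esub>)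
   \<longleftrightarrow> conv_invertible_FF K F B \<sigma>" (is "?L \<longleftrightarrow> ?R")
proof
  assume ?L
  then obtain s where s: "s \<in> Hom (cell F \<star> cell F) (cell F \<star> cell F \<star> cell B)"
    "(\<langle>F\<rangle> \<otimes> \<langle>F\<rangle> \<otimes> \<mu>\<^bsub>B\<^esub>) \<bullet> (s \<otimes> \<langle>B\<rangle>) \<bullet> rho (regular F B) (regular F B) = \<langle>F\<rangle> \<otimes> \<langle>F\<rangle> \<otimes> \<eta>\<^bsub>B\<^esub>"
    "(\<langle>F\<rangle> \<otimes> \<langle>F\<rangle> \<otimes> \<mu>\<^bsub>B\<^esub>) \<bullet> (rho (regular F B) (regular F B) \<otimes> \<langle>B\<rangle>) \<bullet> s = \<langle>F\<rangle> \<otimes> \<langle>F\<rangle> \<otimes> \<eta>\<^bsub>B\<^esub>"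
    using regular_TB by (fastforce simp: regular_def)
  let ?reg = "regular F B"
  interpret right_comodules K A F B \<sigma> \<omega>inv "select ?reg ?reg ?reg ?reg" "select ?reg ?reg ?reg ?reg" "select \<langle>F\<rangle> \<langle>F\<rangle> \<langle>F\<rangle> \<langle>F\<rangle>" \<sigma> s
    by (rule right_comodules_regular[OF s(1)])
  have left: "sem ((wF \<boxtimes> wF \<boxtimes> Cell MulB) \<odot> (Cell Aux \<boxtimes> wB) \<odot> cocycle_diag Reg Reg) = sem (wF \<boxtimes> wF \<boxtimes> Cell UnitB)"
    using s(2) by (simp add: cocycle_diag_def rho_def)
  have right: "sem ((wF \<boxtimes> wF \<boxtimes> Cell MulB) \<odot> (cocycle_diag Reg Reg \<boxtimes> wB) \<odot> Cell Aux) = sem (wF \<boxtimes> wF \<boxtimes> Cell UnitB)"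
    using s(3) by (simp add: cocycle_diag_def rho_def)
  \<comment> \<open>Counits on FF extract the 2-cell FF \<rightarrow> B from the inverse at F,
    F.\<close>
  let ?s' = "(\<epsilon>\<^bsub>F\<^esub> \<otimes> \<epsilon>\<^bsub>F\<^esub> \<otimes> \<langle>B\<rangle>) \<bullet> s"
  have "?s' \<in> Hom (cell F \<star> cell F) (cell B)"
    using sem_cells[of "(eps \<boxtimes> eps \<boxtimes> wB) \<odot> Cell Aux"] by simp
  moreover have "is_conv_inverse K \<mu>\<^bsub>B\<^esub> \<eta>\<^bsub>B\<^esub> (Delta2 K F) (\<epsilon>\<^bsub>F\<^esub> \<otimes> \<epsilon>\<^bsub>F\<^esub>) \<sigma> ?s'"
    using aux_conv[OF left right]
    by (simp add: is_conv_inverse_def conv_def convolution_def delta2_def Delta2_def)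
  ultimately show ?R
    using sigma by (auto simp: conv_invertible_FF_def)
next
  assume ?R
  then obtain s' where s': "s' \<in> Hom (cell F \<star> cell F) (cell B)"
    "is_conv_inverse K \<mu>\<^bsub>B\<^esub> \<eta>\<^bsub>B\<^esub> (Delta2 K F) (\<epsilon>\<^bsub>F\<^esub> \<otimes> \<epsilon>\<^bsub>F\<^esub>) \<sigma> s'"
    by (auto simp: conv_invertible_FF_def)
  show ?L
  proof (intro ballI)
    fix X Y assume XY: "X \<in> C" "Y \<in> C"
    interpret right_comodules K A F B \<sigma> \<omega>inv "select X Y Y Y" "select X Y Y Y" "select \<langle>X\<rangle> \<langle>Y\<rangle> \<langle>Y\<rangle> \<langle>Y\<rangle>" s' "\<langle>F\<rangle> \<otimes> \<langle>F\<rangle> \<otimes> \<eta>\<^bsub>B\<^esub>"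
      by (rule right_comodules_id[OF XY XY(2) s'(1) unit_aux])
    let ?t = "(wX oX \<boxtimes> wX oY \<boxtimes> Cell SigInv) \<odot> delta2 oX oY"
    have conv: "sem (convolution (Cell SigInv) (Cell Sig)) = sem (Cell UnitB \<odot> (eps \<boxtimes> eps))"
      "sem (convolution (Cell Sig) (Cell SigInv)) = sem (Cell UnitB \<odot> (eps \<boxtimes> eps))"
      using s'(2) by (simp_all add: is_conv_inverse_def conv_def convolution_def delta2_def Delta2_def)
    have inv: "sem ((wX oX \<boxtimes> wX oY \<boxtimes> Cell MulB) \<odot> (?t \<boxtimes> wB) \<odot> cocycle_diag oX oY) = sem (wX oX \<boxtimes> wX oY \<boxtimes> Cell UnitB)"
      "sem ((wX oX \<boxtimes> wX oY \<boxtimes> Cell MulB) \<odot> (cocycle_diag oX oY \<boxtimes> wB) \<odot> ?t) = sem (wX oX \<boxtimes> wX oY \<boxtimes> Cell UnitB)"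
      unfolding inverse_product unit_delta2[symmetric] by (simp_all only: sem.simps conv[unfolded sem.simps])
    show "\<exists>s \<in> Hom (cell X \<star> cell Y) (cell X \<star> cell Y \<star> cell B).
       (\<langle>X\<rangle> \<otimes> \<langle>Y\<rangle> \<otimes> \<mu>\<^bsub>B\<^esub>) \<bullet> (s \<otimes> \<langle>B\<rangle>) \<bullet> rho X Y = \<langle>X\<rangle> \<otimes> \<langle>Y\<rangle> \<otimes> \<eta>\<^bsub>B\<^esub>
     \<and> (\<langle>X\<rangle> \<otimes> \<langle>Y\<rangle> \<otimes> \<mu>\<^bsub>B\<^esub>) \<bullet> (rho X Y \<otimes> \<langle>B\<rangle>) \<bullet> s = \<langle>X\<rangle> \<otimes> \<langle>Y\<rangle> \<otimes> \<eta>\<^bsub>B\<^esub>"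
    proof (rule bexI[of _ "sem ?t"])
      show "sem ?t \<in> Hom (cell X \<star> cell Y) (cell X \<star> cell Y \<star> cell B)"
        using sem_cells[of ?t] by (simp add: delta2_def)
    qed (use inv in \<open>simp_all add: cocycle_diag_def rho_def\<close>)
  qed
qed

definition module_condition :: bool where
  "module_condition \<longleftrightarrow> \<mu>\<^bsub>B\<^esub> \<bullet> (\<sigma> \<otimes> \<langle>B\<rangle>) \<bullet> (\<langle>F\<rangle> \<otimes> psi_F) \<bullet> (psi_F \<otimes> \<langle>F\<rangle>) = \<mu>\<^bsub>B\<^esub> \<bullet> (\<lhd>\<^bsub>B\<^esub> \<otimes> \<langle>B\<rangle>) \<bullet> (\<langle>B\<rangle> \<otimes> mult_M)"

lemma linearity_iff:
  "(\<forall>X\<in>C. \<forall>Y\<in>C.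
       (\<langle>X\<rangle> \<otimes> \<langle>Y\<rangle> \<otimes> \<mu>\<^bsub>B\<^esub>) \<bullet> (rho X Y \<otimes> \<langle>B\<rangle>) \<bullet> (\<langle>X\<rangle> \<otimes> psi K F B Y) \<bullet> (psi K F B X \<otimes> \<langle>Y\<rangle>)
     = (\<langle>X\<rangle> \<otimes> \<langle>Y\<rangle> \<otimes> \<mu>\<^bsub>B\<^esub>) \<bullet> (psi K F B (TB_tensor K F X Y) \<otimes> \<langle>B\<rangle>) \<bullet> (\<langle>B\<rangle> \<otimes> rho X Y))
   \<longleftrightarrow> module_condition" (is "?L \<longleftrightarrow> ?R")
proof
  assume L: ?L
  let ?reg = "regular F B"
  interpret right_comodules K A F B \<sigma> \<omega>inv "select ?reg ?reg ?reg ?reg" "select ?reg ?reg ?reg ?reg" "select \<langle>F\<rangle> \<langle>F\<rangle> \<langle>F\<rangle> \<langle>F\<rangle>" \<sigma> "\<langle>F\<rangle> \<otimes> \<langle>F\<rangle> \<otimes> \<eta>\<^bsub>B\<^esub>"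
    by (rule right_comodules_regular[OF unit_aux])
  have "sem ((wX oX \<boxtimes> wX oY \<boxtimes> module_left) \<odot> tauB_delta2 oX oY) = sem ((wX oX \<boxtimes> wX oY \<boxtimes> module_right) \<odot> tauB_delta2 oX oY)"
    unfolding linearity_left[symmetric] linearity_right[symmetric]
    using L[rule_format, OF regular_TB regular_TB]
    by (simp add: cocycle_diag_def psi_diag_def tensor_psi_def tensor_tB_def tensor_coact_def rho_def psi_def TB_tensor_def)
  \<comment> \<open>\<open>oX\<close>, \<open>oY\<close> and \<open>Reg\<close> are different
    symbols but all denote F here; only at \<open>Reg\<close> are the laws for the counit of F
    available.\<close>
  moreover have "sem (tauB_delta2 oX oY) = sem (tauB_delta2 Reg Reg)"
    by (simp add: tauB_delta2_def tensor_tB_def delta2_def)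
  ultimately have "sem ((wF \<boxtimes> wF \<boxtimes> module_left) \<odot> tauB_delta2 Reg Reg) = sem ((wF \<boxtimes> wF \<boxtimes> module_right) \<odot> tauB_delta2 Reg Reg)"
    by simp
  then have "sem module_left = sem module_right"
    unfolding linearity_regular[symmetric] sem.simps(4)[of "eps \<boxtimes> eps \<boxtimes> wB"] by (rule arg_cong)
  then show ?R
    by (simp add: module_condition_def module_left_def module_right_def psi_diag_def mu_M_def psi_def mult_M_def)
next
  assume R: ?R
  show ?L
  proof (intro ballI)
    fix X Y assume XY: "X \<in> C" "Y \<in> C"
    interpret right_comodules K A F B \<sigma> \<omega>inv "select X Y Y Y" "select X Y Y Y" "select \<langle>X\<rangle> \<langle>Y\<rangle> \<langle>Y\<rangle> \<langle>Y\<rangle>" \<sigma> "\<langle>F\<rangle> \<otimes> \<langle>F\<rangle> \<otimes> \<eta>\<^bsub>B\<^esub>"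
      by (rule right_comodules_objects[OF XY XY(2)])
    have "sem module_left = sem module_right"
      using R by (simp add: module_condition_def module_left_def module_right_def psi_diag_def mu_M_def psi_def mult_M_def)
    then have "sem ((wX oX \<boxtimes> wX oY \<boxtimes> module_left) \<odot> tauB_delta2 oX oY) = sem ((wX oX \<boxtimes> wX oY \<boxtimes> module_right) \<odot> tauB_delta2 oX oY)"
      by simp
    then show "(\<langle>X\<rangle> \<otimes> \<langle>Y\<rangle> \<otimes> \<mu>\<^bsub>B\<^esub>) \<bullet> (rho X Y \<otimes> \<langle>B\<rangle>) \<bullet> (\<langle>X\<rangle> \<otimes> psi K F B Y) \<bullet> (psi K F B X \<otimes> \<langle>Y\<rangle>)
     = (\<langle>X\<rangle> \<otimes> \<langle>Y\<rangle> \<otimes> \<mu>\<^bsub>B\<^esub>) \<bullet> (psi K F B (TB_tensor K F X Y) \<otimes> \<langle>B\<rangle>) \<bullet> (\<langle>B\<rangle> \<otimes> rho X Y)"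
      unfolding linearity_left[symmetric] linearity_right[symmetric]
      by (simp add: cocycle_diag_def psi_diag_def tensor_psi_def tensor_tB_def tensor_coact_def rho_def psi_def TB_tensor_def)
  qed
qed

definition cocycle_condition :: bool where
  "cocycle_condition \<longleftrightarrow> \<mu>\<^bsub>B\<^esub> \<bullet> (\<sigma> \<otimes> \<langle>B\<rangle>) \<bullet> (\<langle>F\<rangle> \<otimes> mult_M) \<bullet> beta = \<mu>\<^bsub>B\<^esub> \<bullet> (\<sigma> \<otimes> \<langle>B\<rangle>) \<bullet> (\<langle>F\<rangle> \<otimes> psi_F) \<bullet> (mult_M \<otimes> \<langle>F\<rangle>)"

lemma associativity_iff:
  "(\<forall>X\<in>C. \<forall>Y\<in>C. \<forall>Z\<in>C.
       (TB_assoc K F X Y Z \<otimes> \<mu>\<^bsub>B\<^esub>) \<bullet> (rho (TB_tensor K F X Y) Z \<otimes> \<langle>B\<rangle>)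
          \<bullet> (\<langle>X\<rangle> \<otimes> \<langle>Y\<rangle> \<otimes> psi K F B Z) \<bullet> (rho X Y \<otimes> \<langle>Z\<rangle>)
     = (\<langle>X\<rangle> \<otimes> \<langle>Y\<rangle> \<otimes> \<langle>Z\<rangle> \<otimes> \<mu>\<^bsub>B\<^esub>) \<bullet> (rho X (TB_tensor K F Y Z) \<otimes> \<langle>B\<rangle>) \<bullet> (\<langle>X\<rangle> \<otimes> rho Y Z))
   \<longleftrightarrow> cocycle_condition" (is "?L \<longleftrightarrow> ?R")
proof
  assume L: ?L
  let ?reg = "regular F B"
  interpret right_comodules K A F B \<sigma> \<omega>inv "select ?reg ?reg ?reg ?reg" "select ?reg ?reg ?reg ?reg" "select \<langle>F\<rangle> \<langle>F\<rangle> \<langle>F\<rangle> \<langle>F\<rangle>" \<sigma> "\<langle>F\<rangle> \<otimes> \<langle>F\<rangle> \<otimes> \<eta>\<^bsub>B\<^esub>"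
    by (rule right_comodules_regular[OF unit_aux])
  let ?l = "(Cell Omega \<boxtimes> cocycle_left) \<odot> delta3 Reg Reg Reg"
  have "sem ((wX oX \<boxtimes> wX oY \<boxtimes> wX oZ \<boxtimes> ?l) \<odot> delta3 oX oY oZ) = sem ((wX oX \<boxtimes> wX oY \<boxtimes> wX oZ \<boxtimes> cocycle_right) \<odot> delta3 oX oY oZ)"
    unfolding associativity_left[symmetric] associativity_right[symmetric]
    using L[rule_format, OF regular_TB regular_TB regular_TB]
    by (simp add: cocycle_diag_def psi_diag_def assoc_diag_def cocycle_XY_Z_def cocycle_X_YZ_def tensor_tF_def
        tensor_coact_def rho_def psi_def TB_tensor_def TB_assoc_def)
  moreover have "sem (delta3 oX oY oZ) = sem (delta3 Reg Reg Reg)"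
    by (simp add: delta3_def)
  ultimately have "sem ((wF \<boxtimes> wF \<boxtimes> wF \<boxtimes> ?l) \<odot> delta3 Reg Reg Reg) = sem ((wF \<boxtimes> wF \<boxtimes> wF \<boxtimes> cocycle_right) \<odot> delta3 Reg Reg Reg)"
    by simp
  then have "sem ?l = sem cocycle_right"
    unfolding associativity_regular[symmetric] sem.simps(4)[of "eps \<boxtimes> eps \<boxtimes> eps \<boxtimes> wB"] by (rule arg_cong)
  from twisted_from_associativity[OF this] show ?R
    by (simp add: cocycle_condition_def twisted_cocycle_right_def cocycle_left_def psi_diag_def mu_M_def psi_def
        mult_M_def beta_def delta3_def Delta3_def)
next
  assume R: ?R
  show ?L
  proof (intro ballI)
    fix X Y Z assume XYZ: "X \<in> C" "Y \<in> C" "Z \<in> C"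
    interpret right_comodules K A F B \<sigma> \<omega>inv "select X Y Z Z" "select X Y Z Z" "select \<langle>X\<rangle> \<langle>Y\<rangle> \<langle>Z\<rangle> \<langle>Z\<rangle>" \<sigma> "\<langle>F\<rangle> \<otimes> \<langle>F\<rangle> \<otimes> \<eta>\<^bsub>B\<^esub>"
      by (rule right_comodules_objects[OF XYZ])
    let ?l = "(Cell Omega \<boxtimes> cocycle_left) \<odot> delta3 Reg Reg Reg"
    have "sem twisted_cocycle_right = sem cocycle_left"
      using R by (simp add: cocycle_condition_def twisted_cocycle_right_def cocycle_left_def psi_diag_def mu_M_def psi_def
        mult_M_def beta_def delta3_def Delta3_def)
    then have "sem ?l = sem cocycle_right"
      by (rule associativity_from_twisted)
    then have "sem ((wX oX \<boxtimes> wX oY \<boxtimes> wX oZ \<boxtimes> ?l) \<odot> delta3 oX oY oZ) = sem ((wX oX \<boxtimes> wX oY \<boxtimes> wX oZ \<boxtimes> cocycle_right) \<odot> delta3 oX oY oZ)"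
      by (simp only: sem.simps(3)[of _ ?l] sem.simps(3) sem.simps(4)[of _ "delta3 oX oY oZ"])
    then show "(TB_assoc K F X Y Z \<otimes> \<mu>\<^bsub>B\<^esub>) \<bullet> (rho (TB_tensor K F X Y) Z \<otimes> \<langle>B\<rangle>)
          \<bullet> (\<langle>X\<rangle> \<otimes> \<langle>Y\<rangle> \<otimes> psi K F B Z) \<bullet> (rho X Y \<otimes> \<langle>Z\<rangle>)
     = (\<langle>X\<rangle> \<otimes> \<langle>Y\<rangle> \<otimes> \<langle>Z\<rangle> \<otimes> \<mu>\<^bsub>B\<^esub>) \<bullet> (rho X (TB_tensor K F Y Z) \<otimes> \<langle>B\<rangle>) \<bullet> (\<langle>X\<rangle> \<otimes> rho Y Z)"
      unfolding associativity_left[symmetric] associativity_right[symmetric]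
      by (simp add: cocycle_diag_def psi_diag_def assoc_diag_def cocycle_XY_Z_def cocycle_X_YZ_def tensor_tF_def
        tensor_coact_def rho_def psi_def TB_tensor_def TB_assoc_def)
  qed
qed

text \<open>Sweedler's last two conditions as simplified by \<open>sigma_unit_left\<close> and
  \<open>sigma_unit_right\<close>.\<close>

definition unit_condition :: bool where
  "unit_condition \<longleftrightarrow> \<sigma> \<bullet> (\<eta>\<^bsub>F\<^esub> \<otimes> \<langle>F\<rangle>) = \<eta>\<^bsub>B\<^esub> \<bullet> \<epsilon>\<^bsub>F\<^esub> \<and> \<sigma> \<bullet> (\<langle>F\<rangle> \<otimes> \<eta>\<^bsub>F\<^esub>) = \<eta>\<^bsub>B\<^esub> \<bullet> \<epsilon>\<^bsub>F\<^esub>"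

lemma unit_iff:
  "(\<forall>X\<in>C. rho X (TB_unit K A F B) = \<langle>X\<rangle> \<otimes> \<eta>\<^bsub>B\<^esub> \<and> rho (TB_unit K A F B) X = \<langle>X\<rangle> \<otimes> \<eta>\<^bsub>B\<^esub>) \<longleftrightarrow> unit_condition"
  (is "?L \<longleftrightarrow> ?R")
proof
  assume L: ?L
  let ?reg = "regular F B"
  interpret right_comodules K A F B \<sigma> \<omega>inv "select ?reg ?reg ?reg ?reg" "select ?reg ?reg ?reg ?reg" "select \<langle>F\<rangle> \<langle>F\<rangle> \<langle>F\<rangle> \<langle>F\<rangle>" \<sigma> "\<langle>F\<rangle> \<otimes> \<langle>F\<rangle> \<otimes> \<eta>\<^bsub>B\<^esub>"
    by (rule right_comodules_regular[OF unit_aux])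
  have "rho ?reg (TB_unit K A F B) = (\<langle>F\<rangle> \<otimes> (\<sigma> \<bullet> (\<langle>F\<rangle> \<otimes> \<eta>\<^bsub>F\<^esub>))) \<bullet> \<Delta>\<^bsub>F\<^esub>"
    "rho (TB_unit K A F B) ?reg = (\<langle>F\<rangle> \<otimes> (\<sigma> \<bullet> (\<eta>\<^bsub>F\<^esub> \<otimes> \<langle>F\<rangle>))) \<bullet> \<Delta>\<^bsub>F\<^esub>"
    using cocycle_right_unit cocycle_left_unit by (simp_all add: rho_def TB_unit_def)
  with L[rule_format, OF regular_TB]
  have "(\<langle>F\<rangle> \<otimes> (\<sigma> \<bullet> (\<langle>F\<rangle> \<otimes> \<eta>\<^bsub>F\<^esub>))) \<bullet> \<Delta>\<^bsub>F\<^esub> = \<langle>F\<rangle> \<otimes> \<eta>\<^bsub>B\<^esub>" "(\<langle>F\<rangle> \<otimes> (\<sigma> \<bullet> (\<eta>\<^bsub>F\<^esub> \<otimes> \<langle>F\<rangle>))) \<bullet> \<Delta>\<^bsub>F\<^esub> = \<langle>F\<rangle> \<otimes> \<eta>\<^bsub>B\<^esub>"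
    by (simp_all only: regular_simps)
  then show ?R
    using counit_sigma_unit by (simp add: unit_condition_def)
next
  assume R: ?R
  show ?L
  proof (rule ballI)
    fix X assume X: "X \<in> C"
    interpret right_comodules K A F B \<sigma> \<omega>inv "select X X X X" "select X X X X" "select \<langle>X\<rangle> \<langle>X\<rangle> \<langle>X\<rangle> \<langle>X\<rangle>" \<sigma> "\<langle>F\<rangle> \<otimes> \<langle>F\<rangle> \<otimes> \<eta>\<^bsub>B\<^esub>"
      by (rule right_comodules_objects[OF X X X])
    show "rho X (TB_unit K A F B) = \<langle>X\<rangle> \<otimes> \<eta>\<^bsub>B\<^esub> \<and> rho (TB_unit K A F B) X = \<langle>X\<rangle> \<otimes> \<eta>\<^bsub>B\<^esub>"
      using R cocycle_right_unit cocycle_left_unit unit_coact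
      by (simp add: rho_def TB_unit_def unit_condition_def)
  qed
qed

text \<open>The typing clause and (i) hold throughout the setting; each of (ii)-(v) has been
  translated separately.\<close>

lemma two_cocycle_iff:
  "EM_two_cocycle K A F B rho \<longleftrightarrow>
     conv_invertible_FF K F B \<sigma> \<and> module_condition \<and> cocycle_condition \<and> unit_condition"
  unfolding EM_two_cocycle_def Let_def invertible_iff linearity_iff associativity_iff unit_iff
  using rho_hom rho_natural by simp

text \<open>Typing, the two action equations, the fourth condition and the 3-cocycle property of
  \<beta> hold throughout the setting, as does the identification of \<sigma>; what remains are
  three equations on \<sigma>.\<close>

lemma hopf_datum_iff:
  "sweedler_hopf_datum K A (left_Tambara K A F) (left_regular F) B (cell F) psi_F mult_M (\<eta>\<^bsub>F\<^esub> \<otimes> \<eta>\<^bsub>B\<^esub>) \<epsilon>\<^bsub>F\<^esub> beta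
     \<and> sweedler_cocycle K B mult_M \<epsilon>\<^bsub>F\<^esub> = \<sigma>
   \<longleftrightarrow> module_condition \<and> cocycle_condition \<and> unit_condition"
proof -
  let ?reg = "regular F B"
  interpret right_comodules K A F B \<sigma> \<omega>inv "select ?reg ?reg ?reg ?reg" "select ?reg ?reg ?reg ?reg" "select \<langle>F\<rangle> \<langle>F\<rangle> \<langle>F\<rangle> \<langle>F\<rangle>" \<sigma> "\<langle>F\<rangle> \<otimes> \<langle>F\<rangle> \<otimes> \<eta>\<^bsub>B\<^esub>"
    by (rule right_comodules_regular[OF unit_aux])
  \<comment> \<open>With this identification Sweedler's first two conditions become the defining
    equations of a module monad.\<close>
  have action: "(\<epsilon>\<^bsub>F\<^esub> \<otimes> \<langle>B\<rangle>) \<bullet> psi_F = \<lhd>\<^bsub>B\<^esub>"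
    and assoc: "\<mu>\<^bsub>B\<^esub> \<bullet> (\<lhd>\<^bsub>B\<^esub> \<otimes> \<langle>B\<rangle>) \<bullet> (\<langle>B\<rangle> \<otimes> psi_F) = \<lhd>\<^bsub>B\<^esub> \<bullet> (\<mu>\<^bsub>B\<^esub> \<otimes> \<langle>F\<rangle>)"
    using module_monad unfolding right_module_monad_def Let_def by metis+
  have sigma_eq: "sweedler_cocycle K B mult_M \<epsilon>\<^bsub>F\<^esub> = \<sigma>"
    using sweedler_sigma by (simp add: sweedler_cocycle_def mult_M_def mu_M_def)
  have psi: "psi_F = sem (psi_diag Reg)" and mult: "mult_M = sem mu_M" and eta: "\<eta>\<^bsub>F\<^esub> \<otimes> \<eta>\<^bsub>B\<^esub> = sem eta_M"
    by (simp_all add: psi_def psi_diag_def mult_M_def mu_M_def eta_M_def)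
  have homs: "psi_F \<in> Hom (cell B \<star> cell F) (cell F \<star> cell B)" "mult_M \<in> Hom (cell F \<star> cell F) (cell F \<star> cell B)"
    "\<eta>\<^bsub>F\<^esub> \<otimes> \<eta>\<^bsub>B\<^esub> \<in> Hom (id1 K A) (cell F \<star> cell B)" "\<epsilon>\<^bsub>F\<^esub> \<in> Hom (cell F) (id1 K A)"
    unfolding psi mult eta
    using sem_cells[of "psi_diag Reg"] sem_cells[of mu_M] sem_cells[of eta_M] sem_cells[of eps]
    by (simp_all add: psi_diag_def mu_M_def eta_M_def)
  have beta: "beta = left_omega \<omega>inv (left_regular F) (left_regular F) (left_regular F)"
    by (simp add: beta_def left_omega_def Delta3_def left_regular_def)
  have beta_hom: "beta \<in> Hom (cell F \<star> cell F \<star> cell F) (cell F \<star> cell F \<star> cell F)"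
    unfolding beta
    using left_omega_inverse(1)[of "left_regular F" "left_regular F" "left_regular F"]
      left_comodule_Tambara[OF left_regular_Tambara] by (simp add: left_regular_def)
  have cocycle: "three_cocycle_on K (left_Tambara K A F) (left_regular F) beta"
    "under (left_Tambara K A F) (left_regular F) = cell F"
    unfolding three_cocycle_on_def beta
    using left_omega_three_cocycle left_regular_Tambara by (auto simp: left_Tambara_def left_regular_def)
  have units: "\<mu>\<^bsub>B\<^esub> \<bullet> (\<epsilon>\<^bsub>F\<^esub> \<otimes> \<langle>B\<rangle> \<otimes> \<langle>B\<rangle>) \<bullet> ((\<eta>\<^bsub>F\<^esub> \<otimes> \<eta>\<^bsub>B\<^esub>) \<otimes> \<langle>B\<rangle>) = \<mu>\<^bsub>B\<^esub> \<bullet> (\<lhd>\<^bsub>B\<^esub> \<otimes> \<langle>B\<rangle>) \<bullet> (\<langle>B\<rangle> \<otimes> \<eta>\<^bsub>F\<^esub> \<otimes> \<eta>\<^bsub>B\<^esub>)"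
    "\<mu>\<^bsub>B\<^esub> \<bullet> (\<sigma> \<otimes> \<langle>B\<rangle>) \<bullet> (\<langle>F\<rangle> \<otimes> psi_F) \<bullet> ((\<eta>\<^bsub>F\<^esub> \<otimes> \<eta>\<^bsub>B\<^esub>) \<otimes> \<langle>F\<rangle>) = \<sigma> \<bullet> (\<eta>\<^bsub>F\<^esub> \<otimes> \<langle>F\<rangle>)"
    "\<mu>\<^bsub>B\<^esub> \<bullet> (\<sigma> \<otimes> \<langle>B\<rangle>) \<bullet> (\<langle>F\<rangle> \<otimes> \<eta>\<^bsub>F\<^esub> \<otimes> \<eta>\<^bsub>B\<^esub>) = \<sigma> \<bullet> (\<langle>F\<rangle> \<otimes> \<eta>\<^bsub>F\<^esub>)"
    using eta_M_central sigma_unit_left sigma_unit_right by (simp_all add: eta_M_def psi_def psi_diag_def)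
  show ?thesis
    unfolding sweedler_hopf_datum_def Let_def action sigma_eq units
    using monad_B F_endo homs beta_hom cocycle assoc act_unit
    by (auto simp: module_condition_def cocycle_condition_def unit_condition_def)
qed

end

theorem proposition5p2:
  fixes K :: "('o, 'c, 'd) two_cat" (structure) and A :: 'o
    and F :: "('c, 'd) coquasi_data" and B :: "('c, 'd) module_data"
    and \<sigma> \<omega>inv :: 'd
  assumes "two_category K" and "A \<in> zero_cells K"
    and "CQB_zero_cell K A F"
    and "right_module_monad K A F B"
    and "TB_setting K A F B"
    and "\<sigma> \<in> Hom (cell F \<star> cell F) (cell B)"
    and "\<And>X. X \<in> TB_objects K A F B \<Longrightarrow>
      (\<langle>X\<rangle> \<otimes> \<sigma>) \<bullet> (tauF X \<otimes> \<langle>F\<rangle>) \<bullet> (\<langle>F\<rangle> \<otimes> tauF X) = tauB X \<bullet> (\<sigma> \<otimes> \<langle>X\<rangle>)"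
    and "omega_inverse K A F \<omega>inv"
  defines "\<psi> \<equiv> psi K F B (regular F B)"
    and "\<mu>M \<equiv> (\<mu>\<^bsub>F\<^esub> \<otimes> \<sigma>) \<bullet> (\<langle>F\<rangle> \<otimes> \<tau>\<^bsub>F\<^esub> \<otimes> \<langle>F\<rangle>) \<bullet> (\<Delta>\<^bsub>F\<^esub> \<otimes> \<Delta>\<^bsub>F\<^esub>)"
    and "\<eta>M \<equiv> \<eta>\<^bsub>F\<^esub> \<otimes> \<eta>\<^bsub>B\<^esub>"
    and "\<beta> \<equiv> (\<omega>inv \<otimes> \<langle>F\<rangle> \<otimes> \<langle>F\<rangle> \<otimes> \<langle>F\<rangle>) \<bullet> Delta3 K F"
  shows "EM_two_cocycle K A F B
      (\<lambda>X Y. (\<langle>X\<rangle> \<otimes> \<langle>Y\<rangle> \<otimes> \<sigma>) \<bullet> (\<langle>X\<rangle> \<otimes> tauF Y \<otimes> \<langle>F\<rangle>) \<bullet> (\<rho>\<^bsub>X\<^esub> \<otimes> \<rho>\<^bsub>Y\<^esub>))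
    \<longleftrightarrow> sweedler_hopf_datum K A (left_Tambara K A F) (left_regular F) B (cell F) \<psi> \<mu>M \<eta>M \<epsilon>\<^bsub>F\<^esub> \<beta>
        \<and> sweedler_cocycle K B \<mu>M \<epsilon>\<^bsub>F\<^esub> = \<sigma> \<and> conv_invertible_FF K F B \<sigma>"
proof -
  interpret S: sweedler_setting K A F B \<sigma> \<omega>inv
    using assms(1-8) by (simp add: sweedler_setting_def sweedler_setting_axioms_def)
  have "(\<lambda>X Y. (\<langle>X\<rangle> \<otimes> \<langle>Y\<rangle> \<otimes> \<sigma>) \<bullet> (\<langle>X\<rangle> \<otimes> tauF Y \<otimes> \<langle>F\<rangle>) \<bullet> (\<rho>\<^bsub>X\<^esub> \<otimes> \<rho>\<^bsub>Y\<^esub>)) = S.rho"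
    by (intro ext) (simp add: S.rho_def)
  then show ?thesis
    using S.two_cocycle_iff S.hopf_datum_iff
    by (simp only: \<psi>_def \<mu>M_def \<eta>M_def \<beta>_def S.mult_M_def[symmetric] S.beta_def[symmetric]) blast
qed

end
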